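(* Suppose $n$ is an odd integer with $n\geq t_1+t_2+t_3$, and put $K=k_1+k_2+k_3$, $N=\tfrac{n+1}{2}$, $\mathscr M=\mathscr M_n(x_1)\cap\mathscr M_n(x_2)\cap\mathscr M_n(x_3)$. Let $W_0=O_{n-t_1-t_2-t_3}(k_1+N,\,k_2+N,\,k_3+N)$, $A=O_{t_1-1}(-K-n-1,\,k_3,\,k_2)$, $B=O_{t_2-1}(k_3,\,-K-n-1,\,k_1)$, $C=O_{t_3-1}(k_2,\,k_1,\,-K-n-1)$. Then, as $\mathfrak{BI}$-modules: (i) $\mathscr M\cong W_0\oplus W_0$; (ii) $\mathscr M_n/\mathscr M_n(x_1)\cong A\oplus A$; (iii) $\mathscr M_n/\mathscr M_n(x_2)\cong B\oplus B$; (iv) $\mathscr M_n/\mathscr M_n(x_3)\cong C\oplus C$; (v) $\mathscr M_n(x_1)/\mathscr M\cong B\oplus B\oplus C\oplus C$; (vi) $\mathscr M_n(x_2)/\mathscr M\cong A\oplus A\oplus C\oplus C$; (vii) $\mathscr M_n(x_3)/\mathscr M\cong A\oplus A\oplus B\oplus B$. Moreover, $W_0,A,B,C$ are irreducible.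
   Context: Fix real numbers $k_1,k_2,k_3$. For $i=1,2,3$ let $R_i$ be the operator on functions on $\mathbb R^3$ replacing $x_i$ by $-x_i$, and $T_if=\frac{\partial f}{\partial x_i}+k_i\frac{f-R_if}{x_i}$ (Dunkl operators). Let $\sigma_1=\begin{pmatrix}0&1\\1&0\end{pmatrix}$, $\sigma_2=\begin{pmatrix}0&-\sqrt{-1}\\ \sqrt{-1}&0\end{pmatrix}$, $\sigma_3=\begin{pmatrix}1&0\\0&-1\end{pmatrix}$, and let $e_i$ act on $\mathbb C^2$ by $\sigma_i$. Tensor products are over $\mathbb R$; $\mathbb R[\cdots]_m$ denotes homogeneous polynomials of degree $m$. Let $\mathbf D=e_1\otimes T_1+e_2\otimes T_2+e_3\otimes T_3$ and $\mathscr M_n=\ker(\mathbf D|_{\mathbb C^2\otimes\mathbb R[x_1,x_2,x_3]_n})$. For $i=1,2,3$ set $t_i=-2k_i$ if $2k_i$ is an odd negative integer, and $t_i=\infty$ otherwise. For $i=1,2,3$, $\mathscr M_n(x_i)=\mathscr M_n\cap\bigoplus_{j=t_i}^n\mathbb C^2\otimes(x_i^j\cdot\mathbb R[x_p,x_q]_{n-j})$ where $\{p,q\}=\{1,2,3\}\setminus\{i\}$ (it is $\{0\}$ if $n<t_i$); it is a $\mathfrak{BI}$-submodule of $\mathscr M_n$. $\mathfrak{BI}$ is the unital associative $\mathbb C$-algebra generated by $X,Y,Z$ with relations saying that $\{X,Y\}-Z$, $\{Y,Z\}-X$, $\{Z,X\}-Y$ commute with $X,Y,Z$ ($\{A,B\}=AB+BA$).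 $\mathscr M_n$ is a $\mathfrak{BI}$-module via $X=(\sqrt{-1}\,e_1\otimes(x_3T_2-x_2T_3)+\tfrac12)R_2R_3+k_2R_3+k_3R_2$, $Y=(\sqrt{-1}\,e_2\otimes(x_1T_3-x_3T_1)+\tfrac12)R_1R_3+k_3R_1+k_1R_3$, $Z=(\sqrt{-1}\,e_3\otimes(x_2T_1-x_1T_2)+\tfrac12)R_1R_2+k_1R_2+k_2R_1$, operators composed right to left, $R_i$ acting on the polynomial factor. For $a,b,c\in\mathbb C$ and even $d\geq0$, $O_d(a,b,c)$ is the $\mathfrak{BI}$-module $\mathbb C^{d+1}$ in which, w.r.t. a basis $v_0,\dots,v_d$, $X$ acts by the lower bidiagonal matrix with diagonal $(\theta_0,\dots,\theta_d)$ and subdiagonal entries $1$, $Y$ by the upper bidiagonal matrix with diagonal $(\theta^*_0,\dots,\theta^*_d)$ and superdiagonal $(\varphi_1,\dots,\varphi_d)$, and $Z=\{X,Y\}-(2ab-c(d+1))$, where $\theta_i=\frac{(-1)^i(2a-d+2i)}{2}$, $\theta^*_i=\frac{(-1)^i(2b-d+2i)}{2}$, $\varphi_i=\frac{i(d+1-2i-2a-2b-2c)}{2}$ ($i$ even), $\varphi_i=\frac{(i-d-1)(d+1-2i-2a-2b+2c)}{2}$ ($i$ odd). *)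

theory Defs
  imports Complex_Main "HOL-Library.Extended_Nat"
begin

definition vzero :: "'i \<Rightarrow> complex" where "vzero = (\<lambda>_. 0)"
definition vadd :: "('i \<Rightarrow> complex) \<Rightarrow> ('i \<Rightarrow> complex) \<Rightarrow> 'i \<Rightarrow> complex"
  where "vadd u v = (\<lambda>i. u i + v i)"
definition vsmul :: "complex \<Rightarrow> ('i \<Rightarrow> complex) \<Rightarrow> 'i \<Rightarrow> complex"
  where "vsmul c u = (\<lambda>i. c * u i)"

definition vsubspace :: "('i \<Rightarrow> complex) set \<Rightarrow> bool" where
  "vsubspace S \<longleftrightarrow> vzero \<in> S \<and> (\<forall>u\<in>S. \<forall>v\<in>S. vadd u v \<in> S) \<and> (\<forall>c. \<forall>u\<in>S. vsmul c u \<in> S)"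

definition lin_on :: "('i \<Rightarrow> complex) set \<Rightarrow> (('i \<Rightarrow> complex) \<Rightarrow> ('j \<Rightarrow> complex)) \<Rightarrow> bool" where
  "lin_on S f \<longleftrightarrow> (\<forall>u\<in>S. \<forall>v\<in>S. f (vadd u v) = vadd (f u) (f v)) \<and> (\<forall>c. \<forall>u\<in>S. f (vsmul c u) = vsmul c (f u))"

record 'i bimod =
  bm_carrier :: "('i \<Rightarrow> complex) set"
  bm_X :: "('i \<Rightarrow> complex) \<Rightarrow> ('i \<Rightarrow> complex)"
  bm_Y :: "('i \<Rightarrow> complex) \<Rightarrow> ('i \<Rightarrow> complex)"
  bm_Z :: "('i \<Rightarrow> complex) \<Rightarrow> ('i \<Rightarrow> complex)"

definition bm_hom :: "(('i \<Rightarrow> complex) \<Rightarrow> ('j \<Rightarrow> complex)) \<Rightarrow> 'i bimod \<Rightarrow> 'j bimod \<Rightarrow> bool" where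
  "bm_hom f V W \<longleftrightarrow> (\<forall>v\<in>bm_carrier V. f v \<in> bm_carrier W) \<and> lin_on (bm_carrier V) f \<and>
     (\<forall>v\<in>bm_carrier V. f (bm_X V v) = bm_X W (f v) \<and> f (bm_Y V v) = bm_Y W (f v)
        \<and> f (bm_Z V v) = bm_Z W (f v))"

definition bm_iso :: "(('i \<Rightarrow> complex) \<Rightarrow> ('j \<Rightarrow> complex)) \<Rightarrow> 'i bimod \<Rightarrow> 'j bimod \<Rightarrow> bool" where
  "bm_iso f V W \<longleftrightarrow> bm_hom f V W \<and> bij_betw f (bm_carrier V) (bm_carrier W)"

definition bm_isomorphic :: "'i bimod \<Rightarrow> 'j bimod \<Rightarrow> bool" where
  "bm_isomorphic V W \<longleftrightarrow> (\<exists>f. bm_iso f V W)"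

definition bm_quot_isomorphic :: "'i bimod \<Rightarrow> ('i \<Rightarrow> complex) set \<Rightarrow> 'j bimod \<Rightarrow> bool" where
  "bm_quot_isomorphic V U W \<longleftrightarrow> (\<exists>f. bm_hom f V W \<and> f ` bm_carrier V = bm_carrier W \<and>
      {v \<in> bm_carrier V. f v = vzero} = U)"

definition bm_irreducible :: "'i bimod \<Rightarrow> bool" where
  "bm_irreducible W \<longleftrightarrow> bm_carrier W \<noteq> {vzero} \<and>
     (\<forall>U. U \<subseteq> bm_carrier W \<and> vsubspace U \<and> (\<forall>u\<in>U. bm_X W u \<in> U \<and> bm_Y W u \<in> U \<and> bm_Z W u \<in> U)
        \<longrightarrow> U = {vzero} \<or> U = bm_carrier W)"

definition sumop :: "(('i \<Rightarrow> complex) \<Rightarrow> ('i \<Rightarrow> complex)) \<Rightarrow> (('j \<Rightarrow> complex) \<Rightarrow> ('j \<Rightarrow> complex))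
   \<Rightarrow> ('i + 'j \<Rightarrow> complex) \<Rightarrow> ('i + 'j \<Rightarrow> complex)" where
  "sumop f g u = (\<lambda>x. case x of Inl i \<Rightarrow> f (\<lambda>i. u (Inl i)) i | Inr j \<Rightarrow> g (\<lambda>j. u (Inr j)) j)"

definition dsum :: "'i bimod \<Rightarrow> 'j bimod \<Rightarrow> ('i + 'j) bimod" where
  "dsum V W = \<lparr>bm_carrier = {u. (\<lambda>i. u (Inl i)) \<in> bm_carrier V \<and> (\<lambda>j. u (Inr j)) \<in> bm_carrier W},
     bm_X = sumop (bm_X V) (bm_X W), bm_Y = sumop (bm_Y V) (bm_Y W), bm_Z = sumop (bm_Z V) (bm_Z W)\<rparr>"

definition O_theta :: "nat \<Rightarrow> complex \<Rightarrow> nat \<Rightarrow> complex" where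
  "O_theta d a i = (-1) ^ i * (2 * a - of_nat d + 2 * of_nat i) / 2"

definition O_phi :: "nat \<Rightarrow> complex \<Rightarrow> complex \<Rightarrow> complex \<Rightarrow> nat \<Rightarrow> complex" where
  "O_phi d a b c i = (if even i then of_nat i * (of_nat d + 1 - 2 * of_nat i - 2 * a - 2 * b - 2 * c) / 2
      else (of_nat i - of_nat d - 1) * (of_nat d + 1 - 2 * of_nat i - 2 * a - 2 * b + 2 * c) / 2)"

text \<open>X: lower bidiagonal, X v_j = theta_j v_j + v_(j+1).\<close>
definition O_X :: "nat \<Rightarrow> complex \<Rightarrow> (nat \<Rightarrow> complex) \<Rightarrow> nat \<Rightarrow> complex" where
  "O_X d a u = (\<lambda>i. if i \<le> d then O_theta d a i * u i + (if 1 \<le> i then u (i - 1) else 0) else 0)"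

text \<open>Y: upper bidiagonal, diagonal theta*, (i-1,i) entry phi_i.\<close>
definition O_Y :: "nat \<Rightarrow> complex \<Rightarrow> complex \<Rightarrow> complex \<Rightarrow> (nat \<Rightarrow> complex) \<Rightarrow> nat \<Rightarrow> complex" where
  "O_Y d a b c u = (\<lambda>i. if i \<le> d then O_theta d b i * u i + (if i < d then O_phi d a b c (i + 1) * u (i + 1) else 0) else 0)"

definition Omod :: "nat \<Rightarrow> complex \<Rightarrow> complex \<Rightarrow> complex \<Rightarrow> nat bimod" where
  "Omod d a b c = \<lparr>bm_carrier = {u. \<forall>i>d. u i = 0},
     bm_X = O_X d a, bm_Y = O_Y d a b c,
     bm_Z = (\<lambda>u. vadd (O_X d a (O_Y d a b c u)) (vadd (O_Y d a b c (O_X d a u))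
               (vsmul (- (2 * a * b - c * (of_nat d + 1))) u)))\<rparr>"

section \<open>C^2 (x) R[x1,x2,x3]: coefficient functions.
  f (s,a,b,c) = coefficient of  e_s (x) x1^a x2^b x3^c, s = False / True the first / second
  standard basis vector of C^2.\<close>

type_synonym cpol = "bool \<times> nat \<times> nat \<times> nat \<Rightarrow> complex"

text \<open>T x^m = (m + k(1-(-1)^m)) x^(m-1) in one variable.\<close>
definition dk :: "real \<Rightarrow> nat \<Rightarrow> complex" where
  "dk k m = of_nat m + (if odd m then 2 * complex_of_real k else 0)"

definition T1 :: "real \<Rightarrow> cpol \<Rightarrow> cpol" where
  "T1 k f = (\<lambda>(s,a,b,c). dk k (Suc a) * f (s, Suc a, b, c))"
definition T2 :: "real \<Rightarrow> cpol \<Rightarrow> cpol" where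
  "T2 k f = (\<lambda>(s,a,b,c). dk k (Suc b) * f (s, a, Suc b, c))"
definition T3 :: "real \<Rightarrow> cpol \<Rightarrow> cpol" where
  "T3 k f = (\<lambda>(s,a,b,c). dk k (Suc c) * f (s, a, b, Suc c))"

definition mx1 :: "cpol \<Rightarrow> cpol" where
  "mx1 f = (\<lambda>(s,a,b,c). if a = 0 then 0 else f (s, a - 1, b, c))"
definition mx2 :: "cpol \<Rightarrow> cpol" where
  "mx2 f = (\<lambda>(s,a,b,c). if b = 0 then 0 else f (s, a, b - 1, c))"
definition mx3 :: "cpol \<Rightarrow> cpol" where
  "mx3 f = (\<lambda>(s,a,b,c). if c = 0 then 0 else f (s, a, b, c - 1))"

definition R1 :: "cpol \<Rightarrow> cpol" where
  "R1 f = (\<lambda>(s,a,b,c). (-1) ^ a * f (s, a, b, c))"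
definition R2 :: "cpol \<Rightarrow> cpol" where
  "R2 f = (\<lambda>(s,a,b,c). (-1) ^ b * f (s, a, b, c))"
definition R3 :: "cpol \<Rightarrow> cpol" where
  "R3 f = (\<lambda>(s,a,b,c). (-1) ^ c * f (s, a, b, c))"

definition sig1 :: "cpol \<Rightarrow> cpol" where
  "sig1 f = (\<lambda>(s,p). f (\<not> s, p))"
definition sig2 :: "cpol \<Rightarrow> cpol" where
  "sig2 f = (\<lambda>(s,p). if s then \<i> * f (False, p) else - \<i> * f (True, p))"
definition sig3 :: "cpol \<Rightarrow> cpol" where
  "sig3 f = (\<lambda>(s,p). if s then - f (s, p) else f (s, p))"

definition Dirac :: "real \<Rightarrow> real \<Rightarrow> real \<Rightarrow> cpol \<Rightarrow> cpol" where
  "Dirac k1 k2 k3 f = vadd (sig1 (T1 k1 f)) (vadd (sig2 (T2 k2 f)) (sig3 (T3 k3 f)))"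

definition homog :: "nat \<Rightarrow> cpol \<Rightarrow> bool" where
  "homog n f \<longleftrightarrow> (\<forall>s a b c. a + b + c \<noteq> n \<longrightarrow> f (s, a, b, c) = 0)"

definition Mn :: "real \<Rightarrow> real \<Rightarrow> real \<Rightarrow> nat \<Rightarrow> cpol set" where
  "Mn k1 k2 k3 n = {f. homog n f \<and> Dirac k1 k2 k3 f = vzero}"

definition tpar :: "real \<Rightarrow> enat" where
  "tpar k = (if \<exists>m::nat. odd m \<and> 2 * k = - real m then enat (nat \<lfloor>- 2 * k\<rfloor>) else \<infinity>)"

definition Mnx1 :: "real \<Rightarrow> real \<Rightarrow> real \<Rightarrow> nat \<Rightarrow> cpol set" where
  "Mnx1 k1 k2 k3 n = Mn k1 k2 k3 n \<inter> {f. \<forall>s a b c. enat a < tpar k1 \<longrightarrow> f (s, a, b, c) = 0}"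
definition Mnx2 :: "real \<Rightarrow> real \<Rightarrow> real \<Rightarrow> nat \<Rightarrow> cpol set" where
  "Mnx2 k1 k2 k3 n = Mn k1 k2 k3 n \<inter> {f. \<forall>s a b c. enat b < tpar k2 \<longrightarrow> f (s, a, b, c) = 0}"
definition Mnx3 :: "real \<Rightarrow> real \<Rightarrow> real \<Rightarrow> nat \<Rightarrow> cpol set" where
  "Mnx3 k1 k2 k3 n = Mn k1 k2 k3 n \<inter> {f. \<forall>s a b c. enat c < tpar k3 \<longrightarrow> f (s, a, b, c) = 0}"

definition BX :: "real \<Rightarrow> real \<Rightarrow> real \<Rightarrow> cpol \<Rightarrow> cpol" where
  "BX k1 k2 k3 f = (let g = R2 (R3 f) in
     vadd (vsmul \<i> (sig1 (vadd (mx3 (T2 k2 g)) (vsmul (-1) (mx2 (T3 k3 g))))))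
       (vadd (vsmul (1/2) g) (vadd (vsmul (complex_of_real k2) (R3 f)) (vsmul (complex_of_real k3) (R2 f)))))"
definition BY :: "real \<Rightarrow> real \<Rightarrow> real \<Rightarrow> cpol \<Rightarrow> cpol" where
  "BY k1 k2 k3 f = (let g = R1 (R3 f) in
     vadd (vsmul \<i> (sig2 (vadd (mx1 (T3 k3 g)) (vsmul (-1) (mx3 (T1 k1 g))))))
       (vadd (vsmul (1/2) g) (vadd (vsmul (complex_of_real k3) (R1 f)) (vsmul (complex_of_real k1) (R3 f)))))"
definition BZ :: "real \<Rightarrow> real \<Rightarrow> real \<Rightarrow> cpol \<Rightarrow> cpol" where
  "BZ k1 k2 k3 f = (let g = R1 (R2 f) in
     vadd (vsmul \<i> (sig3 (vadd (mx2 (T1 k1 g)) (vsmul (-1) (mx1 (T2 k2 g))))))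
       (vadd (vsmul (1/2) g) (vadd (vsmul (complex_of_real k1) (R2 f)) (vsmul (complex_of_real k2) (R1 f)))))"

definition DM :: "real \<Rightarrow> real \<Rightarrow> real \<Rightarrow> cpol set \<Rightarrow> (bool \<times> nat \<times> nat \<times> nat) bimod" where
  "DM k1 k2 k3 S = \<lparr>bm_carrier = S, bm_X = BX k1 k2 k3, bm_Y = BY k1 k2 k3, bm_Z = BZ k1 k2 k3\<rparr>"

end

theory Submission
  imports Defs
begin

text \<open>
  All three \<open>t\<^sub>i\<close> are finite, so \<open>k\<^sub>i = - t\<^sub>i / 2\<close> and \<open>T\<^sub>i\<close> kills exactly the powers \<open>x\<^sub>i\<^sup>0\<close> and \<open>x\<^sub>i^t\<^sub>i\<close>. An element of
  \<open>Mn\<close> modulo \<open>Mnx1\<close>, modulo \<open>Mnx2\<close>, modulo \<open>Mnx3\<close>, and an element of the triple intersection, is determined by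
  finitely many coefficients, all of degree \<open>t\<^sub>3\<close> in \<open>x\<^sub>3\<close> or all of degree \<open>t\<^sub>1\<close> in \<open>x\<^sub>1\<close>, and these can be prescribed freely by
  solving the Dirac equation as a recursion away from that layer. On such coefficients \<open>X\<close> and \<open>Y\<close> act by tridiagonal or
  bidiagonal matrices. The Bannai--Ito relations turn them into the split form that defines \<open>O_d(a,b,c)\<close>; the two spin
  values give the two copies. A lift for one quotient can be chosen inside the two other submodules, which gives
  the quotients with four summands.
\<close>

text \<open>No basis is built inside the polynomial modules. Everything is read through coefficient
  functionals, since a quotient map is a family of functionals and surjectivity means prescribing
  their values. The obstacle is the quotient by \<open>Mnx3\<close>. Divisibility by
  \<open>x3\<close> is invisible in the layer of degree \<open>t3\<close> in \<open>x3\<close>: that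
  layer can be zero while lower ones are not. So this quotient is read in the layer of degree
  \<open>t1\<close> in \<open>x1\<close>, where \<open>X\<close> is only tridiagonal. The chain
  argument is therefore made for tridiagonal operators, and asks only for the first two eigenvalues
  on one side and one off-diagonal value; a cubic relation supplies the rest. The parameters come
  from the scalars by which \<open>{X,Y}-Z\<close>, \<open>{Y,Z}-X\<close>, \<open>{Z,X}-Y\<close>
  act in odd degree: \<open>2 k1 k2 - 2 k3 (K+n+1)\<close> and its analogues. They must equal
  \<open>2ab - c(d+1)\<close>, \<open>2bc - a(d+1)\<close>, \<open>2ac - b(d+1)\<close>; for
  \<open>A\<close>, \<open>B\<close>, \<open>C\<close> this fits because
  \<open>d + 1 = t_i = -2 k_i\<close>. Irreducibility is also proved on polynomials and transported
  along the surjections onto the standard modules.\<close>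

section \<open>Coefficient form of the operators\<close>

text \<open>Coefficients are extended by zero to integer exponents. Since \<open>dki k 0 = 0\<close>, all operators below are then
  given by one formula without boundary cases.\<close>

definition cf :: "cpol \<Rightarrow> bool \<Rightarrow> int \<Rightarrow> int \<Rightarrow> int \<Rightarrow> complex" where
  "cf f s a b c = (if a < 0 \<or> b < 0 \<or> c < 0 then 0 else f (s, nat a, nat b, nat c))"

definition sg :: "int \<Rightarrow> complex" where "sg m = (if even m then 1 else -1)"
definition sp :: "bool \<Rightarrow> complex" where "sp s = (if s then -1 else 1)"
definition dki :: "real \<Rightarrow> int \<Rightarrow> complex" where
  "dki k m = of_int m + (if odd m then 2 * of_real k else 0)"

type_synonym coeffs = "bool \<Rightarrow> int \<Rightarrow> int \<Rightarrow> int \<Rightarrow> complex"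

definition X_cf :: "real \<Rightarrow> real \<Rightarrow> coeffs \<Rightarrow> coeffs" where
  "X_cf k2 k3 F s a b c =
     sg (b + c) * (\<i> * (dki k2 (b + 1) * F (\<not> s) a (b + 1) (c - 1) - dki k3 (c + 1) * F (\<not> s) a (b - 1) (c + 1)) + F s a b c / 2)
     + (k2 * sg c + k3 * sg b) * F s a b c"
definition Y_cf :: "real \<Rightarrow> real \<Rightarrow> coeffs \<Rightarrow> coeffs" where
  "Y_cf k1 k3 F s a b c =
     sg (a + c) * (sp s * (dki k3 (c + 1) * F (\<not> s) (a - 1) b (c + 1) - dki k1 (a + 1) * F (\<not> s) (a + 1) b (c - 1)) + F s a b c / 2)
     + (k3 * sg a + k1 * sg c) * F s a b c"
definition Z_cf :: "real \<Rightarrow> real \<Rightarrow> coeffs \<Rightarrow> coeffs" where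
  "Z_cf k1 k2 F s a b c =
     sg (a + b) * (\<i> * sp s * (dki k1 (a + 1) * F s (a + 1) (b - 1) c - dki k2 (b + 1) * F s (a - 1) (b + 1) c) + F s a b c / 2)
     + (k1 * sg b + k2 * sg a) * F s a b c"
definition D_cf :: "real \<Rightarrow> real \<Rightarrow> real \<Rightarrow> coeffs \<Rightarrow> coeffs" where
  "D_cf k1 k2 k3 F s a b c =
     dki k1 (a + 1) * F (\<not> s) (a + 1) b c - \<i> * sp s * dki k2 (b + 1) * F (\<not> s) a (b + 1) c
     + sp s * dki k3 (c + 1) * F s a b (c + 1)"
text \<open>Multiplication by the vector variable \<open>e1 x1 + e2 x2 + e3 x3\<close>.\<close>

definition x_cf :: "coeffs \<Rightarrow> coeffs" where
  "x_cf F s a b c = F (\<not> s) (a - 1) b c - \<i> * sp s * F (\<not> s) a (b - 1) c + sp s * F s a b (c - 1)"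

lemma dki_zero[simp]: "dki k 0 = 0" by (simp add: dki_def)
lemma dki_nat: "dki k (int m) = dk k m" by (simp add: dki_def dk_def)
lemma sg_add: "sg (a + b) = sg a * sg b" by (simp add: sg_def)
lemma sg_simps[simp]: "sg (a + 1) = - sg a" "sg (a - 1) = - sg a" by (simp_all add: sg_def)

lemma cf_neg[simp]: "a < 0 \<Longrightarrow> cf f s a b c = 0" "b < 0 \<Longrightarrow> cf f s a b c = 0" "c < 0 \<Longrightarrow> cf f s a b c = 0"
  by (auto simp: cf_def)

lemma cf_eqI: assumes "\<And>s a b c. cf f s a b c = cf g s a b c" shows "f = g"
proof
  fix p :: "bool \<times> nat \<times> nat \<times> nat"
  obtain s a b c where p: "p = (s,a,b,c)" by (metis prod_cases4)
  have "cf f s (int a) (int b) (int c) = cf g s (int a) (int b) (int c)" by (rule assms)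
  then show "f p = g p" by (simp add: cf_def p)
qed

lemma cf_int[simp]: "cf f s (int a) (int b) (int c) = f (s, a, b, c)"
  by (simp add: cf_def)
lemma cf_Suc[simp]:
  "cf f s (int a + 1) (int b) (int c) = f (s, Suc a, b, c)"
  "cf f s (int a) (int b + 1) (int c) = f (s, a, Suc b, c)"
  "cf f s (int a) (int b) (int c + 1) = f (s, a, b, Suc c)"
  "cf f s (int a + 1) (int b) (int c - 1) = (if c = 0 then 0 else f (s, Suc a, b, c - 1))"
  "cf f s (int a + 1) (int b - 1) (int c) = (if b = 0 then 0 else f (s, Suc a, b - 1, c))"
  "cf f s (int a) (int b + 1) (int c - 1) = (if c = 0 then 0 else f (s, a, Suc b, c - 1))"
  "cf f s (int a - 1) (int b + 1) (int c) = (if a = 0 then 0 else f (s, a - 1, Suc b, c))"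
  "cf f s (int a) (int b - 1) (int c + 1) = (if b = 0 then 0 else f (s, a, b - 1, Suc c))"
  "cf f s (int a - 1) (int b) (int c + 1) = (if a = 0 then 0 else f (s, a - 1, b, Suc c))"
  by (auto simp: cf_def nat_add_distrib nat_diff_distrib)

lemma dki_int_Suc[simp]: "dki k (int m + 1) = dk k (Suc m)"
  using dki_nat[of k "Suc m"] by (simp add: add.commute)
lemma sg_int: "sg (int m) = (-1) ^ m" by (simp add: sg_def)

text \<open>At the edge of the octant a raised index is either still negative or equal to 0, where
  its factor vanishes. So extension by zero is compatible with all operators.\<close>

lemma dki_succ_zero: "m < 0 \<Longrightarrow> dki k (m + 1) = 0 \<or> m + 1 < 0"
  by (cases "m = -1") auto

lemma nonneg_cases3:
  fixes a b c :: int
  obtains "a < 0 \<or> b < 0 \<or> c < 0" | a' b' c' where "a = int a'" "b = int b'" "c = int c'"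
  by (metis linorder_not_le nonneg_int_cases)

lemma minus_one_pred: "0 < m \<Longrightarrow> (-1::complex) ^ (m - Suc 0) = - ((-1) ^ m)"
  by (cases m) auto

lemma cf_BX: "cf (BX k1 k2 k3 f) = X_cf k2 k3 (cf f)"
proof (intro ext)
  fix s and a b c :: int
  show "cf (BX k1 k2 k3 f) s a b c = X_cf k2 k3 (cf f) s a b c"
  proof (cases a b c rule: nonneg_cases3)
    case 1
    then show ?thesis using dki_succ_zero[of b k2] dki_succ_zero[of c k3] by (auto simp: X_cf_def)
  next
    case (2 a' b' c')
    show ?thesis unfolding 2
      apply (simp add: X_cf_def BX_def Let_def vadd_def vsmul_def sig1_def mx3_def mx2_def T2_def T3_def
         R2_def R3_def sg_add sg_int sp_def)
      apply (auto simp: minus_one_pred algebra_simps)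
      done
  qed
qed

lemma cf_BY: "cf (BY k1 k2 k3 f) = Y_cf k1 k3 (cf f)"
proof (intro ext)
  fix s and a b c :: int
  show "cf (BY k1 k2 k3 f) s a b c = Y_cf k1 k3 (cf f) s a b c"
  proof (cases a b c rule: nonneg_cases3)
    case 1
    then show ?thesis using dki_succ_zero[of a k1] dki_succ_zero[of c k3] by (auto simp: Y_cf_def)
  next
    case (2 a' b' c')
    show ?thesis unfolding 2
      apply (simp add: Y_cf_def BY_def Let_def vadd_def vsmul_def sig2_def mx3_def mx1_def T1_def T3_def
         R1_def R3_def sg_add sg_int sp_def sp_def)
      apply (auto simp: minus_one_pred algebra_simps)
      done
  qed
qed

lemma cf_BZ: "cf (BZ k1 k2 k3 f) = Z_cf k1 k2 (cf f)"
proof (intro ext)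
  fix s and a b c :: int
  show "cf (BZ k1 k2 k3 f) s a b c = Z_cf k1 k2 (cf f) s a b c"
  proof (cases a b c rule: nonneg_cases3)
    case 1
    then show ?thesis using dki_succ_zero[of a k1] dki_succ_zero[of b k2] by (auto simp: Z_cf_def)
  next
    case (2 a' b' c')
    show ?thesis unfolding 2
      apply (simp add: Z_cf_def BZ_def Let_def vadd_def vsmul_def sig3_def mx2_def mx1_def T1_def T2_def
         R1_def R2_def sg_add sg_int sp_def sp_def)
      apply (auto simp: minus_one_pred algebra_simps)
      done
  qed
qed

lemma cf_Dirac: "cf (Dirac k1 k2 k3 f) = D_cf k1 k2 k3 (cf f)"
proof (intro ext)
  fix s and a b c :: int
  show "cf (Dirac k1 k2 k3 f) s a b c = D_cf k1 k2 k3 (cf f) s a b c"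
  proof (cases a b c rule: nonneg_cases3)
    case 1
    then show ?thesis using dki_succ_zero[of a k1] dki_succ_zero[of b k2] dki_succ_zero[of c k3] by (auto simp: D_cf_def)
  next
    case (2 a' b' c')
    show ?thesis unfolding 2
      by (cases s; simp add: D_cf_def Dirac_def vadd_def sig1_def sig2_def sig3_def T1_def T2_def T3_def sp_def)
  qed
qed

section \<open>Bannai--Ito relations on coefficients\<close>

lemma dki_sg: "dki k m = of_int m + of_real k * (1 - sg m)" by (simp add: dki_def sg_def)

lemma sg_cases: obtains "sg m = 1" | "sg m = -1" by (cases "even m") (simp_all add: sg_def)

lemma sg_num[simp]: "sg 0 = 1" "sg 1 = -1" "sg 2 = 1" by (simp_all add: sg_def)
lemmas half_simps = algebra_simps add_divide_distrib diff_divide_distrib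

text \<open>Once the spin and the three parities are fixed, each \<open>dki\<close> is affine in its
  index, and only polynomial identities remain. Commuting with the Dirac operator makes
  \<open>Mn\<close> stable under \<open>X\<close>.\<close>

lemma D_cf_X_cf: "D_cf k1 k2 k3 (X_cf k2 k3 F) = X_cf k2 k3 (D_cf k1 k2 k3 F)"
proof (intro ext)
  fix s a b c
  show "D_cf k1 k2 k3 (X_cf k2 k3 F) s a b c = X_cf k2 k3 (D_cf k1 k2 k3 F) s a b c"
  apply (cases s; rule sg_cases[of a]; rule sg_cases[of b]; rule sg_cases[of c])
    apply (simp add: D_cf_def X_cf_def sp_def dki_sg sg_add, simp add: half_simps)+
  done
qed
lemma D_cf_Y_cf: "D_cf k1 k2 k3 (Y_cf k1 k3 F) = Y_cf k1 k3 (D_cf k1 k2 k3 F)"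
proof (intro ext)
  fix s a b c
  show "D_cf k1 k2 k3 (Y_cf k1 k3 F) s a b c = Y_cf k1 k3 (D_cf k1 k2 k3 F) s a b c"
  apply (cases s; rule sg_cases[of a]; rule sg_cases[of b]; rule sg_cases[of c])
    apply (simp add: D_cf_def Y_cf_def sp_def dki_sg sg_add, simp add: half_simps)+
  done
qed

text \<open>On odd degree the anticommutator relations hold up to a multiple of the vector variable times the Dirac
  operator, which vanishes on \<open>Mn\<close>.\<close>

lemma X_cf_Y_cf:
  assumes "sg (a + b + c) = -1"
  shows "X_cf k2 k3 (Y_cf k1 k3 F) s a b c + Y_cf k1 k3 (X_cf k2 k3 F) s a b c = Z_cf k1 k2 F s a b c
   + (2 * k1 * k2 - 2 * k3 * (k1 + k2 + k3 + of_int (a + b + c) + 1)) * F s a b c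
   + 2 * k3 * x_cf (D_cf k1 k2 k3 F) s a b c"
  apply (insert assms, cases s; rule sg_cases[of a]; rule sg_cases[of b]; rule sg_cases[of c])
  apply (simp add: D_cf_def X_cf_def Y_cf_def Z_cf_def x_cf_def sp_def dki_sg sg_add, simp add: half_simps)+
  done
lemma Y_cf_Z_cf:
  assumes "sg (a + b + c) = -1"
  shows "Y_cf k1 k3 (Z_cf k1 k2 F) s a b c + Z_cf k1 k2 (Y_cf k1 k3 F) s a b c = X_cf k2 k3 F s a b c
   + (2 * k2 * k3 - 2 * k1 * (k1 + k2 + k3 + of_int (a + b + c) + 1)) * F s a b c
   + 2 * k1 * x_cf (D_cf k1 k2 k3 F) s a b c"
  apply (insert assms, cases s; rule sg_cases[of a]; rule sg_cases[of b]; rule sg_cases[of c])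
  apply (simp add: D_cf_def X_cf_def Y_cf_def Z_cf_def x_cf_def sp_def dki_sg sg_add, simp add: half_simps)+
  done
lemma X_cf_Z_cf:
  assumes "sg (a + b + c) = -1"
  shows "X_cf k2 k3 (Z_cf k1 k2 F) s a b c + Z_cf k1 k2 (X_cf k2 k3 F) s a b c = Y_cf k1 k3 F s a b c
   + (2 * k1 * k3 - 2 * k2 * (k1 + k2 + k3 + of_int (a + b + c) + 1)) * F s a b c
   + 2 * k2 * x_cf (D_cf k1 k2 k3 F) s a b c"
  apply (insert assms, cases s; rule sg_cases[of a]; rule sg_cases[of b]; rule sg_cases[of c])
  apply (simp add: D_cf_def X_cf_def Y_cf_def Z_cf_def x_cf_def sp_def dki_sg sg_add, simp add: half_simps)+
  done

section \<open>Invariance of \<open>Mn\<close> and the relations holding on it\<close>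

lemma cf_vadd: "cf (vadd f g) s a b c = cf f s a b c + cf g s a b c"
  by (simp add: cf_def vadd_def)
lemma cf_vsmul: "cf (vsmul x f) s a b c = x * cf f s a b c"
  by (simp add: cf_def vsmul_def)
lemma cf_vzero: "cf vzero s a b c = 0"
  by (simp add: cf_def vzero_def)

lemma homog_iff: "homog n f \<longleftrightarrow> (\<forall>s a b c. a + b + c \<noteq> int n \<longrightarrow> cf f s a b c = 0)"
proof
  assume "homog n f"
  then show "\<forall>s a b c. a + b + c \<noteq> int n \<longrightarrow> cf f s a b c = 0"
    by (auto simp: homog_def cf_def)
next
  assume h: "\<forall>s a b c. a + b + c \<noteq> int n \<longrightarrow> cf f s a b c = 0"
  show "homog n f" unfolding homog_def
  proof (intro allI impI)
    fix s a b c assume "a + b + c \<noteq> n"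
    then have "int a + int b + int c \<noteq> int n" by linarith
    then show "f (s, a, b, c) = 0" using h cf_int by metis
  qed
qed

lemma Mn_iff: "f \<in> Mn k1 k2 k3 n \<longleftrightarrow>
  (\<forall>s a b c. a + b + c \<noteq> int n \<longrightarrow> cf f s a b c = 0) \<and> (\<forall>s a b c. D_cf k1 k2 k3 (cf f) s a b c = 0)"
proof -
  have "Dirac k1 k2 k3 f = vzero \<longleftrightarrow> (\<forall>s a b c. D_cf k1 k2 k3 (cf f) s a b c = 0)"
    unfolding cf_Dirac[symmetric] using cf_eqI[of "Dirac k1 k2 k3 f" vzero] cf_vzero by auto
  then show ?thesis by (simp add: Mn_def homog_iff)
qed

lemma x_cf_zero: "(\<And>s a b c. F s a b c = 0) \<Longrightarrow> x_cf F s a b c = 0" by (simp add: x_cf_def)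

lemma BX_vadd: "BX k1 k2 k3 (vadd f g) = vadd (BX k1 k2 k3 f) (BX k1 k2 k3 g)"
  by (rule cf_eqI) (simp add: cf_BX cf_vadd X_cf_def algebra_simps add_divide_distrib)
lemma BY_vadd: "BY k1 k2 k3 (vadd f g) = vadd (BY k1 k2 k3 f) (BY k1 k2 k3 g)"
  by (rule cf_eqI) (simp add: cf_BY cf_vadd Y_cf_def algebra_simps add_divide_distrib)
lemma BX_vsmul: "BX k1 k2 k3 (vsmul x g) = vsmul x (BX k1 k2 k3 g)"
  by (rule cf_eqI) (simp add: cf_BX cf_vsmul X_cf_def algebra_simps)
lemma BY_vsmul: "BY k1 k2 k3 (vsmul x g) = vsmul x (BY k1 k2 k3 g)"
  by (rule cf_eqI) (simp add: cf_BY cf_vsmul Y_cf_def algebra_simps)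

context
  fixes k1 k2 k3 :: real and n :: nat
begin

lemma BX_Mn: "f \<in> Mn k1 k2 k3 n \<Longrightarrow> BX k1 k2 k3 f \<in> Mn k1 k2 k3 n"
  unfolding Mn_iff cf_BX D_cf_X_cf by (auto simp: X_cf_def)
lemma BY_Mn: "f \<in> Mn k1 k2 k3 n \<Longrightarrow> BY k1 k2 k3 f \<in> Mn k1 k2 k3 n"
  unfolding Mn_iff cf_BY D_cf_Y_cf by (auto simp: Y_cf_def)

lemma Mn_homog: "f \<in> Mn k1 k2 k3 n \<Longrightarrow> a + b + c \<noteq> int n \<Longrightarrow> cf f s a b c = 0"
  by (auto simp: Mn_iff)
lemma Mn_Dirac: "f \<in> Mn k1 k2 k3 n \<Longrightarrow> D_cf k1 k2 k3 (cf f) s a b c = 0"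
  by (auto simp: Mn_iff)

lemma sg_odd: "odd n \<Longrightarrow> a + b + c = int n \<Longrightarrow> sg (a + b + c) = -1"
  by (simp add: sg_def)

lemma Mn_XY:
  assumes "odd n" "f \<in> Mn k1 k2 k3 n"
  shows "cf (BX k1 k2 k3 (BY k1 k2 k3 f)) s a b c + cf (BY k1 k2 k3 (BX k1 k2 k3 f)) s a b c
    = cf (BZ k1 k2 k3 f) s a b c + (2 * k1 * k2 - 2 * k3 * (k1 + k2 + k3 + n + 1)) * cf f s a b c"
proof (cases "a + b + c = int n")
  case True
  have "x_cf (D_cf k1 k2 k3 (cf f)) s a b c = 0" using Mn_Dirac[OF assms(2)] by (rule x_cf_zero)
  then show ?thesis using X_cf_Y_cf[OF sg_odd[OF assms(1) True], of k2 k3 k1 "cf f" s] True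
    by (simp add: cf_BX cf_BY cf_BZ)
next
  case False
  then show ?thesis using Mn_homog[OF assms(2)] by (simp add: cf_BX cf_BY cf_BZ X_cf_def Y_cf_def Z_cf_def)
qed

lemma Mn_YZ:
  assumes "odd n" "f \<in> Mn k1 k2 k3 n"
  shows "cf (BY k1 k2 k3 (BZ k1 k2 k3 f)) s a b c + cf (BZ k1 k2 k3 (BY k1 k2 k3 f)) s a b c
    = cf (BX k1 k2 k3 f) s a b c + (2 * k2 * k3 - 2 * k1 * (k1 + k2 + k3 + n + 1)) * cf f s a b c"
proof (cases "a + b + c = int n")
  case True
  have "x_cf (D_cf k1 k2 k3 (cf f)) s a b c = 0" using Mn_Dirac[OF assms(2)] by (rule x_cf_zero)
  then show ?thesis using Y_cf_Z_cf[OF sg_odd[OF assms(1) True], of k1 k3 k2 "cf f" s] True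
    by (simp add: cf_BX cf_BY cf_BZ)
next
  case False
  then show ?thesis using Mn_homog[OF assms(2)] by (simp add: cf_BX cf_BY cf_BZ X_cf_def Y_cf_def Z_cf_def)
qed

lemma Mn_XZ:
  assumes "odd n" "f \<in> Mn k1 k2 k3 n"
  shows "cf (BX k1 k2 k3 (BZ k1 k2 k3 f)) s a b c + cf (BZ k1 k2 k3 (BX k1 k2 k3 f)) s a b c
    = cf (BY k1 k2 k3 f) s a b c + (2 * k1 * k3 - 2 * k2 * (k1 + k2 + k3 + n + 1)) * cf f s a b c"
proof (cases "a + b + c = int n")
  case True
  have "x_cf (D_cf k1 k2 k3 (cf f)) s a b c = 0" using Mn_Dirac[OF assms(2)] by (rule x_cf_zero)
  then show ?thesis using X_cf_Z_cf[OF sg_odd[OF assms(1) True], of k2 k3 k1 "cf f" s] True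
    by (simp add: cf_BX cf_BY cf_BZ)
next
  case False
  then show ?thesis using Mn_homog[OF assms(2)] by (simp add: cf_BX cf_BY cf_BZ X_cf_def Y_cf_def Z_cf_def)
qed

text \<open>\<open>Z\<close> is recovered from \<open>X\<close> and \<open>Y\<close> by the same
  formula that defines it in \<open>Omod\<close>, so a homomorphism has to be checked on
  \<open>X\<close> and \<open>Y\<close> only, together with one scalar.\<close>

lemma BZ_eq:
  assumes "odd n" "f \<in> Mn k1 k2 k3 n"
  shows "BZ k1 k2 k3 f = vadd (BX k1 k2 k3 (BY k1 k2 k3 f)) (vadd (BY k1 k2 k3 (BX k1 k2 k3 f))
     (vsmul (- (2 * k1 * k2 - 2 * k3 * (k1 + k2 + k3 + n + 1))) f))"
  using Mn_XY[OF assms] by (intro cf_eqI) (simp add: cf_vadd cf_vsmul algebra_simps)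

text \<open>Eliminating \<open>Z\<close> from the relation for \<open>{X,Z}\<close> leaves a cubic
  relation in \<open>X\<close> and \<open>Y\<close>. It is the input of the chains generated by
  \<open>X\<close>; \<open>Mn_YYX\<close> serves the chain generated by \<open>Y\<close>.\<close>

lemma Mn_XXY:
  assumes "odd n" "f \<in> Mn k1 k2 k3 n"
  shows "cf (BX k1 k2 k3 (BX k1 k2 k3 (BY k1 k2 k3 f))) s a b c
       + 2 * cf (BX k1 k2 k3 (BY k1 k2 k3 (BX k1 k2 k3 f))) s a b c
       + cf (BY k1 k2 k3 (BX k1 k2 k3 (BX k1 k2 k3 f))) s a b c
    = 2 * (2 * k1 * k2 - 2 * k3 * (k1 + k2 + k3 + n + 1)) * cf (BX k1 k2 k3 f) s a b c
      + cf (BY k1 k2 k3 f) s a b c + (2 * k1 * k3 - 2 * k2 * (k1 + k2 + k3 + n + 1)) * cf f s a b c"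
  using Mn_XZ[OF assms, of s a b c]
  by (simp add: BZ_eq[OF assms] BZ_eq[OF assms(1) BX_Mn[OF assms(2)]] BX_vadd BX_vsmul cf_vadd cf_vsmul algebra_simps)

lemma Mn_YYX:
  assumes "odd n" "f \<in> Mn k1 k2 k3 n"
  shows "cf (BY k1 k2 k3 (BY k1 k2 k3 (BX k1 k2 k3 f))) s a b c
       + 2 * cf (BY k1 k2 k3 (BX k1 k2 k3 (BY k1 k2 k3 f))) s a b c
       + cf (BX k1 k2 k3 (BY k1 k2 k3 (BY k1 k2 k3 f))) s a b c
    = 2 * (2 * k1 * k2 - 2 * k3 * (k1 + k2 + k3 + n + 1)) * cf (BY k1 k2 k3 f) s a b c
      + cf (BX k1 k2 k3 f) s a b c + (2 * k2 * k3 - 2 * k1 * (k1 + k2 + k3 + n + 1)) * cf f s a b c"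
  using Mn_YZ[OF assms, of s a b c]
  by (simp add: BZ_eq[OF assms] BZ_eq[OF assms(1) BY_Mn[OF assms(2)]] BY_vadd BY_vsmul cf_vadd cf_vsmul algebra_simps)

lemma sp_not[simp]: "sp (\<not> s) = - sp s" by (simp add: sp_def)
lemma sp_sq[simp]: "sp s * sp s = 1" "sp s * (sp s * x) = x" by (simp_all add: sp_def)

text \<open>Eliminating two of the terms by the Dirac equation makes \<open>X\<close> triangular in the degree of \<open>x\<^sub>1\<close>, and \<open>Y\<close>
  in the degree of \<open>x\<^sub>2\<close>.\<close>

lemma Mn_X_triangular:
  assumes "f \<in> Mn k1 k2 k3 n"
  shows "cf (BX k1 k2 k3 f) s a b c = sg (b + c) * ((of_int (b + c) + k2 + k3 + 1/2) * cf f s a b c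
    + dki k1 (a + 1) * (- \<i> * sp s * cf f s (a + 1) (b - 1) c + sp s * cf f (\<not> s) (a + 1) b (c - 1)))"
proof -
  let ?F = "cf f"
  \<comment> \<open>The Dirac equation is taken at the two points where it contains a shifted term
    of \<open>X\<close>. Solving for these terms leaves the diagonal and terms of degree
    \<open>a + 1\<close> in \<open>x1\<close>.\<close>
  have e1: "\<i> * (dki k2 (b + 1) * ?F (\<not> s) a (b + 1) (c - 1))
     = sp s * (dki k1 (a + 1) * ?F (\<not> s) (a + 1) b (c - 1)) + dki k3 c * ?F s a b c"
    using arg_cong[OF Mn_Dirac[OF assms(1), of s a b "c - 1"], of "\<lambda>x. sp s * x"]
    by (simp add: D_cf_def algebra_simps)
  have e2: "dki k3 (c + 1) * ?F (\<not> s) a (b - 1) (c + 1)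
     = sp s * (dki k1 (a + 1) * ?F s (a + 1) (b - 1) c) + \<i> * (dki k2 b * ?F s a b c)"
    using arg_cong[OF Mn_Dirac[OF assms(1), of "\<not> s" a "b - 1" c], of "\<lambda>x. sp s * x"]
    by (simp add: D_cf_def algebra_simps)
  show ?thesis unfolding cf_BX X_cf_def right_diff_distrib e1 e2
    by (rule sg_cases[of b]; rule sg_cases[of c]; simp add: dki_sg sg_add algebra_simps)
qed

lemma Mn_Y_triangular:
  assumes "f \<in> Mn k1 k2 k3 n"
  shows "cf (BY k1 k2 k3 f) s a b c = sg (a + c) * ((of_int (a + c) + k1 + k3 + 1/2) * cf f s a b c
    + dki k2 (b + 1) * (\<i> * sp s * cf f s (a - 1) (b + 1) c - \<i> * cf f (\<not> s) a (b + 1) (c - 1)))"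
proof -
  let ?F = "cf f"
  have e1: "dki k1 (a + 1) * ?F (\<not> s) (a + 1) b (c - 1)
     = \<i> * (sp s * (dki k2 (b + 1) * ?F (\<not> s) a (b + 1) (c - 1))) - sp s * (dki k3 c * ?F s a b c)"
    using Mn_Dirac[OF assms(1), of s a b "c - 1"]
    by (simp add: D_cf_def algebra_simps)
  have e2: "dki k3 (c + 1) * ?F (\<not> s) (a - 1) b (c + 1)
     = sp s * (dki k1 a * ?F s a b c) + \<i> * (dki k2 (b + 1) * ?F s (a - 1) (b + 1) c)"
    using arg_cong[OF Mn_Dirac[OF assms(1), of "\<not> s" "a - 1" b c], of "\<lambda>x. sp s * x"]
    by (simp add: D_cf_def algebra_simps)
  show ?thesis unfolding cf_BY Y_cf_def right_diff_distrib e1 e2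
    by (rule sg_cases[of a]; rule sg_cases[of c]; simp add: dki_sg sg_add algebra_simps)
qed

end

section \<open>Divisibility by powers of the variables\<close>

locale odd_params =
  fixes k1 k2 k3 :: real and n t1 t2 t3 :: nat
  assumes odd_n: "odd n" and odd_t: "odd t1" "odd t2" "odd t3"
    and k_eq: "k1 = - real t1 / 2" "k2 = - real t2 / 2" "k3 = - real t3 / 2"
    and t_le: "t1 + t2 + t3 \<le> n"
begin

lemma tpar_eq: "tpar k1 = enat t1" "tpar k2 = enat t2" "tpar k3 = enat t3"
  using odd_t by (auto simp: tpar_def k_eq)

lemma dki_zero_iff:
  "dki k1 m = 0 \<longleftrightarrow> m = 0 \<or> m = int t1"
  "dki k2 m = 0 \<longleftrightarrow> m = 0 \<or> m = int t2"
  "dki k3 m = 0 \<longleftrightarrow> m = 0 \<or> m = int t3"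
proof -
  have *: "dki (- real t / 2) m = 0 \<longleftrightarrow> m = 0 \<or> m = int t" if "odd t" for t
  proof -
    have "dki (- real t / 2) m = of_int (if odd m then m - int t else m)"
      by (simp add: dki_def)
    then show ?thesis using that by (simp only: of_int_eq_0_iff) auto
  qed
  show "dki k1 m = 0 \<longleftrightarrow> m = 0 \<or> m = int t1" "dki k2 m = 0 \<longleftrightarrow> m = 0 \<or> m = int t2"
    "dki k3 m = 0 \<longleftrightarrow> m = 0 \<or> m = int t3"
    unfolding k_eq using *[OF odd_t(1)] *[OF odd_t(2)] *[OF odd_t(3)] by blast+
qed

abbreviation V where "V \<equiv> Mn k1 k2 k3 n"
abbreviation V1 where "V1 \<equiv> Mnx1 k1 k2 k3 n"
abbreviation V2 where "V2 \<equiv> Mnx2 k1 k2 k3 n"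
abbreviation V3 where "V3 \<equiv> Mnx3 k1 k2 k3 n"

lemma V1_iff: "f \<in> V1 \<longleftrightarrow> f \<in> V \<and> (\<forall>s a b c. a < int t1 \<longrightarrow> cf f s a b c = 0)"
  unfolding Mnx1_def tpar_eq
  by (auto simp: cf_def) (metis cf_def cf_int nat_int of_nat_less_iff)
lemma V2_iff: "f \<in> V2 \<longleftrightarrow> f \<in> V \<and> (\<forall>s a b c. b < int t2 \<longrightarrow> cf f s a b c = 0)"
  unfolding Mnx2_def tpar_eq
  by (auto simp: cf_def) (metis cf_def cf_int nat_int of_nat_less_iff)
lemma V3_iff: "f \<in> V3 \<longleftrightarrow> f \<in> V \<and> (\<forall>s a b c. c < int t3 \<longrightarrow> cf f s a b c = 0)"
  unfolding Mnx3_def tpar_eq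
  by (auto simp: cf_def) (metis cf_def cf_int nat_int of_nat_less_iff)

lemma BX_V1: "f \<in> V1 \<Longrightarrow> BX k1 k2 k3 f \<in> V1"
  unfolding V1_iff cf_BX by (auto simp: BX_Mn X_cf_def)
text \<open>A raised index stays below \<open>t_i\<close>, or it reaches \<open>t_i\<close> with
  factor zero. This is why divisibility by \<open>x_i^t_i\<close> is preserved by the operators and
  by the recursions that solve the Dirac equation.\<close>

lemma dki_border: "a < int t1 \<Longrightarrow> dki k1 (a + 1) = 0 \<or> a + 1 < int t1"
  "b < int t2 \<Longrightarrow> dki k2 (b + 1) = 0 \<or> b + 1 < int t2"
  "c < int t3 \<Longrightarrow> dki k3 (c + 1) = 0 \<or> c + 1 < int t3"
  by (auto simp: dki_zero_iff)
lemma BX_V2: "f \<in> V2 \<Longrightarrow> BX k1 k2 k3 f \<in> V2"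
  unfolding V2_iff cf_BX using dki_border(2) by (fastforce simp: BX_Mn X_cf_def)
lemma BX_V3: "f \<in> V3 \<Longrightarrow> BX k1 k2 k3 f \<in> V3"
  unfolding V3_iff cf_BX using dki_border(3) by (fastforce simp: BX_Mn X_cf_def)
lemma BY_V1: "f \<in> V1 \<Longrightarrow> BY k1 k2 k3 f \<in> V1"
  unfolding V1_iff cf_BY using dki_border(1) by (fastforce simp: BY_Mn Y_cf_def)
lemma BY_V2: "f \<in> V2 \<Longrightarrow> BY k1 k2 k3 f \<in> V2"
  unfolding V2_iff cf_BY by (auto simp: BY_Mn Y_cf_def)
lemma BY_V3: "f \<in> V3 \<Longrightarrow> BY k1 k2 k3 f \<in> V3"
  unfolding V3_iff cf_BY using dki_border(3) by (fastforce simp: BY_Mn Y_cf_def)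

lemma sp_nz[simp]: "sp s \<noteq> 0" by (simp add: sp_def)

text \<open>The region below both thresholds is entered from above only with factor zero. By
  induction towards its corner the Dirac equation there reduces to its \<open>x2\<close>
  term.\<close>

lemma V_vanish13:
  assumes f: "f \<in> V" and "a < int t1" "c < int t3"
  shows "cf f s a b c = 0"
  using assms(2,3)
proof (induction "nat (int t1 - a) + nat (int t3 - c)" arbitrary: s a b c rule: less_induct)
  case less
  have 1: "dki k1 (a + 1) * cf f s (a + 1) (b - 1) c = 0"
    using less.hyps[of "a + 1" c] less.prems dki_border(1)[of a] by auto
  have 2: "dki k3 (c + 1) * cf f (\<not> s) a (b - 1) (c + 1) = 0"
    using less.hyps[of a "c + 1"] less.prems dki_border(3)[of c] by auto
  have "dki k2 b * cf f s a b c = 0"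
    using Mn_Dirac[OF f, of "\<not> s" a "b - 1" c] 1 2 by (auto simp: D_cf_def)
  \<comment> \<open>The bound on \<open>n\<close> enters here: \<open>a < t1\<close> and
    \<open>c < t3\<close> force \<open>b > t2\<close>, beyond both zeros of
    \<open>dki k2\<close>.\<close>
  moreover have "dki k2 b \<noteq> 0" if "a + b + c = int n"
    using that less.prems t_le by (simp add: dki_zero_iff)
  ultimately show ?case using Mn_homog[OF f, of a b c s] by auto
qed

lemma V_vanish23:
  assumes f: "f \<in> V" and "b < int t2" "c < int t3"
  shows "cf f s a b c = 0"
  using assms(2,3)
proof (induction "nat (int t2 - b) + nat (int t3 - c)" arbitrary: s a b c rule: less_induct)
  case less
  have 1: "dki k2 (b + 1) * cf f s (a - 1) (b + 1) c = 0"
    using less.hyps[of "b + 1" c] less.prems dki_border(2)[of b] by auto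
  have 2: "dki k3 (c + 1) * cf f (\<not> s) (a - 1) b (c + 1) = 0"
    using less.hyps[of b "c + 1"] less.prems dki_border(3)[of c] by auto
  have "dki k1 a * cf f s a b c = 0"
    using Mn_Dirac[OF f, of "\<not> s" "a - 1" b c] 1 2 by (auto simp: D_cf_def)
  moreover have "dki k1 a \<noteq> 0" if "a + b + c = int n"
    using that less.prems t_le by (simp add: dki_zero_iff)
  ultimately show ?case using Mn_homog[OF f, of a b c s] by auto
qed

text \<open>The Dirac equation determines all layers \<open>c > t3\<close> from the layer \<open>c = t3\<close>, because \<open>dki k3\<close> vanishes
  only at \<open>0\<close> and \<open>t3\<close>.\<close>

lemma V_layer3:
  assumes f: "f \<in> V"
    and R1: "\<And>a b. R a b \<Longrightarrow> dki k1 (a + 1) = 0 \<or> R (a + 1) b"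
    and R2: "\<And>a b. R a b \<Longrightarrow> dki k2 (b + 1) = 0 \<or> R a (b + 1)"
    and base: "\<And>s a b. R a b \<Longrightarrow> cf f s a b (int t3) = 0"
    and "R a b" "int t3 \<le> c"
  shows "cf f s a b c = 0"
  using \<open>int t3 \<le> c\<close> \<open>R a b\<close>
proof (induction c arbitrary: s a b rule: int_ge_induct)
  case base
  then show ?case by (rule assms(4))
next
  case (step c)
  have "dki k3 (c + 1) * cf f s a b (c + 1) = 0"
    using Mn_Dirac[OF f, of s a b c] R1[OF step.prems] R2[OF step.prems]
      step.IH[of "a + 1" b "\<not> s"] step.IH[of a "b + 1" "\<not> s"] by (auto simp: D_cf_def)
  then show ?case using step.hyps by (simp add: dki_zero_iff)
qed

lemma V_layer1:
  assumes f: "f \<in> V"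
    and R1: "\<And>b c. R b c \<Longrightarrow> dki k2 (b + 1) = 0 \<or> R (b + 1) c"
    and R2: "\<And>b c. R b c \<Longrightarrow> dki k3 (c + 1) = 0 \<or> R b (c + 1)"
    and base: "\<And>s b c. R b c \<Longrightarrow> cf f s (int t1) b c = 0"
    and "R b c" "int t1 \<le> a"
  shows "cf f s a b c = 0"
  using \<open>int t1 \<le> a\<close> \<open>R b c\<close>
proof (induction a arbitrary: s b c rule: int_ge_induct)
  case base
  then show ?case by (rule assms(4))
next
  case (step a)
  have "dki k1 (a + 1) * cf f s (a + 1) b c = 0"
    using Mn_Dirac[OF f, of "\<not> s" a b c] R1[OF step.prems] R2[OF step.prems]
      step.IH[of "b + 1" c s] step.IH[of b "c + 1" "\<not> s"] by (auto simp: D_cf_def)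
  then show ?case using step.hyps by (simp add: dki_zero_iff)
qed

text \<open>The entries with \<open>a < t1\<close> vanish below the layer \<open>c = t3\<close> by
  \<open>V_vanish13\<close>, and above it they are determined by that layer.\<close>

lemma V1_I:
  assumes f: "f \<in> V" and "\<And>s a b. a < int t1 \<Longrightarrow> cf f s a b (int t3) = 0"
  shows "f \<in> V1"
  unfolding V1_iff
proof (intro conjI allI impI f)
  fix s a b c assume "a < int t1"
  then show "cf f s a b c = 0"
    using V_layer3[OF f, of "\<lambda>a b. a < int t1" a b c s] V_vanish13[OF f] assms(2) dki_border(1)
    by (cases "c < int t3") auto
qed

lemma V2_I:
  assumes f: "f \<in> V" and "\<And>s a b. b < int t2 \<Longrightarrow> cf f s a b (int t3) = 0"
  shows "f \<in> V2"
  unfolding V2_iff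
proof (intro conjI allI impI f)
  fix s a b c assume "b < int t2"
  then show "cf f s a b c = 0"
    using V_layer3[OF f, of "\<lambda>a b. b < int t2" a b c s] V_vanish23[OF f] assms(2) dki_border(2)
    by (cases "c < int t3") auto
qed

text \<open>Here the layer \<open>a = t1\<close> is tested, since the condition concerns degrees
  below \<open>t3\<close> in \<open>x3\<close>, which the layer \<open>c = t3\<close> does not
  control.\<close>

lemma V3_I:
  assumes f: "f \<in> V" and "\<And>s b c. c < int t3 \<Longrightarrow> cf f s (int t1) b c = 0"
  shows "f \<in> V3"
  unfolding V3_iff
proof (intro conjI allI impI f)
  fix s a b c assume "c < int t3"
  then show "cf f s a b c = 0"
    using V_layer1[OF f, of "\<lambda>b c. c < int t3" b c a s] V_vanish13[OF f] assms(2) dki_border(3)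
    by (cases "a < int t1") auto
qed

lemma V3_zero:
  assumes f: "f \<in> V3" and "\<And>s a b. cf f s a b (int t3) = 0"
  shows "f = vzero"
proof (rule cf_eqI)
  fix s a b c
  show "cf f s a b c = cf vzero s a b c" unfolding cf_vzero
    using V_layer3[of f "\<lambda>a b. True" a b c s] f assms(2)
    by (cases "c < int t3") (auto simp: V3_iff)
qed

end

section \<open>Solutions of the Dirac equation with a prescribed layer\<close>

definition of_cf :: "coeffs \<Rightarrow> cpol" where "of_cf F = (\<lambda>(s,a,b,c). F s (int a) (int b) (int c))"

lemma cf_of_cf:
  assumes "\<And>s a b c. a < 0 \<or> b < 0 \<or> c < 0 \<Longrightarrow> F s a b c = 0"
  shows "cf (of_cf F) = F"
  using assms by (auto simp: cf_def of_cf_def fun_eq_iff)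

context odd_params begin

text \<open>A Cauchy-Kovalevskaya extension: the Dirac equation at \<open>x3\<close>-degree
  \<open>t3 + j\<close>, solved for the coefficients of degree \<open>t3 + j + 1\<close>. The
  denominator is nonzero because the degree exceeds \<open>t3\<close>. In \<open>ck1\<close> the
  equation is used at the opposite spin, as its \<open>x1\<close> term flips the spin.\<close>

fun ck3 :: "(bool \<Rightarrow> int \<Rightarrow> int \<Rightarrow> complex) \<Rightarrow> nat \<Rightarrow> bool \<Rightarrow> int \<Rightarrow> int \<Rightarrow> complex" where
  "ck3 L 0 s a b = L s a b"
| "ck3 L (Suc j) s a b = (\<i> * dki k2 (b + 1) * ck3 L j (\<not> s) a (b + 1) - sp s * dki k1 (a + 1) * ck3 L j (\<not> s) (a + 1) b)
     / dki k3 (int t3 + int j + 1)"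

fun ck1 :: "(bool \<Rightarrow> int \<Rightarrow> int \<Rightarrow> complex) \<Rightarrow> nat \<Rightarrow> bool \<Rightarrow> int \<Rightarrow> int \<Rightarrow> complex" where
  "ck1 L 0 s b c = L s b c"
| "ck1 L (Suc j) s b c = (sp s * dki k3 (c + 1) * ck1 L j (\<not> s) b (c + 1) - \<i> * sp s * dki k2 (b + 1) * ck1 L j s (b + 1) c)
     / dki k1 (int t1 + int j + 1)"

text \<open>The complement of \<open>S\<close> is closed under the raising steps that carry a
  nonzero factor, so vanishing there is inherited by every layer.\<close>

lemma ck3_supp:
  assumes "\<And>s a b. \<not> S a b \<Longrightarrow> L s a b = 0"
    and "\<And>a b. \<not> S a b \<Longrightarrow> dki k1 (a + 1) = 0 \<or> \<not> S (a + 1) b"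
    and "\<And>a b. \<not> S a b \<Longrightarrow> dki k2 (b + 1) = 0 \<or> \<not> S a (b + 1)"
    and "\<not> S a b"
  shows "ck3 L j s a b = 0"
  using assms(4)
proof (induction j arbitrary: s a b)
  case 0
  then show ?case using assms(1) by simp
next
  case (Suc j)
  then show ?case using assms(2)[OF Suc.prems] assms(3)[OF Suc.prems] by auto
qed

lemma ck1_supp:
  assumes "\<And>s b c. \<not> S b c \<Longrightarrow> L s b c = 0"
    and "\<And>b c. \<not> S b c \<Longrightarrow> dki k2 (b + 1) = 0 \<or> \<not> S (b + 1) c"
    and "\<And>b c. \<not> S b c \<Longrightarrow> dki k3 (c + 1) = 0 \<or> \<not> S b (c + 1)"
    and "\<not> S b c"
  shows "ck1 L j s b c = 0"
  using assms(4)
proof (induction j arbitrary: s b c)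
  case 0
  then show ?case using assms(1) by simp
next
  case (Suc j)
  then show ?case using assms(2)[OF Suc.prems] assms(3)[OF Suc.prems] by auto
qed

lemma ck3_homog:
  assumes "\<And>s a b. a + b \<noteq> m \<Longrightarrow> L s a b = 0" "a + b + int j \<noteq> m"
  shows "ck3 L j s a b = 0"
  using assms(2) by (induction j arbitrary: s a b) (auto simp: assms(1))

lemma ck1_homog:
  assumes "\<And>s a b. a + b \<noteq> m \<Longrightarrow> L s a b = 0" "a + b + int j \<noteq> m"
  shows "ck1 L j s a b = 0"
  using assms(2) by (induction j arbitrary: s a b) (auto simp: assms(1))

text \<open>Extension by zero below degree \<open>t3\<close> and by the recursion above it.
  Vanishing of the layer for small \<open>a\<close> or \<open>b\<close> is what places the solution
  in \<open>V1\<close> or \<open>V2\<close>.\<close>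

lemma ck3_exists:
  assumes "\<And>s a b. a + b \<noteq> int n - int t3 \<Longrightarrow> L s a b = 0"
    and "\<And>s a b. a < 0 \<or> b < 0 \<Longrightarrow> L s a b = 0"
  shows "\<exists>f\<in>V3. (\<forall>s a b. cf f s a b (int t3) = L s a b)
    \<and> ((\<forall>s a b. a < int t1 \<longrightarrow> L s a b = 0) \<longrightarrow> f \<in> V1)
    \<and> ((\<forall>s a b. b < int t2 \<longrightarrow> L s a b = 0) \<longrightarrow> f \<in> V2)"
proof -
  define F where "F s a b c = (if c < int t3 then 0 else ck3 L (nat (c - int t3)) s a b)" for s a b c
  define f where "f = of_cf F"
  have neg: "ck3 L j s a b = 0" if "a < 0 \<or> b < 0" for j s a b
  proof (rule ck3_supp[where S = "\<lambda>a b. \<not> (a < 0 \<or> b < 0)"])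
    show "dki k1 (a + 1) = 0 \<or> \<not> \<not> (a + 1 < 0 \<or> b < 0)" if "\<not> \<not> (a < 0 \<or> b < 0)" for a b
      using that dki_succ_zero by auto
    show "dki k2 (b + 1) = 0 \<or> \<not> \<not> (a < 0 \<or> b + 1 < 0)" if "\<not> \<not> (a < 0 \<or> b < 0)" for a b
      using that dki_succ_zero by auto
  qed (use that assms(2) in auto)
  have cf: "cf f = F" unfolding f_def by (rule cf_of_cf) (auto simp: F_def neg)
  have D: "D_cf k1 k2 k3 F s a b c = 0" for s a b c
  proof (cases "c + 1 < int t3")
    case True
    then show ?thesis by (simp add: D_cf_def F_def)
  next
    case False
    show ?thesis
    proof (cases "c + 1 = int t3")
      case True
      \<comment> \<open>The prescribed layer meets the zero part only here, with factor
        \<open>dki k3 (int t3) = 0\<close>; hence the layer is free.\<close>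
      then show ?thesis by (simp add: D_cf_def F_def dki_zero_iff)
    next
      case c: False
      define j where "j = nat (c - int t3)"
      have j: "c = int t3 + int j" using c False by (simp add: j_def)
      have "nat (c + 1 - int t3) = Suc j" using j by simp
      moreover have "dki k3 (int t3 + int j + 1) \<noteq> 0" by (simp add: dki_zero_iff)
      ultimately show ?thesis using j by (simp add: D_cf_def F_def field_simps)
    qed
  qed
  have H: "F s a b c = 0" if "a + b + c \<noteq> int n" for s a b c
    using that ck3_homog[of "int n - int t3" L a b "nat (c - int t3)" s] assms(1) by (auto simp: F_def)
  have V: "f \<in> V" unfolding Mn_iff cf using D H by auto
  have "f \<in> V3" unfolding V3_iff cf using V by (auto simp: F_def)
  moreover have "cf f s a b (int t3) = L s a b" for s a b by (simp add: cf F_def)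
  moreover have "f \<in> V1" if "\<forall>s a b. a < int t1 \<longrightarrow> L s a b = 0"
    using that V V1_I[of f] by (simp add: cf F_def)
  moreover have "f \<in> V2" if "\<forall>s a b. b < int t2 \<longrightarrow> L s a b = 0"
    using that V V2_I[of f] by (simp add: cf F_def)
  ultimately show ?thesis by blast
qed

lemma ck1_exists:
  assumes "\<And>s b c. b + c \<noteq> int n - int t1 \<Longrightarrow> L s b c = 0"
    and "\<And>s b c. c < 0 \<Longrightarrow> L s b c = 0" and "\<And>s b c. b < int t2 \<Longrightarrow> L s b c = 0"
  shows "\<exists>f\<in>V1 \<inter> V2. \<forall>s b c. cf f s (int t1) b c = L s b c"
proof -
  define F where "F s a b c = (if a < int t1 then 0 else ck1 L (nat (a - int t1)) s b c)" for s a b c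
  define f where "f = of_cf F"
  have S2: "ck1 L j s b c = 0" if "b < int t2" for j s b c
    using that ck1_supp[of "\<lambda>b c. \<not> b < int t2" L b c j s] assms(3) dki_border(2)
    by auto
  have neg: "ck1 L j s b c = 0" if "b < 0 \<or> c < 0" for j s b c
    using that ck1_supp[of "\<lambda>b c. \<not> (c < 0)" L b c j s] assms(2) S2[of b] dki_succ_zero
    by auto
  have cf: "cf f = F" unfolding f_def by (rule cf_of_cf) (auto simp: F_def neg)
  have D: "D_cf k1 k2 k3 F s a b c = 0" for s a b c
  proof (cases "a + 1 < int t1")
    case True
    then show ?thesis by (simp add: D_cf_def F_def)
  next
    case False
    show ?thesis
    proof (cases "a + 1 = int t1")
      case True
      then show ?thesis by (simp add: D_cf_def F_def dki_zero_iff)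
    next
      case c: False
      define j where "j = nat (a - int t1)"
      have j: "a = int t1 + int j" using c False by (simp add: j_def)
      have "nat (a + 1 - int t1) = Suc j" using j by simp
      moreover have "dki k1 (int t1 + int j + 1) \<noteq> 0" by (simp add: dki_zero_iff)
      ultimately show ?thesis using j by (simp add: D_cf_def F_def field_simps)
    qed
  qed
  have H: "F s a b c = 0" if "a + b + c \<noteq> int n" for s a b c
    using that ck1_homog[of "int n - int t1" L b c "nat (a - int t1)" s] assms(1) by (auto simp: F_def)
  have V: "f \<in> V" unfolding Mn_iff cf using D H by auto
  have "f \<in> V1" unfolding V1_iff cf using V by (auto simp: F_def)
  moreover have "cf f s (int t1) b c = L s b c" for s b c by (simp add: cf F_def)
  moreover have "f \<in> V2" unfolding V2_iff cf using V by (auto simp: F_def S2)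
  ultimately show ?thesis by blast
qed

end

section \<open>Split bases of Bannai--Ito modules\<close>

text \<open>The functional \<open>e\<close> composed with \<open>P - z 0\<close>, ...,
  \<open>P - z (j - 1)\<close>: the dual counterpart of a split basis, with \<open>P\<close>
  bidiagonal by construction.\<close>

fun split_fun :: "(('i \<Rightarrow> complex) \<Rightarrow> ('i \<Rightarrow> complex)) \<Rightarrow> (nat \<Rightarrow> complex) \<Rightarrow> (('i \<Rightarrow> complex) \<Rightarrow> complex) \<Rightarrow> nat \<Rightarrow> ('i \<Rightarrow> complex) \<Rightarrow> complex" where
  "split_fun P z e 0 f = e f"
| "split_fun P z e (Suc j) f = split_fun P z e j (P f) - z j * split_fun P z e j f"

lemma O_theta_simps:
  "O_theta d a (Suc i) = - O_theta d a i - (-1) ^ i"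
  "O_theta d a (Suc (Suc i)) = O_theta d a i + 2 * (-1) ^ i"
  by (simp_all add: O_theta_def field_simps)

lemma O_phi_0[simp]: "O_phi d a b c 0 = 0" by (simp add: O_phi_def)
lemma O_phi_end: "even d \<Longrightarrow> O_phi d a b c (Suc d) = 0" by (simp add: O_phi_def)

text \<open>This identity and the next three are the coefficient comparison in the cubic relation.
  Two of them continue the entries of \<open>Q\<close> by recursion, and the other two make the
  surplus terms cancel.\<close>

lemma split_coeff_theta: "O_theta d b (Suc (Suc k)) = - 2 * O_theta d b (Suc k) - O_theta d b k"
  by (simp add: O_theta_def field_simps)

lemma split_coeff_sq: "(O_theta d a (Suc k) + O_theta d a k)\<^sup>2 = 1"
  by (simp add: O_theta_simps(1) flip: power_mult)

lemma split_coeff_phi: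
  "O_phi d a b c (Suc (Suc k)) = 2 * (2 * a * b - c * (of_nat d + 1))
    - (O_theta d a k + O_theta d a (Suc k)) * (O_theta d b k + O_theta d b (Suc k))
    - 2 * O_theta d a k * O_theta d b k - 2 * O_theta d a (Suc k) * O_theta d b (Suc k)
    - 2 * O_phi d a b c (Suc k) - O_phi d a b c k"
  by (cases "even k") (simp_all add: O_phi_def O_theta_def field_simps power2_eq_square)

lemma split_coeff_diag:
  "O_phi d a b c k * (3 * O_theta d a k + O_theta d a (k - 1)) + O_phi d a b c (Suc k) * (3 * O_theta d a k + O_theta d a (Suc k))
    + 4 * (O_theta d a k)\<^sup>2 * O_theta d b k
   = 2 * (2 * a * b - c * (of_nat d + 1)) * O_theta d a k + O_theta d b k + 2 * a * c - b * (of_nat d + 1)"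
proof (cases k)
  case 0
  then show ?thesis by (simp add: O_phi_def O_theta_def field_simps power2_eq_square)
next
  case (Suc l)
  then show ?thesis
    by (cases "even l") (simp_all add: O_phi_def O_theta_def field_simps power2_eq_square)
qed

text \<open>Functionals \<open>ep j\<close> on which \<open>P\<close> is tridiagonal and \<open>Q\<close> bidiagonal. From \<open>mu 0 = ep 0\<close> and
  \<open>mu (j + 1) = mu j \<circ> (P - z j)\<close>, the single relation \<open>rel\<close> forces \<open>Q\<close> to be bidiagonal on the \<open>mu j\<close> with the
  entries of the split basis, and the chain stops after \<open>d\<close> steps because the next eigenvalue of \<open>Q\<close> does not
  occur among the diagonal entries \<open>y j\<close>.\<close>

locale bi_chain =
  fixes V :: "('i \<Rightarrow> complex) set" and P Q :: "('i \<Rightarrow> complex) \<Rightarrow> ('i \<Rightarrow> complex)"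
    and ep :: "nat \<Rightarrow> ('i \<Rightarrow> complex) \<Rightarrow> complex"
    and d :: nat and al be c :: complex and p p' p'' y q :: "nat \<Rightarrow> complex"
  assumes even_d: "even d"
    and P_V: "f \<in> V \<Longrightarrow> P f \<in> V" and Q_V: "f \<in> V \<Longrightarrow> Q f \<in> V"
    and ep_P: "f \<in> V \<Longrightarrow> j \<le> d \<Longrightarrow> ep j (P f) = p j * ep (Suc j) f + p' j * ep j f + p'' j * ep (j - 1) f"
    and ep_Q: "f \<in> V \<Longrightarrow> j \<le> d \<Longrightarrow> ep j (Q f) = y j * ep j f + q j * ep (j - 1) f"
    and p_d: "p d = 0" and p_nz: "j < d \<Longrightarrow> p j \<noteq> 0" and q_0: "q 0 = 0" and p''_0: "p'' 0 = 0"
    and rel: "f \<in> V \<Longrightarrow> j \<le> d \<Longrightarrow> ep j (P (P (Q f))) + 2 * ep j (P (Q (P f))) + ep j (Q (P (P f)))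
        = 2 * (2 * al * be - c * (of_nat d + 1)) * ep j (P f) + ep j (Q f)
          + (2 * al * c - be * (of_nat d + 1)) * ep j f"
    and y_0: "y 0 = O_theta d be 0" and y_1: "0 < d \<Longrightarrow> y 1 = O_theta d be 1"
    and base: "p 0 * q 1 + (p' 0 - O_theta d al 0) * (O_theta d be 0 - O_theta d be 1) = O_phi d al be c 1"
    and y_ne: "j \<le> d \<Longrightarrow> y j \<noteq> O_theta d be (Suc d)"
    and surj: "\<exists>f\<in>V. \<forall>j\<le>d. ep j f = g j"
begin

abbreviation "mu \<equiv> split_fun P (O_theta d al) (ep 0)"

definition in_span :: "nat \<Rightarrow> (('i \<Rightarrow> complex) \<Rightarrow> complex) \<Rightarrow> bool" where
  "in_span k g \<longleftrightarrow> (\<exists>m. \<forall>f\<in>V. g f = (\<Sum>i<k. m i * ep i f))"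

lemma in_span_cong: "in_span k g \<Longrightarrow> (\<And>f. f \<in> V \<Longrightarrow> h f = g f) \<Longrightarrow> in_span k h"
  unfolding in_span_def by auto

lemma in_span_add: "in_span k g \<Longrightarrow> in_span k h \<Longrightarrow> in_span k (\<lambda>f. g f + h f)"
  unfolding in_span_def
proof (elim exE)
  fix m m' assume "\<forall>f\<in>V. g f = (\<Sum>i<k. m i * ep i f)" "\<forall>f\<in>V. h f = (\<Sum>i<k. m' i * ep i f)"
  then show "\<exists>m. \<forall>f\<in>V. g f + h f = (\<Sum>i<k. m i * ep i f)"
    by (intro exI[of _ "\<lambda>i. m i + m' i"]) (simp add: sum.distrib distrib_right)
qed

lemma in_span_scale: "in_span k g \<Longrightarrow> in_span k (\<lambda>f. x * g f)"
  unfolding in_span_def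
proof (elim exE)
  fix m assume "\<forall>f\<in>V. g f = (\<Sum>i<k. m i * ep i f)"
  then show "\<exists>m. \<forall>f\<in>V. x * g f = (\<Sum>i<k. m i * ep i f)"
    by (intro exI[of _ "\<lambda>i. x * m i"]) (simp add: sum_distrib_left mult.assoc)
qed

lemma in_span_ep: "j < k \<Longrightarrow> in_span k (ep j)"
  unfolding in_span_def by (rule exI[of _ "\<lambda>i. if i = j then 1 else 0"]) (simp add: if_distrib[of "\<lambda>x. x * _"] cong: if_cong)

lemma in_span_zero: "in_span k (\<lambda>f. 0)"
  unfolding in_span_def by (rule exI[of _ "\<lambda>i. 0"]) simp

lemma in_span_sum: "(\<And>i. i \<in> A \<Longrightarrow> in_span k (g i)) \<Longrightarrow> in_span k (\<lambda>f. \<Sum>i\<in>A. g i f)"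
proof (induction A rule: infinite_finite_induct)
  case (insert x F)
  then show ?case using in_span_add[of k "g x" "\<lambda>f. \<Sum>i\<in>F. g i f"] by simp
qed (simp_all add: in_span_zero)

lemma in_span_mono: assumes "in_span k g" "k \<le> l" shows "in_span l g"
proof -
  obtain m where m: "\<forall>f\<in>V. g f = (\<Sum>i<k. m i * ep i f)" using assms(1) in_span_def by auto
  show ?thesis
    by (rule in_span_cong[of _ "\<lambda>f. \<Sum>i<k. m i * ep i f"], rule in_span_sum, rule in_span_scale, rule in_span_ep)
      (use m assms(2) in auto)
qed

lemma in_span_ep_P: assumes "j \<le> d" "Suc j < k \<or> j = d" "j < k" shows "in_span k (\<lambda>f. ep j (P f))"
proof (rule in_span_cong[of _ "\<lambda>f. p j * ep (Suc j) f + p' j * ep j f + p'' j * ep (j - 1) f"])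
  have "in_span k (\<lambda>f. p j * ep (Suc j) f)"
    using assms by (cases "j = d") (auto simp: p_d in_span_zero intro: in_span_scale in_span_ep)
  then show "in_span k (\<lambda>f. p j * ep (Suc j) f + p' j * ep j f + p'' j * ep (j - 1) f)"
    using assms(3) by (intro in_span_add[OF in_span_add[OF _ in_span_scale[OF in_span_ep]] in_span_scale[OF in_span_ep]]) auto
qed (use ep_P assms in auto)

lemma in_span_P: assumes "in_span k g" "k \<le> d + 1" shows "in_span (min (d + 1) (Suc k)) (\<lambda>f. g (P f))"
proof -
  obtain m where m: "\<forall>f\<in>V. g f = (\<Sum>i<k. m i * ep i f)" using assms(1) in_span_def by auto
  show ?thesis
    by (rule in_span_cong[of _ "\<lambda>f. \<Sum>i<k. m i * ep i (P f)"], rule in_span_sum, rule in_span_scale, rule in_span_ep_P)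
      (use m assms(2) P_V in auto)
qed

text \<open>The leading coefficient is \<open>p 0 * ... * p (j - 1)\<close>, nonzero up to
  \<open>j = d\<close>. The change from \<open>ep\<close> to \<open>mu\<close> is thus triangular
  and invertible.\<close>

lemma mu_form:
  assumes "j \<le> d"
  shows "\<exists>x. x \<noteq> 0 \<and> (\<exists>g. in_span j g \<and> (\<forall>f\<in>V. mu j f = x * ep j f + g f))"
  using assms
proof (induction j)
  case 0
  show ?case by (rule exI[of _ 1]) (auto intro: in_span_zero exI[of _ "\<lambda>_. 0"])
next
  case (Suc j)
  then obtain x g where x: "x \<noteq> 0" and g: "in_span j g" and mu: "\<And>f. f \<in> V \<Longrightarrow> mu j f = x * ep j f + g f"
    by auto
  let ?h = "\<lambda>f. x * (p' j * ep j f + p'' j * ep (j - 1) f) + g (P f) + (- O_theta d al j) * (x * ep j f + g f)"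
  have "in_span (Suc j) (\<lambda>f. g (P f))" using in_span_P[OF g] Suc.prems by (simp add: min_def split: if_splits)
  moreover have "in_span (Suc j) g" using g by (rule in_span_mono) simp
  ultimately have "in_span (Suc j) ?h" by (intro in_span_add in_span_scale in_span_ep) auto
  moreover have "mu (Suc j) f = (x * p j) * ep (Suc j) f + ?h f" if "f \<in> V" for f
    using that mu[OF that] mu[OF P_V[OF that]] ep_P[OF that, of j] Suc.prems by (simp add: algebra_simps)
  ultimately show ?case using x p_nz[of j] Suc.prems
    by (intro exI[of _ "x * p j"]) (auto intro!: exI[of _ ?h])
qed

lemma in_span_mu: "j \<le> d \<Longrightarrow> in_span (Suc j) (mu j)"
proof -
  assume "j \<le> d"
  then obtain x g where g: "in_span j g" and mu: "\<And>f. f \<in> V \<Longrightarrow> mu j f = x * ep j f + g f"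
    using mu_form by blast
  show ?thesis by (rule in_span_cong[OF _ mu]) (auto intro!: in_span_add in_span_scale in_span_ep in_span_mono[OF g])
qed

text \<open>The cubic relation is linear in the functional, and \<open>mu j\<close> is on
  \<open>V\<close> a combination of \<open>ep 0\<close>, ..., \<open>ep j\<close>.\<close>

lemma mu_rel:
  assumes "j \<le> d" "f \<in> V"
  shows "mu j (P (P (Q f))) + 2 * mu j (P (Q (P f))) + mu j (Q (P (P f)))
        = 2 * (2 * al * be - c * (of_nat d + 1)) * mu j (P f) + mu j (Q f)
          + (2 * al * c - be * (of_nat d + 1)) * mu j f"
proof -
  obtain m where m: "\<And>f. f \<in> V \<Longrightarrow> mu j f = (\<Sum>i<Suc j. m i * ep i f)"
    using in_span_mu[OF assms(1)] unfolding in_span_def by auto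
  have "mu j (P (P (Q f))) + 2 * mu j (P (Q (P f))) + mu j (Q (P (P f)))
     = (\<Sum>i<Suc j. m i * (ep i (P (P (Q f))) + 2 * ep i (P (Q (P f))) + ep i (Q (P (P f)))))"
    using assms by (simp add: m P_V Q_V sum.distrib sum_distrib_left algebra_simps)
  also have "\<dots> = (\<Sum>i<Suc j. m i * (2 * (2 * al * be - c * (of_nat d + 1)) * ep i (P f) + ep i (Q f)
          + (2 * al * c - be * (of_nat d + 1)) * ep i f))"
    using assms by (intro sum.cong refl) (simp add: rel)
  also have "\<dots> = 2 * (2 * al * be - c * (of_nat d + 1)) * mu j (P f) + mu j (Q f)
          + (2 * al * c - be * (of_nat d + 1)) * mu j f"
    using assms by (simp add: m P_V Q_V sum.distrib sum_distrib_left sum_subtractf algebra_simps)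
  finally show ?thesis .
qed

lemma mu_P: "mu j (P f) = O_theta d al j * mu j f + mu (Suc j) f"
  by simp

text \<open>Two-step induction. The cubic relation under \<open>mu k\<close> involves
  \<open>mu k\<close>, \<open>mu (k + 1)\<close> and \<open>mu (k + 2)\<close> applied to
  \<open>Q\<close>; the first two are known, and the third occurs with coefficient 1. The range
  includes \<open>Suc d\<close> because \<open>mu_end\<close> needs the value there.\<close>

lemma mu_Q:
  assumes "j \<le> Suc d" "f \<in> V"
  shows "mu j (Q f) = O_theta d be j * mu j f + O_phi d al be c j * mu (j - 1) f"
  using assms
proof (induction j arbitrary: f rule: less_induct)
  case (less j)
  consider "j = 0" | "j = 1" | k where "j = Suc (Suc k)" by (metis One_nat_def not0_implies_Suc)
  then show ?case
  proof cases
    case 1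
    then show ?thesis using ep_Q[of f 0] less.prems y_0 q_0 by simp
  next
    case 2
    have "mu 1 (Q f) = p 0 * ep 1 (Q f) + (p' 0 - O_theta d al 0) * ep 0 (Q f)"
      using ep_P[OF Q_V[OF less.prems(2)], of 0] p''_0 by (simp add: algebra_simps)
    also have "ep 0 (Q f) = O_theta d be 0 * ep 0 f"
      using ep_Q[OF less.prems(2), of 0] y_0 q_0 by simp
    also have "p 0 * ep 1 (Q f) = p 0 * (O_theta d be 1 * ep 1 f + q 1 * ep 0 f)"
      using ep_Q[OF less.prems(2), of 1] y_1 p_d by (cases "d = 0") auto
    also have "p 0 * (O_theta d be 1 * ep 1 f + q 1 * ep 0 f) + (p' 0 - O_theta d al 0) * (O_theta d be 0 * ep 0 f)
       = O_theta d be 1 * (p 0 * ep 1 f + (p' 0 - O_theta d al 0) * ep 0 f) + O_phi d al be c 1 * ep 0 f"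
      unfolding base[symmetric] by (simp add: algebra_simps)
    also have "p 0 * ep 1 f + (p' 0 - O_theta d al 0) * ep 0 f = mu 1 f"
      using ep_P[OF less.prems(2), of 0] p''_0 by (simp add: algebra_simps)
    finally show ?thesis using 2 by simp
  next
    case (3 k)
    have f: "f \<in> V" "P f \<in> V" "P (P f) \<in> V" using less.prems P_V by auto
    have k: "k \<le> d" "Suc k \<le> Suc d" "k \<le> Suc d" using less.prems 3 by auto
    note IH0 = less.IH[of k] and IH1 = less.IH[of "Suc k"]
    have i0: "g \<in> V \<Longrightarrow> mu k (Q g) = O_theta d be k * mu k g + O_phi d al be c k * mu (k - 1) g" for g
      using less.IH[of k] 3 k by auto
    have i1: "g \<in> V \<Longrightarrow> mu (Suc k) (Q g) = O_theta d be (Suc k) * mu (Suc k) g + O_phi d al be c (Suc k) * mu k g" for g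
      using less.IH[of "Suc k"] 3 k by auto
    define z e w where "z = O_theta d al" and "e = O_theta d be" and "w = O_phi d al be c"
    define \<kappa> \<kappa>' where "\<kappa> = 2 * al * be - c * (of_nat d + 1)" and "\<kappa>' = 2 * al * c - be * (of_nat d + 1)"
    define A B C E X where "A = mu k f" and "B = mu (Suc k) f" and "C = mu (Suc (Suc k)) f"
      and "E = mu (k - 1) f" and "X = mu (Suc (Suc k)) (Q f)"
    have mP: "mu j (P g) = z j * mu j g + mu (Suc j) g" for j g by (simp add: z_def)
    have i0': "g \<in> V \<Longrightarrow> mu k (Q g) = e k * mu k g + w k * mu (k - 1) g" for g
      unfolding e_def w_def by (rule i0)
    have i1': "g \<in> V \<Longrightarrow> mu (Suc k) (Q g) = e (Suc k) * mu (Suc k) g + w (Suc k) * mu k g" for g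
      unfolding e_def w_def by (rule i1)
    \<comment> \<open>The factor \<open>w k\<close> is kept because for \<open>k = 0\<close> the
      truncated index \<open>k - 1\<close> is wrong, while \<open>w 0 = 0\<close> removes the
      term.\<close>
    have l: "w k * mu (k - 1) (P g) = w k * (z (k - 1) * mu (k - 1) g + mu k g)" for g
      using mP[of "k - 1" g] by (cases "k = 0") (simp_all add: w_def del: split_fun.simps)
    have a: "mu k (P (P (Q f))) = z k * (z k * (e k * A + w k * E) + (e (Suc k) * B + w (Suc k) * A))
        + (z (Suc k) * (e (Suc k) * B + w (Suc k) * A) + X)"
      unfolding mP i0'[OF f(1)] i1'[OF f(1)] A_def B_def E_def X_def by (rule refl)
    have b: "mu k (P (Q (P f))) = z k * (e k * (z k * A + B) + w k * (z (k - 1) * E + A))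
        + (e (Suc k) * (z (Suc k) * B + C) + w (Suc k) * (z k * A + B))"
      unfolding mP[of k] mP[of "Suc k"] i0'[OF f(2)] i1'[OF f(2)] l A_def B_def C_def E_def by (rule refl)
    have c: "mu k (Q (P (P f))) = e k * (z k * (z k * A + B) + (z (Suc k) * B + C))
        + w k * (z (k - 1) * (z (k - 1) * E + A) + (z k * A + B))"
    proof -
      have "w k * mu (k - 1) (P (P f)) = z (k - 1) * (w k * mu (k - 1) (P f)) + w k * mu k (P f)"
        by (subst l) (simp add: algebra_simps del: split_fun.simps)
      then show ?thesis
        unfolding i0'[OF f(3)] l mP[of k] mP[of "Suc k"] A_def B_def C_def E_def by (simp add: algebra_simps del: split_fun.simps)
    qed
    have r: "mu k (P (P (Q f))) + 2 * mu k (P (Q (P f))) + mu k (Q (P (P f)))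
        = 2 * \<kappa> * (z k * A + B) + (e k * A + w k * E) + \<kappa>' * A"
      using mu_rel[OF k(1) f(1)] unfolding \<kappa>_def \<kappa>'_def mP i0'[OF f(1)] A_def B_def E_def .
    \<comment> \<open>Consecutive entries of \<open>O_theta\<close> add up to 1 or -1, which kills
      the coefficient of \<open>mu (k - 1)\<close>.\<close>
    have cE: "w k * E * ((z k + z (k - 1))\<^sup>2 - 1) = 0"
      using split_coeff_sq[of d al "k - 1"] by (cases k) (simp_all add: w_def z_def)
    have cA: "w k * (3 * z k + z (k - 1)) + w (Suc k) * (3 * z k + z (Suc k)) + 4 * (z k)\<^sup>2 * e k
       = 2 * \<kappa> * z k + e k + \<kappa>'"
      unfolding w_def z_def e_def \<kappa>_def \<kappa>'_def split_coeff_diag by simp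
    \<comment> \<open>The relation solved for \<open>X\<close> and sorted by \<open>C\<close>,
      \<open>B\<close>, \<open>A\<close>, \<open>E\<close>; one coefficient identity settles each of
      the four.\<close>
    have "X = (- 2 * e (Suc k) - e k) * C
      + (2 * \<kappa> - (z k + z (Suc k)) * (e k + e (Suc k)) - 2 * z k * e k - 2 * z (Suc k) * e (Suc k) - 2 * w (Suc k) - w k) * B
      + (2 * \<kappa> * z k + e k + \<kappa>' - (w k * (3 * z k + z (k - 1)) + w (Suc k) * (3 * z k + z (Suc k)) + 4 * (z k)\<^sup>2 * e k)) * A
      - w k * E * ((z k + z (k - 1))\<^sup>2 - 1)"
      using r unfolding a b c by (simp add: algebra_simps power2_eq_square)
    then have "X = e (Suc (Suc k)) * C + w (Suc (Suc k)) * B"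
      unfolding cE cA unfolding w_def e_def z_def \<kappa>_def split_coeff_theta[of d be k] split_coeff_phi[of d al be c k] by simp
    then show ?thesis unfolding 3 X_def C_def B_def e_def w_def by simp
  qed
qed

text \<open>Since \<open>p d = 0\<close>, this functional lies in the span of \<open>ep 0\<close>,
  ..., \<open>ep d\<close>. By \<open>mu_Q\<close> and the zero of \<open>O_phi\<close> at
  \<open>Suc d\<close> it is a left eigenvector of \<open>Q\<close>, but on that span
  \<open>Q\<close> is triangular with diagonal \<open>y j\<close>, none of which is the required
  eigenvalue.\<close>

lemma mu_end: assumes "f \<in> V" shows "mu (Suc d) f = 0"
proof -
  have "in_span (Suc d) (\<lambda>f. mu d (P f))" using in_span_P[OF in_span_mu[of d]] by simp
  then have "in_span (Suc d) (mu (Suc d))"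
    by (rule in_span_cong[OF in_span_add[OF _ in_span_scale[OF in_span_mu[of d], of "- O_theta d al d"]]]) simp_all
  then obtain m where m: "\<And>f. f \<in> V \<Longrightarrow> mu (Suc d) f = (\<Sum>i<Suc d. m i * ep i f)"
    unfolding in_span_def by auto
  have "m j = 0" if "j \<le> d" for j
    using that
  proof (induction "d - j" arbitrary: j rule: less_induct)
    case less
    \<comment> \<open>Evaluation at a vector dual to \<open>ep j\<close> isolates
      \<open>m j\<close>: larger indices are settled by induction, and smaller ones do not see
      \<open>Q g\<close> because \<open>ep_Q\<close> only looks downwards.\<close>
    obtain g where g: "g \<in> V" "\<And>i. i \<le> d \<Longrightarrow> ep i g = (if i = j then 1 else 0)"
      using surj[of "\<lambda>i. if i = j then 1 else 0"] by auto
    have *: "m i * ep i (Q g) = (if i = j then m j * y j else 0)" if "i < Suc d" for i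
    proof (cases "j < i")
      case True
      then show ?thesis using less.hyps[of i] that by simp
    next
      case False
      then show ?thesis using ep_Q[OF g(1), of i] g(2)[of i] g(2)[of "i - 1"] that q_0 less.prems
        by (cases "i = 0") auto
    qed
    have "mu (Suc d) (Q g) = m j * y j"
    proof -
      have "(\<Sum>i<Suc d. m i * ep i (Q g)) = (\<Sum>i<Suc d. if i = j then m j * y j else 0)"
        using * by (intro sum.cong refl) (simp only: lessThan_iff)
      then show ?thesis using less.prems
        by (simp add: m[OF Q_V[OF g(1)]] less_Suc_eq_le del: split_fun.simps sum.lessThan_Suc)
    qed
    moreover have "mu (Suc d) g = m j"
    proof -
      have "(\<Sum>i<Suc d. m i * ep i g) = (\<Sum>i<Suc d. if i = j then m j else 0)"
        using g(2) by (intro sum.cong refl) simp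
      then show ?thesis using less.prems
        by (simp add: m[OF g(1)] less_Suc_eq_le del: split_fun.simps sum.lessThan_Suc)
    qed
    ultimately have "m j * y j = O_theta d be (Suc d) * m j"
      using mu_Q[of "Suc d" g] g(1) O_phi_end[OF even_d] by simp
    then show ?case using y_ne[OF less.prems] by (simp add: mult.commute)
  qed
  then show ?thesis using m[OF assms] by simp
qed

lemma mu_zero_iff: assumes "f \<in> V" shows "(\<forall>j\<le>d. mu j f = 0) \<longleftrightarrow> (\<forall>j\<le>d. ep j f = 0)"
proof
  assume e: "\<forall>j\<le>d. ep j f = 0"
  show "\<forall>j\<le>d. mu j f = 0"
  proof (intro allI impI)
    fix j assume "j \<le> d"
    then obtain m where "mu j f = (\<Sum>i<Suc j. m i * ep i f)"
      using in_span_mu[of j] assms unfolding in_span_def by auto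
    then show "mu j f = 0" using e \<open>j \<le> d\<close> by simp
  qed
next
  assume mu: "\<forall>j\<le>d. mu j f = 0"
  have "ep j f = 0" if "j \<le> d" for j
    using that
  proof (induction j rule: less_induct)
    case (less j)
    obtain x g where "x \<noteq> 0" "in_span j g" "mu j f = x * ep j f + g f"
      using mu_form[OF less.prems] assms by auto
    moreover from \<open>in_span j g\<close> have "g f = 0" using less assms unfolding in_span_def by auto
    ultimately show ?case using mu less.prems by simp
  qed
  then show "\<forall>j\<le>d. ep j f = 0" by simp
qed

text \<open>The values \<open>g\<close> are chosen before \<open>f\<close>, so that later a single
  polynomial can realise the prescriptions for both spins at once.\<close>

lemma mu_prescribe: "\<exists>g. \<forall>f\<in>V. (\<forall>j\<le>d. ep j f = g j) \<longrightarrow> (\<forall>j\<le>d. mu j f = h j)"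
proof -
  have "\<exists>g. \<forall>f\<in>V. (\<forall>j<k. ep j f = g j) \<longrightarrow> (\<forall>j<k. mu j f = h j)" if "k \<le> Suc d" for k
    using that
  proof (induction k)
    case (Suc k)
    then obtain g where g: "\<And>f. f \<in> V \<Longrightarrow> (\<forall>j<k. ep j f = g j) \<Longrightarrow> (\<forall>j<k. mu j f = h j)" by auto
    obtain x u m where x: "x \<noteq> 0" "\<And>f. f \<in> V \<Longrightarrow> mu k f = x * ep k f + u f"
      and u: "\<And>f. f \<in> V \<Longrightarrow> u f = (\<Sum>i<k. m i * ep i f)"
      using mu_form[of k] Suc.prems unfolding in_span_def by auto
    let ?g = "g(k := (h k - (\<Sum>i<k. m i * g i)) / x)"
    have "\<forall>j<Suc k. mu j f = h j" if f: "f \<in> V" "\<forall>j<Suc k. ep j f = ?g j" for f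
    proof -
      have "\<forall>j<k. ep j f = g j" using f(2) by (metis fun_upd_other less_SucI less_irrefl)
      then have 1: "\<forall>j<k. mu j f = h j" "u f = (\<Sum>i<k. m i * g i)" using g u f(1) by auto
      moreover have "ep k f = (h k - (\<Sum>i<k. m i * g i)) / x" using f(2) by simp
      ultimately have "mu k f = h k" using x f(1) by simp
      then show ?thesis using 1 less_Suc_eq by auto
    qed
    then show ?case by blast
  qed simp
  from this[of "Suc d"] show ?thesis by (simp add: less_Suc_eq_le)
qed

lemma mu_surj: "\<exists>f\<in>V. \<forall>j\<le>d. mu j f = h j"
  using mu_prescribe[of h] surj by meson

end

section \<open>Linear chains and the submodule argument\<close>

definition lin_fun :: "(('i \<Rightarrow> complex) \<Rightarrow> complex) \<Rightarrow> bool" where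
  "lin_fun g \<longleftrightarrow> (\<forall>u v x. g (vadd u v) = g u + g v \<and> g (vsmul x u) = x * g u)"

locale bi_chain_linear = bi_chain V P Q ep d al be c p p' p'' y q
  for V :: "('i \<Rightarrow> complex) set" and P Q ep d al be c p p' p'' y q +
  assumes ep_lin: "\<And>j. lin_fun (ep j)"
    and V_add: "f \<in> V \<Longrightarrow> h \<in> V \<Longrightarrow> vadd f h \<in> V" and V_smul: "f \<in> V \<Longrightarrow> vsmul x f \<in> V"
begin

lemma ep_linear: "ep j (vadd f g) = ep j f + ep j g" "ep j (vsmul x f) = x * ep j f"
  using ep_lin by (auto simp: lin_fun_def)

lemma mu_smul:
  assumes "j \<le> d" "f \<in> V"
  shows "mu j (vsmul x f) = x * mu j f"
proof -
  obtain m where m: "\<And>f. f \<in> V \<Longrightarrow> mu j f = (\<Sum>i<Suc j. m i * ep i f)"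
    using in_span_mu[OF assms(1)] unfolding in_span_def by auto
  show ?thesis
    using assms by (simp add: m V_smul ep_linear sum_distrib_left algebra_simps del: sum.lessThan_Suc)
qed

lemma mu_add:
  assumes "j \<le> d" "f \<in> V" "g \<in> V"
  shows "mu j (vadd f g) = mu j f + mu j g"
proof -
  obtain m where m: "\<And>f. f \<in> V \<Longrightarrow> mu j f = (\<Sum>i<Suc j. m i * ep i f)"
    using in_span_mu[OF assms(1)] unfolding in_span_def by auto
  show ?thesis
    using assms by (simp add: m V_add ep_linear sum.distrib algebra_simps del: sum.lessThan_Suc)
qed

lemmas mu_linear = mu_add mu_smul

text \<open>Modulo the common kernel of the \<open>mu j\<close>, the space is spanned by the vectors
  dual to them; subtracting these one by one removes the highest index.\<close>

lemma mu_span_induct: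
  assumes K: "\<And>f. f \<in> V \<Longrightarrow> (\<And>j. j \<le> d \<Longrightarrow> mu j f = 0) \<Longrightarrow> Z f"
    and v: "\<And>k f. k \<le> d \<Longrightarrow> f \<in> V \<Longrightarrow> (\<And>j. j \<le> d \<Longrightarrow> mu j f = (if j = k then 1 else 0)) \<Longrightarrow> Z f"
    and add: "\<And>f g. f \<in> V \<Longrightarrow> g \<in> V \<Longrightarrow> Z f \<Longrightarrow> Z g \<Longrightarrow> Z (vadd f g)"
    and smul: "\<And>f x. f \<in> V \<Longrightarrow> Z f \<Longrightarrow> Z (vsmul x f)"
    and f: "f \<in> V"
  shows "Z f"
proof -
  have "Z f" if "f \<in> V" "\<And>j. k \<le> j \<Longrightarrow> j \<le> d \<Longrightarrow> mu j f = 0" "k \<le> Suc d" for k f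
    using that
  proof (induction k arbitrary: f)
    case 0
    then show ?case using K by simp
  next
    case (Suc k)
    obtain u where u: "u \<in> V" "\<And>j. j \<le> d \<Longrightarrow> mu j u = (if j = k then 1 else 0)"
      using mu_surj[of "\<lambda>j. if j = k then 1 else 0"] by auto
    have Zu: "Z u" using v[of k u] u Suc.prems by auto
    define h where "h = vadd f (vsmul (- mu k f) u)"
    have h: "h \<in> V" using Suc.prems u unfolding h_def by (auto intro: V_add V_smul)
    have mu_h: "mu j h = mu j f - mu k f * mu j u" if "j \<le> d" for j
      using that Suc.prems u by (simp add: h_def mu_linear V_smul)
    have "mu j h = 0" if "k \<le> j" "j \<le> d" for j
      using that Suc.prems(2)[of j] mu_h[of j] u(2)[of j] by (cases "j = k") auto
    then have "Z h" using Suc.IH[OF h] Suc.prems by auto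
    moreover have "f = vadd h (vsmul (mu k f) u)"
      by (simp add: h_def vadd_def vsmul_def)
    ultimately show ?case using add[OF h V_smul[OF u(1)]] smul[OF u(1) Zu] by metis
  qed
  from this[of f "Suc d"] f show ?thesis by simp
qed

text \<open>\<open>ga J\<close> is a left eigenvector of \<open>P\<close> with eigenvalue \<open>z 0\<close>, and \<open>Q\<close> leads from it down to \<open>ga 0 = ep 0\<close>.
  Hence it is nonzero on every submodule not killed by all \<open>mu j\<close>. The product of the \<open>P - z i\<close>, \<open>i \<ge> 1\<close>, is a rank-one
  operator proportional to \<open>ga J\<close> with image spanned by the first basis vector.\<close>

lemma submodule_total:
  fixes ga :: "nat \<Rightarrow> ('i \<Rightarrow> complex) \<Rightarrow> complex" and J :: nat
  assumes phi: "\<And>i. 1 \<le> i \<Longrightarrow> i \<le> d \<Longrightarrow> O_phi d al be c i \<noteq> 0"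
    and g0: "\<And>f. f \<in> V \<Longrightarrow> ga 0 f = ep 0 f"
    and gQ: "\<And>j f. f \<in> V \<Longrightarrow> 1 \<le> j \<Longrightarrow> j \<le> J \<Longrightarrow> ga j (Q f) = y' j * ga j f + c' j * ga (j - 1) f"
    and c': "\<And>j. 1 \<le> j \<Longrightarrow> j \<le> J \<Longrightarrow> c' j \<noteq> 0"
    and gP: "\<And>f. f \<in> V \<Longrightarrow> ga J (P f) = O_theta d al 0 * ga J f"
    and gK: "\<And>f. f \<in> V \<Longrightarrow> (\<And>j. j \<le> d \<Longrightarrow> ep j f = 0) \<Longrightarrow> ga J f = 0"
    and glin: "lin_fun (ga J)"
    and U: "U \<subseteq> V" "\<And>f g. f \<in> U \<Longrightarrow> g \<in> U \<Longrightarrow> vadd f g \<in> U" "\<And>f x. f \<in> U \<Longrightarrow> vsmul x f \<in> U"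
      "\<And>f. f \<in> U \<Longrightarrow> P f \<in> U" "\<And>f. f \<in> U \<Longrightarrow> Q f \<in> U"
    and UK: "\<And>f. f \<in> V \<Longrightarrow> (\<And>j. j \<le> d \<Longrightarrow> mu j f = 0) \<Longrightarrow> f \<in> U"
    and ne: "h \<in> U" "i \<le> d" "mu i h \<noteq> 0"
  shows "V \<subseteq> U"
proof -
  define z where "z = O_theta d al"
  have zP: "mu j (P f) = z j * mu j f + mu (Suc j) f" for j f by (simp add: z_def)
  \<comment> \<open>If \<open>mu 0\<close> vanished on the \<open>P\<close>-stable set
    \<open>U\<close>, so would every \<open>mu j\<close>, each being \<open>mu 0\<close> after a
    polynomial in \<open>P\<close>.\<close>
  have 1: "\<exists>f\<in>U. mu 0 f \<noteq> 0"
  proof (rule ccontr)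
    assume "\<not> (\<exists>f\<in>U. mu 0 f \<noteq> 0)"
    then have 0: "mu 0 f = 0" if "f \<in> U" for f using that by blast
    have "\<forall>f\<in>U. mu j f = 0" for j
    proof (induction j)
      case (Suc j)
      then show ?case using U(4) by simp
    qed (use 0 in blast)
    then show False using ne by auto
  qed
  \<comment> \<open>Vanishing of \<open>ga J\<close> on \<open>U\<close> would descend along
    \<open>Q\<close>, the factors \<open>c' j\<close> being nonzero, to
    \<open>ga 0 = ep 0 = mu 0\<close>.\<close>
  have 2: "\<exists>f\<in>U. ga J f \<noteq> 0"
  proof (rule ccontr)
    assume n: "\<not> (\<exists>f\<in>U. ga J f \<noteq> 0)"
    have "\<forall>f\<in>U. ga (J - j) f = 0" if "j \<le> J" for j
      using that
    proof (induction j)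
      case (Suc j)
      show ?case
      proof
        fix f assume f: "f \<in> U"
        have "ga (J - j) f = 0" "ga (J - j) (Q f) = 0" using Suc f U(5) by auto
        then have "c' (J - j) * ga (J - j - 1) f = 0"
          using gQ[of f "J - j"] f U(1) Suc.prems by auto
        then show "ga (J - Suc j) f = 0" using c'[of "J - j"] Suc.prems by simp
      qed
    qed (use n in auto)
    moreover obtain f where f: "f \<in> U" "ep 0 f \<noteq> 0" using 1 by auto
    ultimately have "ga 0 f = 0" by (metis diff_self_eq_0 order_refl)
    then show False using f U(1) g0[of f] by auto
  qed
  have "\<exists>v. \<forall>k. v k \<in> V \<and> (\<forall>j\<le>d. mu j (v k) = (if j = k then 1 else 0))"
  proof (intro choice allI)
    fix k
    show "\<exists>u. u \<in> V \<and> (\<forall>j\<le>d. mu j u = (if j = k then 1 else 0))"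
      using mu_surj[of "\<lambda>j. if j = k then 1 else 0"] by (simp only: Bex_def)
  qed
  then obtain v where vv: "\<forall>k. v k \<in> V \<and> (\<forall>j\<le>d. mu j (v k) = (if j = k then 1 else 0))"
    by (elim exE)
  have v: "v k \<in> V" "j \<le> d \<Longrightarrow> mu j (v k) = (if j = k then 1 else 0)" for k j
    using vv by (simp_all only:)
  have ga_lin: "ga J (vadd f g) = ga J f + ga J g" "ga J (vsmul x f) = x * ga J f" for f g x
    using glin by (auto simp: lin_fun_def)
  have gK': "ga J f = 0" if "f \<in> V" "\<And>j. j \<le> d \<Longrightarrow> mu j f = 0" for f
    using that gK[of f] mu_zero_iff[of f] by auto
  have expand: "ga J f = (\<Sum>j\<le>d. mu j f * ga J (v j))" if "f \<in> V" for f
  proof (rule mu_span_induct[OF _ _ _ _ that])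
    show "ga J f = (\<Sum>j\<le>d. mu j f * ga J (v j))" if "f \<in> V" "\<And>j. j \<le> d \<Longrightarrow> mu j f = 0" for f
      using that gK'[of f] by simp
    show "ga J f = (\<Sum>j\<le>d. mu j f * ga J (v j))"
      if "k \<le> d" "f \<in> V" and f: "\<And>j. j \<le> d \<Longrightarrow> mu j f = (if j = k then 1 else 0)" for k f
    proof -
      have "ga J (vadd f (vsmul (-1) (v k))) = 0"
        using that v by (intro gK') (auto intro: V_add V_smul simp: mu_linear V_smul)
      moreover have "(\<Sum>j\<le>d. mu j f * ga J (v j)) = (\<Sum>j\<le>d. if j = k then ga J (v k) else 0)"
        using f by (intro sum.cong refl) auto
      ultimately show ?thesis using that(1) by (simp add: ga_lin)
    qed
  qed (simp_all add: ga_lin mu_linear sum.distrib sum_distrib_left algebra_simps)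
  define r where "r j = ga J (v j)" for j
  \<comment> \<open>The left eigenvector equation, tested on the dual vectors, determines all
    coefficients of \<open>ga J\<close> from the last one.\<close>
  have r: "r j = (z 0 - z (Suc j)) * r (Suc j)" if "Suc j \<le> d" for j
  proof -
    have *: "mu i (P (v (Suc j))) = (if i = Suc j then z (Suc j) else if i = j then 1 else 0)" if "i \<le> d" for i
      using v(2)[of i "Suc j"] v(2)[of "Suc i" "Suc j"] mu_end[OF v(1)] that \<open>Suc j \<le> d\<close>
      by (cases "i = d") (auto simp: zP simp del: split_fun.simps)
    have "z 0 * r (Suc j) = (\<Sum>i\<le>d. mu i (P (v (Suc j))) * r i)"
      using gP[OF v(1)] expand[OF P_V[OF v(1)]] by (simp add: r_def z_def)
    also have "\<dots> = (\<Sum>i\<le>d. (if i = Suc j then z (Suc j) * r (Suc j) else 0) + (if i = j then r j else 0))"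
      by (intro sum.cong refl) (auto simp: *)
    also have "\<dots> = z (Suc j) * r (Suc j) + r j" using that by (simp add: sum.distrib)
    finally show ?thesis by (simp add: algebra_simps)
  qed
  \<comment> \<open>\<open>x k j\<close> is the coefficient of \<open>mu j\<close> in
    \<open>mu 0\<close> composed with \<open>P - z 1\<close>, ..., \<open>P - z k\<close>; the
    identity \<open>S_step\<close> expresses this inductively.\<close>
  define x where "x k j = (\<Prod>i\<in>{j<..k}. z 0 - z i)" for k j :: nat
  have x_Suc: "x (Suc k) j = x k j * (z 0 - z (Suc k))" if "j \<le> k" for k j
  proof -
    have "{j<..Suc k} = insert (Suc k) {j<..k}" using that by auto
    then show ?thesis by (simp add: x_def mult.commute)
  qed
  have x_refl: "x k k = 1" for k by (simp add: x_def)
  have x_pred: "x k j = (z 0 - z (Suc j)) * x k (Suc j)" if "j < k" for k j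
  proof -
    have "{j<..k} = insert (Suc j) {Suc j<..k}" using that by auto
    then show ?thesis by (simp add: x_def)
  qed
  have r_x: "r j = x d j * r d" if "j \<le> d" for j
    using that
  proof (induction "d - j" arbitrary: j)
    case (Suc m)
    then show ?case using r[of j] x_pred[of j d] Suc.hyps(1)[of "Suc j"] by simp
  qed (simp add: x_refl)
  have S_step: "(\<Sum>j\<le>k. x k j * (u (Suc j) + (z j - z (Suc k)) * u j)) = (\<Sum>j\<le>Suc k. x (Suc k) j * u j)"
    for k and u :: "nat \<Rightarrow> complex"
  proof -
    have a: "(\<Sum>j\<le>k. x k j * (z 0 - z j) * u j) = (\<Sum>j<k. x k j * u (Suc j))"
    proof (cases k)
      case (Suc l)
      have "(\<Sum>j\<le>Suc l. x k j * (z 0 - z j) * u j) = (\<Sum>j\<le>l. x k (Suc j) * (z 0 - z (Suc j)) * u (Suc j))"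
        by (subst sum.atMost_Suc_shift) simp
      also have "\<dots> = (\<Sum>j<k. x k j * u (Suc j))"
        unfolding Suc lessThan_Suc_atMost by (intro sum.cong refl) (simp add: x_pred mult.commute)
      finally show ?thesis using Suc by simp
    qed simp
    have "(\<Sum>j\<le>Suc k. x (Suc k) j * u j) = (\<Sum>j\<le>k. x k j * (z 0 - z (Suc k)) * u j) + u (Suc k)"
      by (simp add: x_refl x_Suc)
    also have "(\<Sum>j\<le>k. x k j * (z 0 - z (Suc k)) * u j)
       = (\<Sum>j\<le>k. x k j * (z 0 - z j) * u j) + (\<Sum>j\<le>k. x k j * (z j - z (Suc k)) * u j)"
      by (simp add: algebra_simps flip: sum.distrib)
    also have "(\<Sum>j\<le>k. x k j * (z 0 - z j) * u j) + (\<Sum>j\<le>k. x k j * (z j - z (Suc k)) * u j) + u (Suc k)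
       = (\<Sum>j\<le>k. x k j * (z j - z (Suc k)) * u j) + (\<Sum>j\<le>k. x k j * u (Suc j))"
      unfolding a using x_refl by (simp add: lessThan_Suc_atMost[symmetric] del: lessThan_Suc_atMost)
    finally have "(\<Sum>j\<le>Suc k. x (Suc k) j * u j)
       = (\<Sum>j\<le>k. x k j * (z j - z (Suc k)) * u j + x k j * u (Suc j))" by (simp only: sum.distrib)
    then show ?thesis by (simp only:) (intro sum.cong refl, simp add: algebra_simps)
  qed
  \<comment> \<open>Each application of \<open>P - z (k + 1)\<close> removes the top component, by
    \<open>mu_end\<close> at the first stage, and keeps the nonzero pairing. At \<open>k = 0\<close>
    a nonzero multiple of the first dual vector is left, modulo the kernel.\<close>
  have red: "\<exists>g\<in>U. (\<forall>j. k < j \<longrightarrow> j \<le> d \<longrightarrow> mu j g = 0) \<and> (\<Sum>j\<le>k. x k j * mu j g) \<noteq> 0" if "k \<le> d" for k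
    using that
  proof (induction "d - k" arbitrary: k)
    case 0
    obtain f where f: "f \<in> U" "ga J f \<noteq> 0" using 2 by auto
    have "ga J f = (\<Sum>j\<le>d. mu j f * r j)"
      using expand[of f] f(1) U(1) unfolding r_def by blast
    also have "\<dots> = (\<Sum>j\<le>d. mu j f * (x d j * r d))"
      by (intro sum.cong refl arg_cong2[of _ _ _ _ "(*)"] r_x) (simp only: atMost_iff)
    finally have "ga J f = r d * (\<Sum>j\<le>d. x d j * mu j f)" by (simp add: sum_distrib_left algebra_simps)
    then have "(\<Sum>j\<le>d. x d j * mu j f) \<noteq> 0" using f(2) by (metis mult_zero_right)
    moreover have "k = d" using 0 by simp
    ultimately show ?case using f(1) by (intro bexI[of _ f]) auto
  next
    case (Suc m)
    have IH: "\<exists>g\<in>U. (\<forall>j. Suc k < j \<longrightarrow> j \<le> d \<longrightarrow> mu j g = 0) \<and> (\<Sum>j\<le>Suc k. x (Suc k) j * mu j g) \<noteq> 0"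
      by (rule Suc.hyps(1)) (use Suc.hyps(2) in linarith)+
    obtain g where g: "g \<in> U" "(\<Sum>j\<le>Suc k. x (Suc k) j * mu j g) \<noteq> 0"
      and g_zero: "\<forall>j. Suc k < j \<longrightarrow> j \<le> d \<longrightarrow> mu j g = 0"
      using IH by (elim bexE conjE) (rule that)
    have gV: "g \<in> V" using g U by auto
    define h where "h = vadd (P g) (vsmul (- z (Suc k)) g)"
    have mh: "mu j h = mu (Suc j) g + (z j - z (Suc k)) * mu j g" if "j \<le> d" for j
      using that gV by (simp add: h_def mu_linear P_V V_smul zP algebra_simps del: split_fun.simps)
    have "h \<in> U" using g U by (auto simp: h_def)
    moreover have "mu j h = 0" if "k < j" "j \<le> d" for j
      using that g_zero[rule_format, of j] g_zero[rule_format, of "Suc j"] mh[of j] mu_end[OF gV]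
      by (cases "j = Suc k"; cases "j = d") (auto simp del: split_fun.simps)
    moreover have "(\<Sum>j\<le>k. x k j * mu j h) = (\<Sum>j\<le>Suc k. x (Suc k) j * mu j g)"
    proof -
      have "(\<Sum>j\<le>k. x k j * mu j h) = (\<Sum>j\<le>k. x k j * (mu (Suc j) g + (z j - z (Suc k)) * mu j g))"
        by (intro sum.cong refl arg_cong2[of _ _ _ _ "(*)"] mh) (use Suc.prems in simp)
      then show ?thesis unfolding S_step[of k "\<lambda>j. mu j g"] .
    qed
    ultimately show ?case using g(2) by (intro bexI[of _ h]) auto
  qed
  obtain g where g: "g \<in> U" "\<And>j. 0 < j \<Longrightarrow> j \<le> d \<Longrightarrow> mu j g = 0" "mu 0 g \<noteq> 0"
    using red[of 0] by (auto simp: x_def)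
  \<comment> \<open>\<open>Q\<close> minus its diagonal entry sends the dual vector
    \<open>v k\<close> to a nonzero multiple of \<open>v (k + 1)\<close> modulo the kernel, and the
    kernel lies in \<open>U\<close>.\<close>
  have v_U: "v k \<in> U" if "k \<le> d" for k
    using that
  proof (induction k)
    case 0
    define w where "w = vadd (v 0) (vsmul (- 1 / mu 0 g) g)"
    have gV: "g \<in> V" using g U by auto
    have "w \<in> U"
    proof (rule UK)
      show "w \<in> V" using v(1) gV unfolding w_def by (intro V_add V_smul)
      show "mu j w = 0" if "j \<le> d" for j
        using that g v(2)[of j 0] gV by (cases "j = 0") (simp_all add: w_def mu_linear v(1) V_smul del: split_fun.simps)
    qed
    moreover have "v 0 = vadd w (vsmul (1 / mu 0 g) g)"
      by (simp add: w_def vadd_def vsmul_def)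
    ultimately show ?case using U(2,3) g(1) by metis
  next
    case (Suc k)
    define ph where "ph = O_phi d al be c (Suc k)"
    have ph: "ph \<noteq> 0" using phi[of "Suc k"] Suc.prems by (simp add: ph_def)
    define u where "u = vadd (Q (v k)) (vsmul (- O_theta d be k) (v k))"
    have uU: "u \<in> U" using Suc U(2,3,5) by (auto simp: u_def)
    have uV: "u \<in> V" using uU U by auto
    have mu_u: "mu j u = (if j = Suc k then ph else 0)" if "j \<le> d" for j
    proof -
      have "mu j u = (O_theta d be j - O_theta d be k) * mu j (v k) + O_phi d al be c j * mu (j - 1) (v k)"
        using that v(1) by (simp add: u_def mu_linear V_smul Q_V mu_Q algebra_simps del: split_fun.simps)
      then show ?thesis using v(2)[of j k] v(2)[of "j - 1" k] that
        by (cases "j = 0") (auto simp: ph_def simp del: split_fun.simps)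
    qed
    define w where "w = vadd (v (Suc k)) (vsmul (- 1 / ph) u)"
    have "w \<in> U"
    proof (rule UK)
      show "w \<in> V" using v(1) uV unfolding w_def by (intro V_add V_smul)
      show "mu j w = 0" if "j \<le> d" for j
        using that mu_u[of j] v(2)[of j "Suc k"] uV ph by (simp add: w_def mu_linear v(1) V_smul del: split_fun.simps)
    qed
    moreover have "v (Suc k) = vadd w (vsmul (1 / ph) u)"
      by (simp add: w_def vadd_def vsmul_def)
    ultimately show ?case using U(2,3) uU by metis
  qed
  show "V \<subseteq> U"
  proof
    fix f assume "f \<in> V"
    then show "f \<in> U"
    proof (rule mu_span_induct[rotated -1])
      show "f \<in> U" if "k \<le> d" "f \<in> V" and f: "\<And>j. j \<le> d \<Longrightarrow> mu j f = (if j = k then 1 else 0)" for k f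
      proof -
        have "vadd f (vsmul (-1) (v k)) \<in> U"
          using that v by (intro UK) (auto intro: V_add V_smul simp: mu_linear V_smul simp del: split_fun.simps)
        moreover have "f = vadd (vadd f (vsmul (-1) (v k))) (v k)"
          by (simp add: vadd_def vsmul_def)
        ultimately show ?thesis using U(2) v_U[OF that(1)] by metis
      qed
    qed (use UK U in auto)
  qed
qed

end

section \<open>Homomorphisms onto the standard modules\<close>

lemma bm_hom_subset:
  "bm_hom f V W \<Longrightarrow> bm_carrier V' \<subseteq> bm_carrier V \<Longrightarrow> bm_X V' = bm_X V \<Longrightarrow> bm_Y V' = bm_Y V
   \<Longrightarrow> bm_Z V' = bm_Z V \<Longrightarrow> bm_hom f V' W"
  unfolding bm_hom_def lin_on_def by (auto simp: subset_iff)

lemma bm_hom_pair: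
  assumes "bm_hom f V W1" "bm_hom g V W2"
  shows "bm_hom (\<lambda>v. case_sum (f v) (g v)) V (dsum W1 W2)"
  using assms unfolding bm_hom_def lin_on_def dsum_def
  by (auto simp: sumop_def vadd_def vsmul_def fun_eq_iff split: sum.split)

lemma case_sum_eq_vzero: "case_sum u v = vzero \<longleftrightarrow> u = vzero \<and> v = vzero"
  by (auto simp: vzero_def fun_eq_iff split: sum.split)

lemma dsum_carrierE:
  assumes "u \<in> bm_carrier (dsum W1 W2)"
  obtains v w where "v \<in> bm_carrier W1" "w \<in> bm_carrier W2" "u = case_sum v w"
proof
  show "(\<lambda>i. u (Inl i)) \<in> bm_carrier W1" "(\<lambda>i. u (Inr i)) \<in> bm_carrier W2"
    using assms by (simp_all add: dsum_def)
  show "u = case_sum (\<lambda>i. u (Inl i)) (\<lambda>i. u (Inr i))"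
    by (auto simp: fun_eq_iff split: sum.split)
qed

lemma bm_quot_isomorphic_pairI:
  assumes "bm_hom f V W1" "bm_hom g V W2"
    and "\<And>u w. u \<in> bm_carrier W1 \<Longrightarrow> w \<in> bm_carrier W2 \<Longrightarrow> \<exists>v\<in>bm_carrier V. f v = u \<and> g v = w"
    and "{v \<in> bm_carrier V. f v = vzero \<and> g v = vzero} = U"
  shows "bm_quot_isomorphic V U (dsum W1 W2)"
  unfolding bm_quot_isomorphic_def
proof (intro exI conjI)
  let ?h = "\<lambda>v. case_sum (f v) (g v)"
  show h: "bm_hom ?h V (dsum W1 W2)" by (rule bm_hom_pair[OF assms(1,2)])
  show "{v \<in> bm_carrier V. ?h v = vzero} = U" using assms(4) by (simp add: case_sum_eq_vzero)
  show "?h ` bm_carrier V = bm_carrier (dsum W1 W2)"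
  proof
    show "?h ` bm_carrier V \<subseteq> bm_carrier (dsum W1 W2)" using h by (auto simp: bm_hom_def)
    show "bm_carrier (dsum W1 W2) \<subseteq> ?h ` bm_carrier V"
    proof
      fix x assume "x \<in> bm_carrier (dsum W1 W2)"
      then obtain u w where uw: "u \<in> bm_carrier W1" "w \<in> bm_carrier W2" "x = case_sum u w"
        by (rule dsum_carrierE)
      then obtain v where "v \<in> bm_carrier V" "f v = u" "g v = w" using assms(3) by blast
      then show "x \<in> ?h ` bm_carrier V" using uw(3) by auto
    qed
  qed
qed

lemma bm_isomorphicI:
  assumes q: "bm_quot_isomorphic V {vzero} W" and V: "vsubspace (bm_carrier V)"
  shows "bm_isomorphic V W"
proof -
  obtain f where f: "bm_hom f V W" "f ` bm_carrier V = bm_carrier W" "{v \<in> bm_carrier V. f v = vzero} = {vzero}"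
    using q by (auto simp: bm_quot_isomorphic_def)
  have "inj_on f (bm_carrier V)"
  proof
    fix u v assume uv: "u \<in> bm_carrier V" "v \<in> bm_carrier V" "f u = f v"
    define w where "w = vadd u (vsmul (-1) v)"
    have "vsmul (-1) v \<in> bm_carrier V" using V uv by (auto simp: vsubspace_def)
    then have w: "w \<in> bm_carrier V" and "f w = vadd (f u) (vsmul (-1) (f v))"
      using V uv f(1) by (auto simp: w_def vsubspace_def bm_hom_def lin_on_def)
    then have "f w = vzero" using uv(3) by (simp add: vadd_def vsmul_def vzero_def)
    then have "w = vzero" using w f(3) by auto
    then show "u = v" by (auto simp: w_def vadd_def vsmul_def vzero_def fun_eq_iff)
  qed
  then show ?thesis using f by (auto simp: bm_isomorphic_def bm_iso_def bij_betw_def)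
qed

lemma Omod_hom:
  assumes "\<And>f i. f \<in> V \<Longrightarrow> d < i \<Longrightarrow> L f i = 0"
    and lin: "\<And>f g. f \<in> V \<Longrightarrow> g \<in> V \<Longrightarrow> L (vadd f g) = vadd (L f) (L g)" "\<And>f x. f \<in> V \<Longrightarrow> L (vsmul x f) = vsmul x (L f)"
    and LX: "\<And>f. f \<in> V \<Longrightarrow> L (X f) = O_X d a (L f)"
    and LY: "\<And>f. f \<in> V \<Longrightarrow> L (Y f) = O_Y d a b c (L f)"
    and closed: "\<And>f. f \<in> V \<Longrightarrow> X f \<in> V" "\<And>f. f \<in> V \<Longrightarrow> Y f \<in> V"
      "\<And>f g. f \<in> V \<Longrightarrow> g \<in> V \<Longrightarrow> vadd f g \<in> V" "\<And>f x. f \<in> V \<Longrightarrow> vsmul x f \<in> V"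
    and Z: "\<And>f. f \<in> V \<Longrightarrow> Z f = vadd (X (Y f)) (vadd (Y (X f)) (vsmul (- (2 * a * b - c * (of_nat d + 1))) f))"
  shows "bm_hom L \<lparr>bm_carrier = V, bm_X = X, bm_Y = Y, bm_Z = Z\<rparr> (Omod d a b c)"
  unfolding bm_hom_def lin_on_def Omod_def using assms by simp

section \<open>Reflected and direct chains\<close>

lemma O_theta_reflect:
  assumes "even d" "i \<le> d" shows "O_theta d (- a) (d - i) = - O_theta d a i"
proof -
  have "even (d - i) \<longleftrightarrow> even i" using assms by (simp add: even_diff_nat)
  then have "(-1) ^ (d - i) = ((-1) ^ i :: complex)" by (cases "even i") auto
  then show ?thesis using assms by (simp add: O_theta_def of_nat_diff field_simps)
qed

text \<open>With \<open>O_theta_reflect\<close> this says that for even \<open>d\<close> the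
  reversal of the index, combined with a sign change of \<open>a\<close>, \<open>b\<close> and of
  both operators, preserves the shape of \<open>Omod\<close>.\<close>

lemma O_phi_reflect:
  assumes "even d" "i \<le> d" shows "O_phi d (- a) (- b) c (d - i) = O_phi d a b c (Suc i)"
  using assms by (auto simp: O_phi_def of_nat_diff algebra_simps even_diff_nat)

text \<open>Lets \<open>X\<close> and \<open>Y\<close> exchange their roles in a chain together with
  \<open>a\<close> and \<open>b\<close>.\<close>

lemma O_phi_sym: "O_phi d a b c = O_phi d b a c"
  by (simp add: O_phi_def fun_eq_iff algebra_simps)

text \<open>The functionals dual to the basis of \<open>Omod\<close> are generated from the last one downwards by \<open>X\<close>. Replacing
  \<open>(X, Y, a, b)\<close> by \<open>(-X, -Y, -a, -b)\<close> turns this into a chain running upwards.\<close>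

locale reflected_chain = bi_chain_linear V "\<lambda>f. vsmul (-1) (X f)" "\<lambda>f. vsmul (-1) (Y f)" ep d "- a" "- b" c p p' p'' y q
  for V :: "('i \<Rightarrow> complex) set" and X Y ep d a b c p p' p'' y q +
  assumes X_V: "f \<in> V \<Longrightarrow> X f \<in> V" and Y_V: "f \<in> V \<Longrightarrow> Y f \<in> V"
begin

text \<open>Each step of the chain applies \<open>-X\<close>; the alternating sign turns the
  resulting entries -1 into the subdiagonal entries 1 of \<open>Omod\<close>.\<close>

definition L :: "('i \<Rightarrow> complex) \<Rightarrow> nat \<Rightarrow> complex" where
  "L f i = (if i \<le> d then (-1) ^ (d - i) * mu (d - i) f else 0)"

lemma mu_X: "f \<in> V \<Longrightarrow> j \<le> d \<Longrightarrow> mu j (X f) = - mu j (vsmul (-1) (X f))"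
  by (simp add: mu_smul X_V)
lemma mu_Y: "f \<in> V \<Longrightarrow> j \<le> d \<Longrightarrow> mu j (Y f) = - mu j (vsmul (-1) (Y f))"
  by (simp add: mu_smul Y_V)

lemma L_X: assumes "f \<in> V" shows "L (X f) = O_X d a (L f)"
proof
  fix i
  show "L (X f) i = O_X d a (L f) i"
  proof (cases "i \<le> d")
    case True
    have "mu (d - i) (X f) = O_theta d a i * mu (d - i) f - mu (Suc (d - i)) f"
      using mu_X[OF assms, of "d - i"] mu_P[of "d - i" f] O_theta_reflect[OF even_d True, of a]
      by (simp del: split_fun.simps)
    then have 1: "L (X f) i = (-1) ^ (d - i) * (O_theta d a i * mu (d - i) f - mu (Suc (d - i)) f)"
      using True by (simp only: L_def if_True)
    have 2: "L f i = (-1) ^ (d - i) * mu (d - i) f" using True by (simp only: L_def if_True)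
    show ?thesis
    proof (cases "i = 0")
      case True
      then show ?thesis using 1 2 mu_end[OF assms] by (simp add: O_X_def algebra_simps del: split_fun.simps)
    next
      case False
      then have "d - (i - 1) = Suc (d - i)" "i - 1 \<le> d" using \<open>i \<le> d\<close> by simp_all
      then have "L f (i - 1) = - ((-1) ^ (d - i) * mu (Suc (d - i)) f)"
        by (simp only: L_def if_True power_Suc) simp
      then show ?thesis using 1 2 False \<open>i \<le> d\<close> by (simp add: O_X_def algebra_simps del: split_fun.simps)
    qed
  qed (simp add: L_def O_X_def)
qed

lemma L_Y: assumes "f \<in> V" shows "L (Y f) = O_Y d a b c (L f)"
proof
  fix i
  show "L (Y f) i = O_Y d a b c (L f) i"
  proof (cases "i \<le> d")
    case True
    have "mu (d - i) (Y f) = O_theta d b i * mu (d - i) f - O_phi d a b c (Suc i) * mu (d - i - 1) f"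
      using mu_Y[OF assms, of "d - i"] mu_Q[of "d - i" f] assms O_theta_reflect[OF even_d True, of b]
        O_phi_reflect[OF even_d True, of a b c]
      by (simp del: split_fun.simps)
    then have 1: "L (Y f) i = (-1) ^ (d - i) * (O_theta d b i * mu (d - i) f - O_phi d a b c (Suc i) * mu (d - i - 1) f)"
      using True by (simp only: L_def if_True)
    have 2: "L f i = (-1) ^ (d - i) * mu (d - i) f" using True by (simp only: L_def if_True)
    show ?thesis
    proof (cases "i = d")
      case True
      then show ?thesis using 1 2 O_phi_end[OF even_d] by (simp add: O_Y_def algebra_simps del: split_fun.simps)
    next
      case False
      then have "d - i = Suc (d - Suc i)" "Suc i \<le> d" using \<open>i \<le> d\<close> by simp_all
      then have "L f (Suc i) = - ((-1) ^ (d - i) * mu (d - i - 1) f)"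
        by (simp only: L_def if_True power_Suc) simp
      then show ?thesis using 1 2 False \<open>i \<le> d\<close> by (simp add: O_Y_def algebra_simps del: split_fun.simps)
    qed
  qed (simp add: L_def O_Y_def)
qed

lemma L_add: "f \<in> V \<Longrightarrow> g \<in> V \<Longrightarrow> L (vadd f g) = vadd (L f) (L g)"
  using mu_add[of _ f g] by (intro ext) (simp add: L_def vadd_def[of "L f"] distrib_left)
lemma L_smul: "f \<in> V \<Longrightarrow> L (vsmul x f) = vsmul x (L f)"
  using mu_smul[of _ f x] by (intro ext) (simp add: L_def vsmul_def[of x "L f"])

lemma L_zero_iff: "f \<in> V \<Longrightarrow> L f = vzero \<longleftrightarrow> (\<forall>j\<le>d. ep j f = 0)"
proof -
  assume f: "f \<in> V"
  have "L f = vzero \<longleftrightarrow> (\<forall>j\<le>d. mu (d - j) f = 0)" by (auto simp: L_def vzero_def fun_eq_iff)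
  also have "\<dots> \<longleftrightarrow> (\<forall>j\<le>d. mu j f = 0)" by (metis diff_diff_cancel diff_le_self)
  finally show ?thesis using mu_zero_iff[OF f] by simp
qed

lemma L_prescribe:
  assumes "\<forall>i>d. u i = 0"
  shows "\<exists>g. \<forall>f\<in>V. (\<forall>j\<le>d. ep j f = g j) \<longrightarrow> L f = u"
proof -
  obtain g where g: "\<forall>f\<in>V. (\<forall>j\<le>d. ep j f = g j) \<longrightarrow> (\<forall>j\<le>d. mu j f = (-1) ^ j * u (d - j))"
    using mu_prescribe[of "\<lambda>j. (-1) ^ j * u (d - j)"] by (elim exE)
  show ?thesis
  proof (intro exI[of _ g] ballI impI ext)
    fix f i assume "f \<in> V" "\<forall>j\<le>d. ep j f = g j"
    then have m: "mu j f = (-1) ^ j * u (d - j)" if "j \<le> d" for j using g that by blast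
    show "L f i = u i"
      using m[of "d - i"] assms by (cases "i \<le> d") (simp_all add: L_def flip: power_mult_distrib mult.assoc)
  qed
qed

lemma L_surj: assumes "\<forall>i>d. u i = 0" shows "\<exists>f\<in>V. L f = u"
proof -
  obtain g where g: "\<forall>f\<in>V. (\<forall>j\<le>d. ep j f = g j) \<longrightarrow> L f = u"
    using L_prescribe[OF assms] by (elim exE)
  then show ?thesis using surj[of g] by auto
qed

end

text \<open>A submodule of \<open>Omod\<close> is pulled back along the surjection \<open>L\<close>
  to a submodule of \<open>V\<close> containing the kernel. If it is nonzero, the pullback is all of
  \<open>V\<close>.\<close>

lemma Omod_irreducibleI:
  fixes V :: "('i \<Rightarrow> complex) set"
  assumes lin: "\<And>f g. f \<in> V \<Longrightarrow> g \<in> V \<Longrightarrow> L (vadd f g) = vadd (L f) (L g)" "\<And>f x. f \<in> V \<Longrightarrow> L (vsmul x f) = vsmul x (L f)"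
    and LX: "\<And>f. f \<in> V \<Longrightarrow> L (X f) = O_X d a (L f)"
    and LY: "\<And>f. f \<in> V \<Longrightarrow> L (Y f) = O_Y d a b c (L f)"
    and closed: "\<And>f. f \<in> V \<Longrightarrow> X f \<in> V" "\<And>f. f \<in> V \<Longrightarrow> Y f \<in> V"
      "\<And>f g. f \<in> V \<Longrightarrow> g \<in> V \<Longrightarrow> vadd f g \<in> V" "\<And>f x. f \<in> V \<Longrightarrow> vsmul x f \<in> V"
    and Lsurj: "\<And>u. \<forall>i>d. u i = 0 \<Longrightarrow> \<exists>f\<in>V. L f = u"
    and tot: "\<And>U h. U \<subseteq> V \<Longrightarrow> (\<And>f g. f \<in> U \<Longrightarrow> g \<in> U \<Longrightarrow> vadd f g \<in> U) \<Longrightarrow> (\<And>f x. f \<in> U \<Longrightarrow> vsmul x f \<in> U)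
      \<Longrightarrow> (\<And>f. f \<in> U \<Longrightarrow> X f \<in> U) \<Longrightarrow> (\<And>f. f \<in> U \<Longrightarrow> Y f \<in> U)
      \<Longrightarrow> (\<And>f. f \<in> V \<Longrightarrow> L f = vzero \<Longrightarrow> f \<in> U) \<Longrightarrow> h \<in> U \<Longrightarrow> L h \<noteq> vzero \<Longrightarrow> V \<subseteq> U"
  shows "bm_irreducible (Omod d a b c)"
  unfolding bm_irreducible_def
proof (intro conjI allI impI)
  have "(\<lambda>i. if i = 0 then 1 else 0) \<in> bm_carrier (Omod d a b c)" by (simp add: Omod_def)
  moreover have "(\<lambda>i::nat. if i = 0 then 1 else 0) \<noteq> vzero" by (auto simp: vzero_def fun_eq_iff)
  ultimately show "bm_carrier (Omod d a b c) \<noteq> {vzero}" by blast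
next
  fix U
  assume U: "U \<subseteq> bm_carrier (Omod d a b c) \<and> vsubspace U \<and>
     (\<forall>u\<in>U. bm_X (Omod d a b c) u \<in> U \<and> bm_Y (Omod d a b c) u \<in> U \<and> bm_Z (Omod d a b c) u \<in> U)"
  have XU: "O_X d a u \<in> U" "O_Y d a b c u \<in> U" if "u \<in> U" for u
    using U that by (auto simp: Omod_def)
  show "U = {vzero} \<or> U = bm_carrier (Omod d a b c)"
  proof (rule disjCI)
    assume ne: "U \<noteq> bm_carrier (Omod d a b c)"
    define T where "T = {f \<in> V. L f \<in> U}"
    have "L h = vzero" if "h \<in> T" for h
    proof (rule ccontr)
      assume h: "L h \<noteq> vzero"
      have "V \<subseteq> T"
      proof (rule tot[OF _ _ _ _ _ _ that h])
        show "f \<in> T" if "f \<in> V" "L f = vzero" for f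
          using that U by (auto simp: T_def vsubspace_def)
      qed (use U XU closed lin LX LY in \<open>auto simp: T_def vsubspace_def\<close>)
      moreover have "\<exists>f\<in>V. L f = u" if "u \<in> bm_carrier (Omod d a b c)" for u
        using that Lsurj[of u] by (auto simp: Omod_def)
      ultimately have "bm_carrier (Omod d a b c) \<subseteq> U" by (fastforce simp: T_def)
      then show False using U ne by blast
    qed
    moreover have "\<exists>f\<in>T. L f = u" if "u \<in> U" for u
    proof -
      have "\<forall>i>d. u i = 0" using that U by (auto simp: Omod_def)
      then show ?thesis using Lsurj[of u] that by (auto simp: T_def)
    qed
    ultimately have "U \<subseteq> {vzero}" by fastforce
    then show "U = {vzero}" using U by (auto simp: vsubspace_def)
  qed
qed

context reflected_chain begin

lemma Omod_irreducible:
  fixes ga :: "nat \<Rightarrow> ('i \<Rightarrow> complex) \<Rightarrow> complex" and J :: nat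
  assumes phi: "\<And>i. 1 \<le> i \<Longrightarrow> i \<le> d \<Longrightarrow> O_phi d (- a) (- b) c i \<noteq> 0"
    and ga: "\<And>f. f \<in> V \<Longrightarrow> ga 0 f = ep 0 f"
      "\<And>j f. f \<in> V \<Longrightarrow> 1 \<le> j \<Longrightarrow> j \<le> J \<Longrightarrow> ga j (vsmul (-1) (Y f)) = y' j * ga j f + c' j * ga (j - 1) f"
      "\<And>j. 1 \<le> j \<Longrightarrow> j \<le> J \<Longrightarrow> c' j \<noteq> 0"
      "\<And>f. f \<in> V \<Longrightarrow> ga J (vsmul (-1) (X f)) = O_theta d (- a) 0 * ga J f"
      "\<And>f. f \<in> V \<Longrightarrow> (\<And>j. j \<le> d \<Longrightarrow> ep j f = 0) \<Longrightarrow> ga J f = 0"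
      "lin_fun (ga J)"
  shows "bm_irreducible (Omod d a b c)"
proof (rule Omod_irreducibleI[where V = V and L = L, OF L_add L_smul L_X L_Y X_V Y_V V_add V_smul L_surj])
  fix U h
  assume U: "U \<subseteq> V" "\<And>f g. f \<in> U \<Longrightarrow> g \<in> U \<Longrightarrow> vadd f g \<in> U" "\<And>f x. f \<in> U \<Longrightarrow> vsmul x f \<in> U"
    "\<And>f. f \<in> U \<Longrightarrow> X f \<in> U" "\<And>f. f \<in> U \<Longrightarrow> Y f \<in> U"
    and K: "\<And>f. f \<in> V \<Longrightarrow> L f = vzero \<Longrightarrow> f \<in> U" and h: "h \<in> U" "L h \<noteq> vzero"
  have "h \<in> V" using h U by auto
  then obtain i where i: "i \<le> d" "mu i h \<noteq> 0"
    using h(2) L_zero_iff mu_zero_iff by meson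
  show "V \<subseteq> U"
  proof (rule submodule_total[OF phi ga _ _ _ _ _ _ h(1) i])
    fix f assume "f \<in> V" "\<And>j. j \<le> d \<Longrightarrow> mu j f = 0"
    then show "f \<in> U" using K[of f] L_zero_iff[of f] mu_zero_iff[of f] by meson
  qed (use U in auto)
qed

end

text \<open>Here the dual functionals are generated from the first one upwards by \<open>Y\<close>, up to the scalars \<open>w i\<close>.\<close>

locale direct_chain = bi_chain_linear V Y X ep d b a c p p' p'' y q
  for V :: "('i \<Rightarrow> complex) set" and X Y ep d a b c p p' p'' y q +
  assumes phi_nz: "\<And>i. 1 \<le> i \<Longrightarrow> i \<le> d \<Longrightarrow> O_phi d a b c i \<noteq> 0"
begin

text \<open>In the \<open>mu\<close> coordinates the off-diagonal ones belong to \<open>Y\<close>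
  and the \<open>O_phi\<close> entries to \<open>X\<close>; in \<open>Omod\<close> it is the other
  way round. Division by \<open>w i\<close> exchanges them.\<close>

definition w :: "nat \<Rightarrow> complex" where "w i = (\<Prod>k\<in>{1..i}. O_phi d a b c k)"

lemma w_Suc: "w (Suc i) = w i * O_phi d a b c (Suc i)" by (simp add: w_def)
lemma w_nz: "i \<le> d \<Longrightarrow> w i \<noteq> 0" using phi_nz by (auto simp: w_def)

definition L :: "('i \<Rightarrow> complex) \<Rightarrow> nat \<Rightarrow> complex" where
  "L f i = (if i \<le> d then mu i f / w i else 0)"

lemma L_X: assumes "f \<in> V" shows "L (X f) = O_X d a (L f)"
proof
  fix i
  show "L (X f) i = O_X d a (L f) i"
  proof (cases "i \<le> d")
    case True
    have 1: "mu i (X f) = O_theta d a i * mu i f + O_phi d a b c i * mu (i - 1) f"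
      using mu_Q[of i f] True assms O_phi_sym[of d a b c] by (simp del: split_fun.simps)
    show ?thesis
    proof (cases i)
      case 0
      then show ?thesis using 1 by (simp add: L_def O_X_def)
    next
      case (Suc m)
      then have "w m \<noteq> 0" "O_phi d a b c (Suc m) \<noteq> 0" using w_nz[of m] phi_nz[of "Suc m"] True by auto
      then show ?thesis using 1 Suc True by (simp add: L_def O_X_def w_Suc field_simps del: split_fun.simps)
    qed
  qed (simp add: L_def O_X_def)
qed

lemma L_Y: assumes "f \<in> V" shows "L (Y f) = O_Y d a b c (L f)"
proof
  fix i
  show "L (Y f) i = O_Y d a b c (L f) i"
  proof (cases "i \<le> d")
    case True
    have 1: "mu i (Y f) = O_theta d b i * mu i f + mu (Suc i) f" by simp
    show ?thesis
    proof (cases "i = d")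
      case True
      then show ?thesis using 1 mu_end[OF assms] by (simp add: L_def O_Y_def del: split_fun.simps)
    next
      case False
      then have "w i \<noteq> 0" "O_phi d a b c (Suc i) \<noteq> 0" using w_nz[of i] phi_nz[of "Suc i"] True by auto
      then show ?thesis using 1 False True by (simp add: L_def O_Y_def w_Suc field_simps del: split_fun.simps)
    qed
  qed (simp add: L_def O_Y_def)
qed

lemma L_add: "f \<in> V \<Longrightarrow> g \<in> V \<Longrightarrow> L (vadd f g) = vadd (L f) (L g)"
  using mu_add[of _ f g] by (intro ext) (simp add: L_def vadd_def[of "L f"] add_divide_distrib)
lemma L_smul: "f \<in> V \<Longrightarrow> L (vsmul x f) = vsmul x (L f)"
  using mu_smul[of _ f x] by (intro ext) (simp add: L_def vsmul_def[of x "L f"])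

lemma L_zero_iff: assumes "f \<in> V" shows "L f = vzero \<longleftrightarrow> (\<forall>j\<le>d. ep j f = 0)"
proof -
  have "L f = vzero \<longleftrightarrow> (\<forall>j\<le>d. mu j f = 0)"
    using w_nz by (auto simp: L_def vzero_def fun_eq_iff)
  then show ?thesis using mu_zero_iff[OF assms] by simp
qed

lemma L_prescribe:
  assumes "\<forall>i>d. u i = 0"
  shows "\<exists>g. \<forall>f\<in>V. (\<forall>j\<le>d. ep j f = g j) \<longrightarrow> L f = u"
proof -
  obtain g where g: "\<forall>f\<in>V. (\<forall>j\<le>d. ep j f = g j) \<longrightarrow> (\<forall>j\<le>d. mu j f = w j * u j)"
    using mu_prescribe[of "\<lambda>j. w j * u j"] by (elim exE)
  show ?thesis
  proof (intro exI[of _ g] ballI impI ext)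
    fix f i assume "f \<in> V" "\<forall>j\<le>d. ep j f = g j"
    then have m: "mu j f = w j * u j" if "j \<le> d" for j using g that by blast
    show "L f i = u i"
      using m[of i] assms w_nz[of i] by (cases "i \<le> d") (simp_all add: L_def)
  qed
qed

lemma L_surj: assumes "\<forall>i>d. u i = 0" shows "\<exists>f\<in>V. L f = u"
proof -
  obtain g where g: "\<forall>f\<in>V. (\<forall>j\<le>d. ep j f = g j) \<longrightarrow> L f = u"
    using L_prescribe[OF assms] by (elim exE)
  then show ?thesis using surj[of g] by auto
qed

lemma Omod_irreducible:
  fixes ga :: "nat \<Rightarrow> ('i \<Rightarrow> complex) \<Rightarrow> complex" and J :: nat
  assumes ga: "\<And>f. f \<in> V \<Longrightarrow> ga 0 f = ep 0 f"
      "\<And>j f. f \<in> V \<Longrightarrow> 1 \<le> j \<Longrightarrow> j \<le> J \<Longrightarrow> ga j (X f) = y' j * ga j f + c' j * ga (j - 1) f"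
      "\<And>j. 1 \<le> j \<Longrightarrow> j \<le> J \<Longrightarrow> c' j \<noteq> 0"
      "\<And>f. f \<in> V \<Longrightarrow> ga J (Y f) = O_theta d b 0 * ga J f"
      "\<And>f. f \<in> V \<Longrightarrow> (\<And>j. j \<le> d \<Longrightarrow> ep j f = 0) \<Longrightarrow> ga J f = 0"
      "lin_fun (ga J)"
  shows "bm_irreducible (Omod d a b c)"
proof (rule Omod_irreducibleI[where V = V and L = L, OF L_add L_smul L_X L_Y Q_V P_V V_add V_smul L_surj])
  fix U h
  assume U: "U \<subseteq> V" "\<And>f g. f \<in> U \<Longrightarrow> g \<in> U \<Longrightarrow> vadd f g \<in> U" "\<And>f x. f \<in> U \<Longrightarrow> vsmul x f \<in> U"
    "\<And>f. f \<in> U \<Longrightarrow> X f \<in> U" "\<And>f. f \<in> U \<Longrightarrow> Y f \<in> U"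
    and K: "\<And>f. f \<in> V \<Longrightarrow> L f = vzero \<Longrightarrow> f \<in> U" and h: "h \<in> U" "L h \<noteq> vzero"
  have "h \<in> V" using h U by auto
  then obtain i where i: "i \<le> d" "mu i h \<noteq> 0"
    using h(2) L_zero_iff mu_zero_iff by meson
  show "V \<subseteq> U"
  proof (rule submodule_total[OF _ ga _ _ _ _ _ _ h(1) i])
    show "O_phi d b a c i \<noteq> 0" if "1 \<le> i" "i \<le> d" for i
      using phi_nz[OF that] O_phi_sym[of d a b c] by simp
    fix f assume "f \<in> V" "\<And>j. j \<le> d \<Longrightarrow> mu j f = 0"
    then show "f \<in> U" using K[of f] L_zero_iff[of f] mu_zero_iff[of f] by meson
  qed (use U in auto)
qed

end

section \<open>The four families of coefficient functionals\<close>

lemma sg_diff: "sg (a - b) = sg a * sg b" by (simp add: sg_def)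
lemma lin_fun_cf: "lin_fun (\<lambda>f. cf f s a b c)"
  by (simp add: lin_fun_def cf_vadd cf_vsmul)

lemma Mn_vadd: "f \<in> Mn k1 k2 k3 n \<Longrightarrow> g \<in> Mn k1 k2 k3 n \<Longrightarrow> vadd f g \<in> Mn k1 k2 k3 n"
  by (auto simp: Mn_iff cf_vadd D_cf_def algebra_simps)
lemma Mn_vsmul: "f \<in> Mn k1 k2 k3 n \<Longrightarrow> vsmul x f \<in> Mn k1 k2 k3 n"
proof -
  assume f: "f \<in> Mn k1 k2 k3 n"
  have "D_cf k1 k2 k3 (cf (vsmul x f)) s a b c = x * D_cf k1 k2 k3 (cf f) s a b c" for s a b c
    by (simp add: D_cf_def cf_vsmul algebra_simps)
  then show ?thesis using f by (simp add: Mn_iff cf_vsmul)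
qed

context odd_params begin

lemma V1_add: "f \<in> V1 \<Longrightarrow> g \<in> V1 \<Longrightarrow> vadd f g \<in> V1" and V1_smul: "f \<in> V1 \<Longrightarrow> vsmul x f \<in> V1"
  by (auto simp: V1_iff cf_vadd cf_vsmul Mn_vadd Mn_vsmul)
lemma V2_add: "f \<in> V2 \<Longrightarrow> g \<in> V2 \<Longrightarrow> vadd f g \<in> V2" and V2_smul: "f \<in> V2 \<Longrightarrow> vsmul x f \<in> V2"
  by (auto simp: V2_iff cf_vadd cf_vsmul Mn_vadd Mn_vsmul)
lemma V3_add: "f \<in> V3 \<Longrightarrow> g \<in> V3 \<Longrightarrow> vadd f g \<in> V3" and V3_smul: "f \<in> V3 \<Longrightarrow> vsmul x f \<in> V3"
  by (auto simp: V3_iff cf_vadd cf_vsmul Mn_vadd Mn_vsmul)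

lemma sg_nt[simp]: "sg (int n) = -1" "sg (int t1) = -1" "sg (int t2) = -1" "sg (int t3) = -1"
  using odd_n odd_t by (auto simp: sg_def)
lemma t_pos: "1 \<le> t1" "1 \<le> t2" "1 \<le> t3"
  using odd_t by (auto simp: odd_pos Suc_leI)

abbreviation K where "K \<equiv> k1 + k2 + k3"

text \<open>Passing to \<open>-X\<close> and \<open>-Y\<close> leaves \<open>Z\<close> unchanged,
  hence also the scalar of \<open>{X,Y} - Z\<close>, and negates the scalar of
  \<open>{X,Z} - Y\<close>; so does the sign change of \<open>a\<close> and
  \<open>b\<close>.\<close>

lemma rel_neg:
  fixes a b c :: complex
  assumes "2 * a * b - c * (of_nat d + 1) = 2 * k1 * k2 - 2 * k3 * (k1 + k2 + k3 + n + 1)"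
    and "2 * a * c - b * (of_nat d + 1) = 2 * k1 * k3 - 2 * k2 * (k1 + k2 + k3 + n + 1)"
    and f: "f \<in> V"
  defines "P \<equiv> \<lambda>f. vsmul (-1) (BX k1 k2 k3 f)" and "Q \<equiv> \<lambda>f. vsmul (-1) (BY k1 k2 k3 f)"
  shows "cf (P (P (Q f))) s x y z + 2 * cf (P (Q (P f))) s x y z + cf (Q (P (P f))) s x y z
        = 2 * (2 * (- a) * (- b) - c * (of_nat d + 1)) * cf (P f) s x y z + cf (Q f) s x y z
          + (2 * (- a) * c - (- b) * (of_nat d + 1)) * cf f s x y z"
proof -
  have 1: "2 * (- a) * (- b) - c * (of_nat d + 1) = 2 * k1 * k2 - 2 * k3 * (k1 + k2 + k3 + n + 1)"
    "2 * (- a) * c - (- b) * (of_nat d + 1) = - (2 * k1 * k3 - 2 * k2 * (k1 + k2 + k3 + n + 1))"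
    using assms(1,2) by (simp_all add: algebra_simps)
  show ?thesis unfolding 1 P_def Q_def
    using arg_cong[OF Mn_XXY[OF odd_n f, of s x y z], of uminus]
    by (simp add: BX_vsmul BY_vsmul cf_vsmul algebra_simps)
qed

text \<open>The side condition disposes of the only term of \<open>Mn_X_triangular\<close> that
  leaves the layer \<open>c = t3\<close>.\<close>

lemma X_plane3:
  assumes "f \<in> V" "dki k1 (a + 1) = 0 \<or> cf f (\<not> s) (a + 1) b (int t3 - 1) = 0"
  shows "cf (BX k1 k2 k3 f) s a b (int t3) = - sg b * ((of_real (of_int b + t3 + k2 + k3 + 1/2)) * cf f s a b (int t3)
    - \<i> * sp s * dki k1 (a + 1) * cf f s (a + 1) (b - 1) (int t3))"
  using assms by (auto simp: Mn_X_triangular sg_add algebra_simps)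

lemma Y_plane3:
  assumes "f \<in> V" "dki k2 (b + 1) = 0 \<or> cf f (\<not> s) a (b + 1) (int t3 - 1) = 0"
  shows "cf (BY k1 k2 k3 f) s a b (int t3) = - sg a * ((of_real (of_int a + t3 + k1 + k3 + 1/2)) * cf f s a b (int t3)
    + \<i> * sp s * dki k2 (b + 1) * cf f s (a - 1) (b + 1) (int t3))"
  using assms by (auto simp: Mn_Y_triangular sg_add algebra_simps)

definition epA :: "bool \<Rightarrow> nat \<Rightarrow> cpol \<Rightarrow> complex" where
  "epA s j f = cf f s (int j) (int n - int t3 - int j) (int t3)"

abbreviation "negX \<equiv> \<lambda>f. vsmul (-1) (BX k1 k2 k3 f)"
abbreviation "negY \<equiv> \<lambda>f. vsmul (-1) (BY k1 k2 k3 f)"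

lemma epA_X:
  assumes "f \<in> V" "j < t1"
  shows "epA s j (negX f) = - \<i> * sp s * sg (int j) * dki k1 (int j + 1) * epA s (Suc j) f
     + sg (int j) * (of_real (real n - real j + k2 + k3 + 1/2)) * epA s j f"
proof -
  have e: "epA s (Suc j) f = cf f s (int j + 1) (int n - int t3 - int j - 1) (int t3)"
    by (simp add: epA_def algebra_simps)
  have X: "cf (BX k1 k2 k3 f) s (int j) (int n - int t3 - int j) (int t3)
    = - sg (int n - int t3 - int j) * (of_real (of_int (int n - int t3 - int j) + t3 + k2 + k3 + 1/2) * cf f s (int j) (int n - int t3 - int j) (int t3)
    - \<i> * sp s * dki k1 (int j + 1) * cf f s (int j + 1) (int n - int t3 - int j - 1) (int t3))"
    using dki_border(1)[of "int j"] assms V_vanish13[OF assms(1), of "int j + 1" "int t3 - 1"]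
    by (intro X_plane3) auto
  show ?thesis unfolding e epA_def[of s j] cf_vsmul X
    by (simp add: sg_diff sg_add algebra_simps)
qed

lemma epA_Y:
  assumes "f \<in> V" "j < t1"
  shows "epA s j (negY f) = sg (int j) * (of_real (real j + t3 + k1 + k3 + 1/2)) * epA s j f
     + (if j = 0 then 0 else \<i> * sp s * sg (int j) * dki k2 (int n - int t3 - int j + 1)) * epA s (j - 1) f"
proof -
  have e: "epA s (j - 1) f = cf f s (int j - 1) (int n - int t3 - int j + 1) (int t3)" if "j \<noteq> 0"
    using that by (simp add: epA_def of_nat_diff algebra_simps)
  have Y: "cf (BY k1 k2 k3 f) s (int j) (int n - int t3 - int j) (int t3)
    = - sg (int j) * (of_real (of_int (int j) + t3 + k1 + k3 + 1/2) * cf f s (int j) (int n - int t3 - int j) (int t3)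
    + \<i> * sp s * dki k2 (int n - int t3 - int j + 1) * cf f s (int j - 1) (int n - int t3 - int j + 1) (int t3))"
    using assms V_vanish13[OF assms(1)] by (intro Y_plane3) auto
  show ?thesis unfolding epA_def[of s j] cf_vsmul Y using e
    by (cases "j = 0") (simp_all add: algebra_simps)
qed

lemma epA_surj:
  "\<exists>f\<in>V2 \<inter> V3. \<forall>s. \<forall>j\<le>t1 - 1. epA s j f = g s j"
proof -
  define L where "L s a b = (if 0 \<le> a \<and> a < int t1 \<and> a + b = int n - int t3 then g s (nat a) else 0)" for s a b
  have "\<exists>f\<in>V3. (\<forall>s a b. cf f s a b (int t3) = L s a b)
    \<and> ((\<forall>s a b. a < int t1 \<longrightarrow> L s a b = 0) \<longrightarrow> f \<in> V1)
    \<and> ((\<forall>s a b. b < int t2 \<longrightarrow> L s a b = 0) \<longrightarrow> f \<in> V2)"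
    by (rule ck3_exists) (use t_le in \<open>auto simp: L_def\<close>)
  then obtain f where f: "f \<in> V3" "\<And>s a b. cf f s a b (int t3) = L s a b"
    "(\<forall>s a b. b < int t2 \<longrightarrow> L s a b = 0) \<longrightarrow> f \<in> V2" by blast
  \<comment> \<open>On the support \<open>a < t1\<close>, hence \<open>b > t2\<close> by the bound
    on \<open>n\<close>; the lift is thus divisible by the power of \<open>x2\<close> as
    well.\<close>
  have "f \<in> V2" by (rule f(3)[rule_format]) (use t_le in \<open>auto simp: L_def\<close>)
  moreover have "epA s j f = g s j" if "j \<le> t1 - 1" for s j
  proof -
    have "j < t1" using that t_pos by linarith
    then show ?thesis by (simp add: epA_def f(2) L_def)
  qed
  ultimately show ?thesis using f(1) by blast
qed

text \<open>\<open>X\<close> raises the exponent of \<open>x1\<close>, and the zero of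
  \<open>dki k1\<close> at \<open>t1\<close> stops the chain after \<open>t1\<close> functionals,
  the dimension of \<open>A\<close>. Downwards, \<open>Y\<close> stops at exponent 0.\<close>

lemma chain_A:
  "reflected_chain V (BX k1 k2 k3) (BY k1 k2 k3) (epA s) (t1 - 1) (of_real (- K - real n - 1)) (of_real k3) (of_real k2)
   (\<lambda>j. - \<i> * sp s * sg (int j) * dki k1 (int j + 1)) (\<lambda>j. sg (int j) * of_real (real n - real j + k2 + k3 + 1/2))
   (\<lambda>j. 0) (\<lambda>j. sg (int j) * of_real (real j + t3 + k1 + k3 + 1/2))
   (\<lambda>j. if j = 0 then 0 else \<i> * sp s * sg (int j) * dki k2 (int n - int t3 - int j + 1))"
proof (unfold_locales, goal_cases)
  case 1 then show ?case using odd_t by simp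
next
  case (4 f j) then show ?case using epA_X[of f j] t_pos by simp
next
  case (5 f j) then show ?case using epA_Y[of f j] t_pos by simp
next
  case 6 then show ?case using t_pos by (simp add: dki_zero_iff)
next
  case (7 j) then show ?case using dki_zero_iff(1)[of "int j + 1"] by (auto simp: sg_def simp del: dki_int_Suc)
next
  case (10 f j) show ?case unfolding epA_def
    by (rule rel_neg[OF _ _ 10(1)]) (use t_pos in \<open>simp_all add: k_eq of_nat_diff field_simps\<close>)
next
  case 11 then show ?case using t_pos by (simp add: O_theta_def k_eq of_nat_diff field_simps)
next
  case 12 then show ?case using t_pos by (simp add: O_theta_def k_eq of_nat_diff field_simps sg_def)
next
  case 13 then show ?case
    using t_pos odd_t odd_n by (simp add: O_theta_def O_phi_def k_eq of_nat_diff field_simps sg_def dki_def)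
next
  case (14 j)
  have t1: "Suc (t1 - 1) = t1" using t_pos by simp
  have "real j + 1 \<le> real t1" using 14 t_pos by linarith
  \<comment> \<open>Equality would force \<open>j = t1\<close> for odd \<open>j\<close> and
    \<open>j = - t3 - 1\<close> for even \<open>j\<close>.\<close>
  then show ?case unfolding t1 using odd_t t_pos
    by (cases "even j") (auto simp: O_theta_def k_eq of_nat_diff sg_def complex_eq_iff field_simps)
next
  case (15 g)
  obtain f where "f \<in> V2 \<inter> V3" "\<forall>s. \<forall>j\<le>t1 - 1. epA s j f = g j" using epA_surj[of "\<lambda>_. g"] by auto
  then show ?case by (intro bexI[of _ f]) (auto simp: V2_iff)
qed (simp_all add: BX_Mn BY_Mn Mn_vadd Mn_vsmul epA_def[abs_def] lin_fun_cf)

text \<open>The index runs against the exponent of \<open>x2\<close>, since \<open>X\<close> raises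
  \<open>x1\<close> and lowers \<open>x2\<close> in this layer. At \<open>j = 0\<close> the coupling
  of \<open>Y\<close> is cut by \<open>dki k2 (int t2) = 0\<close>.\<close>

definition epB :: "bool \<Rightarrow> nat \<Rightarrow> cpol \<Rightarrow> complex" where
  "epB s j f = cf f s (int n + 1 - int t2 - int t3 + int j) (int t2 - 1 - int j) (int t3)"

lemma epB_X:
  assumes "f \<in> V" "j < t2"
  shows "epB s j (negX f) = (if j = t2 - 1 then 0 else - \<i> * sp s * sg (int j) * dki k1 (int n + 2 - int t2 - int t3 + int j)) * epB s (Suc j) f
     + sg (int j) * of_real (real t2 - 1 - real j + t3 + k2 + k3 + 1/2) * epB s j f"
proof -
  have e: "epB s (Suc j) f = cf f s (int n + 1 - int t2 - int t3 + int j + 1) (int t2 - 1 - int j - 1) (int t3)"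
    by (simp add: epB_def algebra_simps)
  have z: "epB s (Suc j) f = 0" if "j = t2 - 1" unfolding e using that t_pos by simp
  have X: "cf (BX k1 k2 k3 f) s (int n + 1 - int t2 - int t3 + int j) (int t2 - 1 - int j) (int t3)
    = - sg (int t2 - 1 - int j) * (of_real (of_int (int t2 - 1 - int j) + t3 + k2 + k3 + 1/2) * cf f s (int n + 1 - int t2 - int t3 + int j) (int t2 - 1 - int j) (int t3)
    - \<i> * sp s * dki k1 (int n + 1 - int t2 - int t3 + int j + 1) * cf f s (int n + 1 - int t2 - int t3 + int j + 1) (int t2 - 1 - int j - 1) (int t3))"
    using assms V_vanish23[OF assms(1)] by (intro X_plane3) auto
  have d: "int n + 1 - int t2 - int t3 + int j + 1 = int n + 2 - int t2 - int t3 + int j" by simp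
  show ?thesis using z unfolding e epB_def[of s j] cf_vsmul X d
    by (simp add: sg_diff sg_add algebra_simps)
qed

lemma epB_Y:
  assumes "f \<in> V" "j < t2"
  shows "epB s j (negY f) = sg (int j) * of_real (real n + 1 - real t2 + real j + k1 + k3 + 1/2) * epB s j f
     + \<i> * sp s * sg (int j) * dki k2 (int t2 - int j) * epB s (j - 1) f"
proof -
  have e: "epB s (j - 1) f = cf f s (int n + 1 - int t2 - int t3 + int j - 1) (int t2 - 1 - int j + 1) (int t3)" if "j \<noteq> 0"
    using that by (simp add: epB_def of_nat_diff algebra_simps)
  have Y: "cf (BY k1 k2 k3 f) s (int n + 1 - int t2 - int t3 + int j) (int t2 - 1 - int j) (int t3)
    = - sg (int n + 1 - int t2 - int t3 + int j) * (of_real (of_int (int n + 1 - int t2 - int t3 + int j) + t3 + k1 + k3 + 1/2) * cf f s (int n + 1 - int t2 - int t3 + int j) (int t2 - 1 - int j) (int t3)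
    + \<i> * sp s * dki k2 (int t2 - 1 - int j + 1) * cf f s (int n + 1 - int t2 - int t3 + int j - 1) (int t2 - 1 - int j + 1) (int t3))"
    using dki_border(2)[of "int t2 - 1 - int j"] assms V_vanish23[OF assms(1), of "int t2 - 1 - int j + 1" "int t3 - 1"]
    by (intro Y_plane3) auto
  have d: "int t2 - 1 - int j + 1 = int t2 - int j" by simp
  have z: "dki k2 (int t2 - int j) = 0" if "j = 0" using that by (simp add: dki_zero_iff)
  show ?thesis unfolding epB_def[of s j] cf_vsmul Y using e z
    by (cases "j = 0") (simp_all add: d sg_diff sg_add algebra_simps)
qed

lemma epB_surj:
  "\<exists>f\<in>V1 \<inter> V3. \<forall>s. \<forall>j\<le>t2 - 1. epB s j f = g s j"
proof -
  define L where "L s a b = (if 0 \<le> b \<and> b < int t2 \<and> a + b = int n - int t3 then g s (nat (int t2 - 1 - b)) else 0)" for s a b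
  have "\<exists>f\<in>V3. (\<forall>s a b. cf f s a b (int t3) = L s a b)
    \<and> ((\<forall>s a b. a < int t1 \<longrightarrow> L s a b = 0) \<longrightarrow> f \<in> V1)
    \<and> ((\<forall>s a b. b < int t2 \<longrightarrow> L s a b = 0) \<longrightarrow> f \<in> V2)"
    by (rule ck3_exists) (use t_le in \<open>auto simp: L_def\<close>)
  then obtain f where f: "f \<in> V3" "\<And>s a b. cf f s a b (int t3) = L s a b"
    "(\<forall>s a b. a < int t1 \<longrightarrow> L s a b = 0) \<longrightarrow> f \<in> V1" by blast
  have "f \<in> V1" by (rule f(3)[rule_format]) (use t_le in \<open>auto simp: L_def\<close>)
  moreover have "epB s j f = g s j" if "j \<le> t2 - 1" for s j
  proof -
    have "j < t2" using that t_pos by linarith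
    then show ?thesis by (simp add: epB_def f(2) L_def)
  qed
  ultimately show ?thesis using f(1) by blast
qed

lemma chain_B:
  "reflected_chain V (BX k1 k2 k3) (BY k1 k2 k3) (epB s) (t2 - 1) (of_real k3) (of_real (- K - real n - 1)) (of_real k1)
   (\<lambda>j. if j = t2 - 1 then 0 else - \<i> * sp s * sg (int j) * dki k1 (int n + 2 - int t2 - int t3 + int j))
   (\<lambda>j. sg (int j) * of_real (real t2 - 1 - real j + t3 + k2 + k3 + 1/2))
   (\<lambda>j. 0) (\<lambda>j. sg (int j) * of_real (real n + 1 - real t2 + real j + k1 + k3 + 1/2))
   (\<lambda>j. \<i> * sp s * sg (int j) * dki k2 (int t2 - int j))"
proof (unfold_locales, goal_cases)
  case 1 then show ?case using odd_t by simp
next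
  case (4 f j) then show ?case using epB_X[of f j] t_pos by simp
next
  case (5 f j) then show ?case using epB_Y[of f j] t_pos by simp
next
  case (7 j) then show ?case using dki_zero_iff(1)[of "int n + 2 - int t2 - int t3 + int j"] t_le by (auto simp: sg_def simp del: dki_int_Suc)
next
  case 8 show ?case by (simp add: dki_zero_iff)
next
  case (10 f j) show ?case unfolding epB_def
    by (rule rel_neg[OF _ _ 10(1)]) (use t_pos in \<open>simp_all add: k_eq of_nat_diff field_simps\<close>)
next
  case 11 then show ?case using t_pos by (simp add: O_theta_def k_eq of_nat_diff field_simps)
next
  case 12 then show ?case using t_pos by (simp add: O_theta_def k_eq of_nat_diff field_simps sg_def)
next
  case 13
  show ?case
  proof (cases "t2 = 1")
    case True
    then show ?thesis by (simp add: O_theta_def O_phi_def k_eq field_simps)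
  next
    case False
    then show ?thesis
      using t_pos odd_t odd_n by (simp add: O_theta_def O_phi_def k_eq of_nat_diff field_simps sg_def dki_def)
  qed
next
  case (14 j)
  have t2: "Suc (t2 - 1) = t2" using t_pos by simp
  have "real j + 1 \<le> real t2" "real t1 + real t2 + real t3 \<le> real n" using 14 t_pos t_le by linarith+
  \<comment> \<open>Odd \<open>j\<close> would have to be \<open>t2\<close>, and even
    \<open>j\<close> would have to be \<open>t1 + t2 + t3 - 2 n - 3\<close>, which is
    negative.\<close>
  then show ?case unfolding t2 using odd_t t_pos
    by (cases "even j") (auto simp: O_theta_def k_eq of_nat_diff sg_def complex_eq_iff field_simps)
next
  case (15 g)
  obtain f where "f \<in> V1 \<inter> V3" "\<forall>s. \<forall>j\<le>t2 - 1. epB s j f = g j" using epB_surj[of "\<lambda>_. g"] by auto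
  then show ?case by (intro bexI[of _ f]) (auto simp: V1_iff)
qed (simp_all add: BX_Mn BY_Mn Mn_vadd Mn_vsmul epB_def[abs_def] lin_fun_cf)

end

lemma O_phi_nonzero:
  fixes a b c :: real
  assumes "1 \<le> i" "i \<le> d"
    and "even i \<Longrightarrow> real d + 1 - 2 * real i - 2 * a - 2 * b - 2 * c \<noteq> 0"
    and "odd i \<Longrightarrow> real d + 1 - 2 * real i - 2 * a - 2 * b + 2 * c \<noteq> 0"
  shows "O_phi d (of_real a) (of_real b) (of_real c) i \<noteq> 0"
proof -
  have "O_phi d (of_real a) (of_real b) (of_real c) i =
    of_real (if even i then real i * (real d + 1 - 2 * real i - 2 * a - 2 * b - 2 * c) / 2
      else (real i - real d - 1) * (real d + 1 - 2 * real i - 2 * a - 2 * b + 2 * c) / 2)"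
    by (simp add: O_phi_def)
  moreover have "real i - real d - 1 \<noteq> 0" "real i \<noteq> 0" using assms(1,2) by auto
  ultimately show ?thesis using assms(3,4) by (simp only: of_real_eq_0_iff) simp
qed

context odd_params begin

text \<open>The spin index alternates along the layer \<open>a = t1\<close> because \<open>\<sigma>\<^sub>1\<close> and \<open>\<sigma>\<^sub>3 \<sigma>\<^sub>2\<close> are off-diagonal.\<close>

definition epC :: "bool \<Rightarrow> nat \<Rightarrow> cpol \<Rightarrow> complex" where
  "epC s j f = cf f (s \<noteq> odd j) (int t1) (int n - int t1 - int j) (int j)"

text \<open>\<open>X\<close> is used in its original form, which does not change the exponent of
  \<open>x1\<close>. The triangular form would leave the layer \<open>a = t1\<close>; the price is a
  tridiagonal matrix.\<close>

lemma epC_X: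
  "epC s j (negX f) = \<i> * dki k3 (int j + 1) * epC s (Suc j) f
     + (- of_real (1/2) - of_real (k2 + k3) * sg (int j)) * epC s j f
     + (if j = 0 then 0 else - \<i> * dki k2 (int n - int t1 - int j + 1)) * epC s (j - 1) f"
proof -
  have e: "epC s (Suc j) f = cf f (\<not> (s \<noteq> odd j)) (int t1) (int n - int t1 - int j - 1) (int j + 1)"
    by (simp add: epC_def algebra_simps)
  have e': "epC s (j - 1) f = cf f (\<not> (s \<noteq> odd j)) (int t1) (int n - int t1 - int j + 1) (int j - 1)" if "j \<noteq> 0"
    using that by (simp add: epC_def of_nat_diff algebra_simps)
  show ?thesis unfolding e epC_def[of s j] cf_vsmul cf_BX X_cf_def
    by (insert e', cases "j = 0"; rule sg_cases[of "int j"]; simp add: sg_diff sg_add algebra_simps del: cf_int dki_int_Suc)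
qed

text \<open>The term of the triangular form that leaves the layer sits at \<open>a = t1 - 1\<close>,
  \<open>c = j < t3\<close>, where \<open>V_vanish13\<close> applies.\<close>

lemma epC_Y:
  assumes "f \<in> V" "j < t3"
  shows "epC s j (negY f) = sg (int j) * of_real (real t1 + real j + k1 + k3 + 1/2) * epC s j f
     + (if j = 0 then 0 else - \<i> * sg (int j) * dki k2 (int n - int t1 - int j + 1)) * epC s (j - 1) f"
proof -
  have e': "epC s (j - 1) f = cf f (\<not> (s \<noteq> odd j)) (int t1) (int n - int t1 - int j + 1) (int j - 1)" if "j \<noteq> 0"
    using that by (simp add: epC_def of_nat_diff algebra_simps)
  show ?thesis using e' V_vanish13[OF assms(1), of "int t1 - 1" "int j"] assms(2)
    unfolding epC_def[of s j] cf_vsmul Mn_Y_triangular[OF assms(1)]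
    by (cases "j = 0") (simp_all add: sg_diff sg_add algebra_simps del: cf_int dki_int_Suc)
qed

lemma epC_surj:
  "\<exists>f\<in>V1 \<inter> V2. \<forall>s. \<forall>j\<le>t3 - 1. epC s j f = g s j"
proof -
  define L where "L s b c = (if 0 \<le> c \<and> c < int t3 \<and> b + c = int n - int t1 then g (s \<noteq> odd c) (nat c) else 0)" for s b c
  have "\<exists>f\<in>V1 \<inter> V2. \<forall>s b c. cf f s (int t1) b c = L s b c"
    by (rule ck1_exists) (use t_le in \<open>auto simp: L_def\<close>)
  then obtain f where f: "f \<in> V1 \<inter> V2" "\<And>s b c. cf f s (int t1) b c = L s b c" by blast
  moreover have "epC s j f = g s j" if "j \<le> t3 - 1" for s j
  proof -
    have "j < t3" using that t_pos by linarith
    moreover have "((s \<noteq> odd j) \<noteq> odd (int j)) = s" by auto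
    ultimately show ?thesis by (simp add: epC_def f(2) L_def)
  qed
  ultimately show ?thesis by blast
qed

text \<open>The carrier is left open: the quotient uses all of \<open>V\<close>, while
  irreducibility uses the kernel of one of the two copies.\<close>

lemma chain_C:
  assumes S: "S \<subseteq> V" "\<And>f. f \<in> S \<Longrightarrow> BX k1 k2 k3 f \<in> S" "\<And>f. f \<in> S \<Longrightarrow> BY k1 k2 k3 f \<in> S"
    "\<And>f g. f \<in> S \<Longrightarrow> g \<in> S \<Longrightarrow> vadd f g \<in> S" "\<And>f x. f \<in> S \<Longrightarrow> vsmul x f \<in> S"
    and surj: "\<And>g. \<exists>f\<in>S. \<forall>j\<le>t3 - 1. epC s j f = g j"
  shows "reflected_chain S (BX k1 k2 k3) (BY k1 k2 k3) (epC s) (t3 - 1) (of_real k2) (of_real k1) (of_real (- K - real n - 1))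
   (\<lambda>j. \<i> * dki k3 (int j + 1))
   (\<lambda>j. - of_real (1/2) - of_real (k2 + k3) * sg (int j))
   (\<lambda>j. if j = 0 then 0 else - \<i> * dki k2 (int n - int t1 - int j + 1))
   (\<lambda>j. sg (int j) * of_real (real t1 + real j + k1 + k3 + 1/2))
   (\<lambda>j. if j = 0 then 0 else - \<i> * sg (int j) * dki k2 (int n - int t1 - int j + 1))"
proof (unfold_locales, goal_cases)
  case 1 then show ?case using odd_t by simp
next
  case (4 f j) then show ?case by (rule_tac epC_X)
next
  case (5 f j) then show ?case using epC_Y[of f j] t_pos S(1) by auto
next
  case 6 show ?case using t_pos dki_zero_iff(3)[of "int (t3 - 1) + 1"] by (simp del: dki_int_Suc)
next
  case (7 j) then show ?case using dki_zero_iff(3)[of "int j + 1"] by (auto simp del: dki_int_Suc)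
next
  case (10 f j)
  have f: "f \<in> V" using 10 S(1) by auto
  show ?case unfolding epC_def
    by (rule rel_neg[OF _ _ f]) (use t_pos in \<open>simp_all add: k_eq of_nat_diff field_simps\<close>)
next
  case 11 then show ?case using t_pos by (simp add: O_theta_def k_eq of_nat_diff field_simps)
next
  case 12 then show ?case using t_pos by (simp add: O_theta_def k_eq of_nat_diff field_simps sg_def)
next
  case 13
  show ?case
    using t_pos odd_t odd_n by (simp add: O_theta_def O_phi_def k_eq of_nat_diff field_simps sg_def dki_def del: dki_int_Suc)
next
  case (14 j)
  have t3: "Suc (t3 - 1) = t3" using t_pos by simp
  have "real j + 1 \<le> real t3" using 14 t_pos by linarith+
  then show ?case unfolding t3 using odd_t t_pos
    by (cases "even j") (auto simp: O_theta_def k_eq of_nat_diff sg_def complex_eq_iff field_simps)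
next
  case (15 g)
  then show ?case by (rule_tac surj)
qed (use S in \<open>simp_all add: epC_def[abs_def] lin_fun_cf\<close>)

section \<open>The chain on the triple intersection\<close>

definition dW :: nat where "dW = n - t1 - t2 - t3"

definition epW :: "bool \<Rightarrow> nat \<Rightarrow> cpol \<Rightarrow> complex" where
  "epW s j f = cf f s (int t1 + int dW - int j) (int t2 + int j) (int t3)"

abbreviation M where "M \<equiv> V1 \<inter> V2 \<inter> V3"

lemma dW_int: "int dW = int n - int t1 - int t2 - int t3" using t_le by (simp add: dW_def)
lemma even_dW: "even dW" using odd_n odd_t t_le by (simp add: dW_def)
lemma sg_dW: "sg (int dW) = 1" using even_dW by (simp add: sg_def)

lemma epW_Y:
  assumes f: "f \<in> M"
  shows "epW s j (BY k1 k2 k3 f) = (if j = dW then 0 else \<i> * sp s * sg (int j) * dki k2 (int t2 + int j + 1)) * epW s (Suc j) f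
     + sg (int j) * of_real (real t1 + real dW - real j + t3 + k1 + k3 + 1/2) * epW s j f"
proof -
  have e: "epW s (Suc j) f = cf f s (int t1 + int dW - int j - 1) (int t2 + int j + 1) (int t3)"
    by (simp add: epW_def algebra_simps)
  have z: "epW s (Suc j) f = 0" if "j = dW" unfolding e using that f by (simp add: V1_iff)
  have Y: "cf (BY k1 k2 k3 f) s (int t1 + int dW - int j) (int t2 + int j) (int t3)
    = - sg (int t1 + int dW - int j) * (of_real (of_int (int t1 + int dW - int j) + t3 + k1 + k3 + 1/2) * cf f s (int t1 + int dW - int j) (int t2 + int j) (int t3)
    + \<i> * sp s * dki k2 (int t2 + int j + 1) * cf f s (int t1 + int dW - int j - 1) (int t2 + int j + 1) (int t3))"
    using f by (intro Y_plane3) (auto simp: V3_iff)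
  show ?thesis using z unfolding e epW_def[of s j] Y
    by (cases "j = dW") (simp_all add: sg_dW sg_diff sg_add algebra_simps)
qed

lemma epW_X:
  assumes f: "f \<in> M"
  shows "epW s j (BX k1 k2 k3 f) = sg (int j) * of_real (real t2 + real j + t3 + k2 + k3 + 1/2) * epW s j f
     + (if j = 0 then 0 else - \<i> * sp s * sg (int j) * dki k1 (int t1 + int dW - int j + 1)) * epW s (j - 1) f"
proof -
  have e: "epW s (j - 1) f = cf f s (int t1 + int dW - int j + 1) (int t2 + int j - 1) (int t3)" if "j \<noteq> 0"
    using that by (cases j) (simp_all add: epW_def algebra_simps)
  have z: "cf f s (int t1 + int dW - int j + 1) (int t2 + int j - 1) (int t3) = 0" if "j = 0"
    using that f by (simp add: V2_iff)
  have X: "cf (BX k1 k2 k3 f) s (int t1 + int dW - int j) (int t2 + int j) (int t3)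
    = - sg (int t2 + int j) * (of_real (of_int (int t2 + int j) + t3 + k2 + k3 + 1/2) * cf f s (int t1 + int dW - int j) (int t2 + int j) (int t3)
    - \<i> * sp s * dki k1 (int t1 + int dW - int j + 1) * cf f s (int t1 + int dW - int j + 1) (int t2 + int j - 1) (int t3))"
    using f by (intro X_plane3) (auto simp: V3_iff)
  show ?thesis unfolding epW_def[of s j] X using e z
    by (cases "j = 0") (simp_all add: sg_dW sg_diff sg_add algebra_simps)
qed

lemma epW_surj:
  "\<exists>f\<in>M. \<forall>s. \<forall>j\<le>dW. epW s j f = g s j"
proof -
  define L where "L s a b = (if int t2 \<le> b \<and> int t1 \<le> a \<and> a + b = int n - int t3 then g s (nat (b - int t2)) else 0)" for s a b
  have "\<exists>f\<in>V3. (\<forall>s a b. cf f s a b (int t3) = L s a b)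
    \<and> ((\<forall>s a b. a < int t1 \<longrightarrow> L s a b = 0) \<longrightarrow> f \<in> V1)
    \<and> ((\<forall>s a b. b < int t2 \<longrightarrow> L s a b = 0) \<longrightarrow> f \<in> V2)"
    by (rule ck3_exists) (use t_le in \<open>auto simp: L_def\<close>)
  then obtain f where f: "f \<in> V3" "\<And>s a b. cf f s a b (int t3) = L s a b"
    "(\<forall>s a b. a < int t1 \<longrightarrow> L s a b = 0) \<longrightarrow> f \<in> V1"
    "(\<forall>s a b. b < int t2 \<longrightarrow> L s a b = 0) \<longrightarrow> f \<in> V2" by blast
  have "f \<in> V1" by (rule f(3)[rule_format]) (auto simp: L_def)
  moreover have "f \<in> V2" by (rule f(4)[rule_format]) (auto simp: L_def)
  moreover have "epW s j f = g s j" if "j \<le> dW" for s j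
    using that dW_int by (simp add: epW_def f(2) L_def)
  ultimately show ?thesis using f(1) by blast
qed

text \<open>In these coordinates \<open>X\<close> is bidiagonal with diagonal
  \<open>O_theta dW (k1 + N)\<close>, where \<open>N = (n + 1) / 2\<close>. It takes the role of
  \<open>Q\<close>, the chain is generated by \<open>Y\<close>, and no reflection occurs.\<close>

lemma chain_W:
  "direct_chain M (BX k1 k2 k3) (BY k1 k2 k3) (epW s) dW
    (of_real (k1 + (real n + 1) / 2)) (of_real (k2 + (real n + 1) / 2)) (of_real (k3 + (real n + 1) / 2))
   (\<lambda>j. if j = dW then 0 else \<i> * sp s * sg (int j) * dki k2 (int t2 + int j + 1))
   (\<lambda>j. sg (int j) * of_real (real t1 + real dW - real j + t3 + k1 + k3 + 1/2))
   (\<lambda>j. 0)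
   (\<lambda>j. sg (int j) * of_real (real t2 + real j + t3 + k2 + k3 + 1/2))
   (\<lambda>j. if j = 0 then 0 else - \<i> * sp s * sg (int j) * dki k1 (int t1 + int dW - int j + 1))"
proof -
  obtain D where n: "n = t1 + t2 + t3 + D" by (metis t_le le_Suc_ex)
  then have dW: "dW = D" unfolding dW_def by simp
  have rn: "complex_of_nat n = of_nat t1 + of_nat t2 + of_nat t3 + of_nat D" by (simp add: n)
  show ?thesis
proof (unfold_locales, goal_cases)
  case 1 then show ?case by (rule even_dW)
next
  case (2 f) then show ?case by (simp add: BY_V1 BY_V2 BY_V3)
next
  case (3 f) then show ?case by (simp add: BX_V1 BX_V2 BX_V3)
next
  case (4 f j) then show ?case using epW_Y[of f s j] by simp
next
  case (5 f j) then show ?case using epW_X[of f s j] by simp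
next
  case (7 j) then show ?case using dki_zero_iff(2)[of "int t2 + int j + 1"] by (auto simp: sg_def simp del: dki_int_Suc)
next
  case (10 f j)
  then have f: "f \<in> V" by (simp add: V1_iff)
  have k: "2 * complex_of_real (k2 + (real n + 1) / 2) * of_real (k1 + (real n + 1) / 2)
      - of_real (k3 + (real n + 1) / 2) * (of_nat dW + 1) = 2 * k1 * k2 - 2 * k3 * (k1 + k2 + k3 + n + 1)"
    "2 * complex_of_real (k2 + (real n + 1) / 2) * of_real (k3 + (real n + 1) / 2)
      - of_real (k1 + (real n + 1) / 2) * (of_nat dW + 1) = 2 * k2 * k3 - 2 * k1 * (k1 + k2 + k3 + n + 1)"
    unfolding dW by (simp_all add: k_eq rn field_simps)
  show ?case unfolding k epW_def
    using Mn_YYX[OF odd_n f, of s "int t1 + int dW - int j" "int t2 + int j" "int t3"] by (simp)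
next
  case 11 show ?case unfolding dW by (simp add: O_theta_def k_eq rn field_simps)
next
  case 12 show ?case unfolding dW by (simp add: O_theta_def k_eq rn sg_def field_simps)
next
  case 13
  show ?case
  proof (cases "D = 0")
    case True
    then show ?thesis unfolding dW by (simp add: O_theta_def O_phi_def k_eq rn field_simps)
  next
    case False
    have "even D" using even_dW by (simp only: dW)
    then show ?thesis using False odd_t
      unfolding dW by (simp add: O_theta_def O_phi_def k_eq rn field_simps sg_def dki_def del: dki_int_Suc)
  qed
next
  case (14 j)
  have "real n = real t1 + real t2 + real t3 + real D" by (simp add: n)
  then show ?case using 14 even_dW unfolding dW
    by (cases "even j") (auto simp: O_theta_def k_eq sg_def complex_eq_iff field_simps)
next
  case (15 g)
  then show ?case using epW_surj[of "\<lambda>_. g"] by auto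
next
  case (19 i)
  \<comment> \<open>The factor deciding whether \<open>O_phi\<close> vanishes equals
    \<open>- 2 n - 2 - 2 i\<close> for even \<open>i\<close> and \<open>- 2 i - 2 t3\<close> for odd
    \<open>i\<close>.\<close>
  have "real n = real t1 + real t2 + real t3 + real D" by (simp add: n)
  then show ?case using 19 unfolding dW
    by (intro O_phi_nonzero) (simp_all add: k_eq field_simps)
qed (simp_all add: V1_add V2_add V3_add V1_smul V2_smul V3_smul epW_def[abs_def] lin_fun_cf)
qed

end

section \<open>Module homomorphisms and irreducibility\<close>

context odd_params begin

lemma V_sub: "V1 \<subseteq> V" "V2 \<subseteq> V" "V3 \<subseteq> V"
  by (auto simp: V1_iff V2_iff V3_iff)

text \<open>The two spins give two maps to \<open>W\<close>. They are jointly onto because the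
  functionals of both spins can be prescribed simultaneously, even within the smaller set
  \<open>T\<close>.\<close>

lemma double_hom:
  fixes L :: "bool \<Rightarrow> cpol \<Rightarrow> 'j \<Rightarrow> complex" and ep :: "bool \<Rightarrow> nat \<Rightarrow> cpol \<Rightarrow> complex" and d :: nat
  assumes hom: "\<And>s. bm_hom (L s) (DM k1 k2 k3 S) W"
    and zero: "\<And>s f. f \<in> S \<Longrightarrow> L s f = vzero \<longleftrightarrow> (\<forall>j\<le>d. ep s j f = 0)"
    and presc: "\<And>s u. u \<in> bm_carrier W \<Longrightarrow> \<exists>g. \<forall>f\<in>S. (\<forall>j\<le>d. ep s j f = g j) \<longrightarrow> L s f = u"
    and ker: "\<And>f. f \<in> S \<Longrightarrow> (\<forall>s. \<forall>j\<le>d. ep s j f = 0) \<longleftrightarrow> f \<in> S'"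
    and surj: "\<And>g. \<exists>f\<in>T. \<forall>s. \<forall>j\<le>d. ep s j f = g s j" and T: "T \<subseteq> S"
  shows "\<exists>H. bm_hom H (DM k1 k2 k3 S) (dsum W W) \<and> (\<forall>f\<in>S. H f = vzero \<longleftrightarrow> f \<in> S')
    \<and> (\<forall>u\<in>bm_carrier (dsum W W). \<exists>f\<in>T. H f = u)"
proof (intro exI conjI ballI)
  let ?H = "\<lambda>f. case_sum (L False f) (L True f)"
  show "bm_hom ?H (DM k1 k2 k3 S) (dsum W W)" by (intro bm_hom_pair hom)
  show "?H f = vzero \<longleftrightarrow> f \<in> S'" if "f \<in> S" for f
    unfolding case_sum_eq_vzero zero[OF that] ker[OF that, symmetric] by (metis (full_types))
  fix u assume "u \<in> bm_carrier (dsum W W)"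
  then obtain v w where vw: "v \<in> bm_carrier W" "w \<in> bm_carrier W" "u = case_sum v w"
    by (rule dsum_carrierE)
  obtain g where g: "\<forall>f\<in>S. (\<forall>j\<le>d. ep False j f = g j) \<longrightarrow> L False f = v" using presc[OF vw(1), of False] by (elim exE)
  obtain h where h: "\<forall>f\<in>S. (\<forall>j\<le>d. ep True j f = h j) \<longrightarrow> L True f = w" using presc[OF vw(2), of True] by (elim exE)
  obtain f where f: "f \<in> T" "\<forall>s. \<forall>j\<le>d. ep s j f = (if s then h j else g j)"
    using surj[of "\<lambda>s j. if s then h j else g j"] by (elim bexE)
  have "L False f = v" using g f T by (metis (no_types, lifting) subsetD)
  moreover have "L True f = w" using h f T by (metis (no_types, lifting) subsetD)
  ultimately show "\<exists>f\<in>T. ?H f = u" using f(1) vw(3) by (intro bexI[of _ f]) auto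
qed

lemma reflected_double_hom:
  fixes ep :: "bool \<Rightarrow> nat \<Rightarrow> cpol \<Rightarrow> complex" and d :: nat
  assumes ch: "\<And>s. reflected_chain V (BX k1 k2 k3) (BY k1 k2 k3) (ep s) d a b c (p s) (p' s) (p'' s) (y s) (q s)"
    and ka: "2 * a * b - c * (of_nat d + 1) = 2 * k1 * k2 - 2 * k3 * (k1 + k2 + k3 + n + 1)"
    and ker: "\<And>f. f \<in> V \<Longrightarrow> (\<forall>s. \<forall>j\<le>d. ep s j f = 0) \<longleftrightarrow> f \<in> S'"
    and surj: "\<And>g. \<exists>f\<in>T. \<forall>s. \<forall>j\<le>d. ep s j f = g s j" and T: "T \<subseteq> V"
  shows "\<exists>H. bm_hom H (DM k1 k2 k3 V) (dsum (Omod d a b c) (Omod d a b c)) \<and> (\<forall>f\<in>V. H f = vzero \<longleftrightarrow> f \<in> S')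
    \<and> (\<forall>u\<in>bm_carrier (dsum (Omod d a b c) (Omod d a b c)). \<exists>f\<in>T. H f = u)"
proof -
  have "\<exists>L. bm_hom L (DM k1 k2 k3 V) (Omod d a b c) \<and> (\<forall>f\<in>V. L f = vzero \<longleftrightarrow> (\<forall>j\<le>d. ep s j f = 0))
    \<and> (\<forall>u\<in>bm_carrier (Omod d a b c). \<exists>g. \<forall>f\<in>V. (\<forall>j\<le>d. ep s j f = g j) \<longrightarrow> L f = u)" for s
  proof -
    interpret reflected_chain V "BX k1 k2 k3" "BY k1 k2 k3" "ep s" d a b c "p s" "p' s" "p'' s" "y s" "q s"
      by (rule ch)
    have "bm_hom L (DM k1 k2 k3 V) (Omod d a b c)"
      unfolding DM_def
    proof (rule Omod_hom[OF _ L_add L_smul L_X L_Y X_V Y_V V_add V_smul])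
      show "L f i = 0" if "d < i" for f i using that by (simp add: L_def)
      show "BZ k1 k2 k3 f = vadd (BX k1 k2 k3 (BY k1 k2 k3 f)) (vadd (BY k1 k2 k3 (BX k1 k2 k3 f))
         (vsmul (- (2 * a * b - c * (of_nat d + 1))) f))" if "f \<in> V" for f
        unfolding ka using BZ_eq[OF odd_n that] by simp
    qed
    then show ?thesis using L_zero_iff L_prescribe by (intro exI[of _ L]) (simp add: Omod_def)
  qed
  then have "\<exists>L. \<forall>s. bm_hom (L s) (DM k1 k2 k3 V) (Omod d a b c) \<and> (\<forall>f\<in>V. L s f = vzero \<longleftrightarrow> (\<forall>j\<le>d. ep s j f = 0))
    \<and> (\<forall>u\<in>bm_carrier (Omod d a b c). \<exists>g. \<forall>f\<in>V. (\<forall>j\<le>d. ep s j f = g j) \<longrightarrow> L s f = u)"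
    by (intro choice allI)
  then obtain L where L: "\<forall>s. bm_hom (L s) (DM k1 k2 k3 V) (Omod d a b c) \<and> (\<forall>f\<in>V. L s f = vzero \<longleftrightarrow> (\<forall>j\<le>d. ep s j f = 0))
    \<and> (\<forall>u\<in>bm_carrier (Omod d a b c). \<exists>g. \<forall>f\<in>V. (\<forall>j\<le>d. ep s j f = g j) \<longrightarrow> L s f = u)" by (elim exE)
  show ?thesis by (rule double_hom[OF _ _ _ ker surj T, where L = L]) (use L in blast)+
qed

text \<open>The scalar of \<open>{X,Y} - Z\<close> on \<open>Mn\<close> agrees with the one built
  into \<open>Omod\<close>; this matches the action of \<open>Z\<close>.\<close>

lemma kappa_A: "2 * complex_of_real (- K - real n - 1) * of_real k3 - of_real k2 * (of_nat (t1 - 1) + 1)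
    = 2 * k1 * k2 - 2 * k3 * (k1 + k2 + k3 + n + 1)"
  using t_pos by (simp add: k_eq of_nat_diff field_simps)
lemma kappa_B: "2 * complex_of_real k3 * of_real (- K - real n - 1) - of_real k1 * (of_nat (t2 - 1) + 1)
    = 2 * k1 * k2 - 2 * k3 * (k1 + k2 + k3 + n + 1)"
  using t_pos by (simp add: k_eq of_nat_diff field_simps)
lemma kappa_C: "2 * complex_of_real k2 * of_real k1 - of_real (- K - real n - 1) * (of_nat (t3 - 1) + 1)
    = 2 * k1 * k2 - 2 * k3 * (k1 + k2 + k3 + n + 1)"
  using t_pos by (simp add: k_eq of_nat_diff field_simps)

lemma epA_ker: assumes f: "f \<in> V" shows "(\<forall>s. \<forall>j\<le>t1 - 1. epA s j f = 0) \<longleftrightarrow> f \<in> V1"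
proof
  assume e: "\<forall>s. \<forall>j\<le>t1 - 1. epA s j f = 0"
  show "f \<in> V1"
  proof (rule V1_I[OF f])
    fix s a b assume a: "a < int t1"
    show "cf f s a b (int t3) = 0"
    proof (cases "0 \<le> a \<and> a + b + int t3 = int n")
      case True
      define j where "j = nat a"
      have j: "a = int j" "b = int n - int t3 - int j" "j \<le> t1 - 1" using True a by (auto simp: j_def)
      then show ?thesis using e unfolding epA_def j(1,2) by blast
    next
      case False
      then show ?thesis using Mn_homog[OF f] by auto
    qed
  qed
next
  assume "f \<in> V1"
  moreover have "int j < int t1" if "j \<le> t1 - 1" for j using that t_pos by linarith
  ultimately show "\<forall>s. \<forall>j\<le>t1 - 1. epA s j f = 0" by (simp add: V1_iff epA_def)
qed

lemma epB_ker: assumes f: "f \<in> V" shows "(\<forall>s. \<forall>j\<le>t2 - 1. epB s j f = 0) \<longleftrightarrow> f \<in> V2"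
proof
  assume e: "\<forall>s. \<forall>j\<le>t2 - 1. epB s j f = 0"
  show "f \<in> V2"
  proof (rule V2_I[OF f])
    fix s a b assume b: "b < int t2"
    show "cf f s a b (int t3) = 0"
    proof (cases "0 \<le> b \<and> a + b + int t3 = int n")
      case True
      define j where "j = nat (int t2 - 1 - b)"
      have j: "a = int n + 1 - int t2 - int t3 + int j" "b = int t2 - 1 - int j" "j \<le> t2 - 1"
        using True b by (auto simp: j_def)
      then show ?thesis using e unfolding epB_def j(1,2) by blast
    next
      case False
      then show ?thesis using Mn_homog[OF f] by auto
    qed
  qed
next
  assume "f \<in> V2"
  then show "\<forall>s. \<forall>j\<le>t2 - 1. epB s j f = 0" by (simp add: V2_iff epB_def)
qed

lemma epC_ker: assumes f: "f \<in> V" shows "(\<forall>s. \<forall>j\<le>t3 - 1. epC s j f = 0) \<longleftrightarrow> f \<in> V3"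
proof
  assume e: "\<forall>s. \<forall>j\<le>t3 - 1. epC s j f = 0"
  show "f \<in> V3"
  proof (rule V3_I[OF f])
    fix s b c assume c: "c < int t3"
    show "cf f s (int t1) b c = 0"
    proof (cases "0 \<le> c \<and> int t1 + b + c = int n")
      case True
      define j where "j = nat c"
      have j: "b = int n - int t1 - int j" "c = int j" "j \<le> t3 - 1"
        using True c by (auto simp: j_def)
      have "((s \<noteq> odd j) \<noteq> odd j) = s" by auto
      then show ?thesis using e[rule_format, of j "s \<noteq> odd j"] j(3) unfolding epC_def j(1,2) by simp
    next
      case False
      then show ?thesis using Mn_homog[OF f] by auto
    qed
  qed
next
  assume "f \<in> V3"
  moreover have "int j < int t3" if "j \<le> t3 - 1" for j using that t_pos by linarith
  ultimately show "\<forall>s. \<forall>j\<le>t3 - 1. epC s j f = 0" by (simp add: V3_iff epC_def del: cf_int)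
qed

lemma epW_ker: assumes f: "f \<in> M" shows "(\<forall>s. \<forall>j\<le>dW. epW s j f = 0) \<longleftrightarrow> f \<in> {vzero}"
proof
  assume e: "\<forall>s. \<forall>j\<le>dW. epW s j f = 0"
  have fV: "f \<in> V" "f \<in> V3" using f V_sub by auto
  have "f = vzero"
  proof (rule V3_zero[OF fV(2)])
    fix s a b
    show "cf f s a b (int t3) = 0"
    proof (cases "int t1 \<le> a \<and> int t2 \<le> b \<and> a + b + int t3 = int n")
      case True
      define j where "j = nat (b - int t2)"
      have j: "a = int t1 + int dW - int j" "b = int t2 + int j" "j \<le> dW"
        using True dW_int by (auto simp: j_def)
      then show ?thesis using e unfolding epW_def j(1,2) by blast
    next
      case False
      then show ?thesis using Mn_homog[OF fV(1)] f by (auto simp: V1_iff V2_iff)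
    qed
  qed
  then show "f \<in> {vzero}" by simp
qed (simp add: epW_def cf_vzero)

abbreviation A where "A \<equiv> Omod (t1 - 1) (of_real (- K - real n - 1)) (of_real k3) (of_real k2)"
abbreviation B where "B \<equiv> Omod (t2 - 1) (of_real k3) (of_real (- K - real n - 1)) (of_real k1)"
abbreviation C where "C \<equiv> Omod (t3 - 1) (of_real k2) (of_real k1) (of_real (- K - real n - 1))"

lemma hom_A: "\<exists>H. bm_hom H (DM k1 k2 k3 V) (dsum A A)
   \<and> (\<forall>f\<in>V. H f = vzero \<longleftrightarrow> f \<in> V1)
   \<and> (\<forall>u\<in>bm_carrier (dsum A A). \<exists>f\<in>V2 \<inter> V3. H f = u)"
  using V_sub by (intro reflected_double_hom[OF chain_A kappa_A epA_ker epA_surj]) auto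

lemma hom_B: "\<exists>H. bm_hom H (DM k1 k2 k3 V) (dsum B B)
   \<and> (\<forall>f\<in>V. H f = vzero \<longleftrightarrow> f \<in> V2)
   \<and> (\<forall>u\<in>bm_carrier (dsum B B). \<exists>f\<in>V1 \<inter> V3. H f = u)"
  using V_sub by (intro reflected_double_hom[OF chain_B kappa_B epB_ker epB_surj]) auto

lemma chain_C_V: "reflected_chain V (BX k1 k2 k3) (BY k1 k2 k3) (epC s) (t3 - 1) (of_real k2) (of_real k1) (of_real (- K - real n - 1))
   (\<lambda>j. \<i> * dki k3 (int j + 1))
   (\<lambda>j. - of_real (1/2) - of_real (k2 + k3) * sg (int j))
   (\<lambda>j. if j = 0 then 0 else - \<i> * dki k2 (int n - int t1 - int j + 1))
   (\<lambda>j. sg (int j) * of_real (real t1 + real j + k1 + k3 + 1/2))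
   (\<lambda>j. if j = 0 then 0 else - \<i> * sg (int j) * dki k2 (int n - int t1 - int j + 1))"
proof (rule chain_C)
  fix g :: "nat \<Rightarrow> complex"
  obtain f where "f \<in> V1 \<inter> V2" "\<forall>s. \<forall>j\<le>t3 - 1. epC s j f = g j" using epC_surj[of "\<lambda>_. g"] by auto
  then show "\<exists>f\<in>V. \<forall>j\<le>t3 - 1. epC s j f = g j" by (intro bexI[of _ f]) (auto simp: V1_iff)
qed (auto simp: BX_Mn BY_Mn Mn_vadd Mn_vsmul)

lemma hom_C: "\<exists>H. bm_hom H (DM k1 k2 k3 V) (dsum C C)
   \<and> (\<forall>f\<in>V. H f = vzero \<longleftrightarrow> f \<in> V3)
   \<and> (\<forall>u\<in>bm_carrier (dsum C C). \<exists>f\<in>V1 \<inter> V2. H f = u)"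
  using V_sub by (intro reflected_double_hom[OF chain_C_V kappa_C epC_ker epC_surj]) auto

lemma kappa_W: "2 * complex_of_real (k1 + (real n + 1) / 2) * of_real (k2 + (real n + 1) / 2) - of_real (k3 + (real n + 1) / 2) * (of_nat dW + 1)
    = 2 * k1 * k2 - 2 * k3 * (k1 + k2 + k3 + n + 1)"
proof -
  have n: "n = t1 + t2 + t3 + dW" using t_le unfolding dW_def by simp
  show ?thesis by (subst (1 2 3 4) n) (simp add: k_eq field_simps)
qed

abbreviation W0 where "W0 \<equiv> Omod dW (of_real (k1 + (real n + 1) / 2)) (of_real (k2 + (real n + 1) / 2)) (of_real (k3 + (real n + 1) / 2))"

lemma hom_W: "\<exists>H. bm_hom H (DM k1 k2 k3 M) (dsum W0 W0) \<and> (\<forall>f\<in>M. H f = vzero \<longleftrightarrow> f \<in> {vzero})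
   \<and> (\<forall>u\<in>bm_carrier (dsum W0 W0). \<exists>f\<in>M. H f = u)"
proof -
  have "\<exists>L. bm_hom L (DM k1 k2 k3 M) W0 \<and> (\<forall>f\<in>M. L f = vzero \<longleftrightarrow> (\<forall>j\<le>dW. epW s j f = 0))
    \<and> (\<forall>u\<in>bm_carrier W0. \<exists>g. \<forall>f\<in>M. (\<forall>j\<le>dW. epW s j f = g j) \<longrightarrow> L f = u)" for s
  proof -
    note ch = chain_W[of s]
    interpret direct_chain M "BX k1 k2 k3" "BY k1 k2 k3" "epW s" dW
      "of_real (k1 + (real n + 1) / 2)" "of_real (k2 + (real n + 1) / 2)" "of_real (k3 + (real n + 1) / 2)"
      "\<lambda>j. if j = dW then 0 else \<i> * sp s * sg (int j) * dki k2 (int t2 + int j + 1)"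
      "\<lambda>j. sg (int j) * of_real (real t1 + real dW - real j + t3 + k1 + k3 + 1/2)"
      "\<lambda>j. 0"
      "\<lambda>j. sg (int j) * of_real (real t2 + real j + t3 + k2 + k3 + 1/2)"
      "\<lambda>j. if j = 0 then 0 else - \<i> * sp s * sg (int j) * dki k1 (int t1 + int dW - int j + 1)"
      by (rule ch)
    have "bm_hom L (DM k1 k2 k3 M) W0"
      unfolding DM_def
    proof (rule Omod_hom[OF _ L_add L_smul L_X L_Y Q_V P_V V_add V_smul])
      show "L f i = 0" if "dW < i" for f i using that unfolding L_def by simp
      show "BZ k1 k2 k3 f = vadd (BX k1 k2 k3 (BY k1 k2 k3 f)) (vadd (BY k1 k2 k3 (BX k1 k2 k3 f))
         (vsmul (- (2 * complex_of_real (k1 + (real n + 1) / 2) * of_real (k2 + (real n + 1) / 2) - of_real (k3 + (real n + 1) / 2) * (of_nat dW + 1))) f))" if "f \<in> M" for f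
        unfolding kappa_W using BZ_eq[OF odd_n, of f] that V_sub by auto
    qed
    then show ?thesis using L_zero_iff L_prescribe by (intro exI[of _ L]) (simp add: Omod_def)
  qed
  then have "\<exists>L. \<forall>s. bm_hom (L s) (DM k1 k2 k3 M) W0 \<and> (\<forall>f\<in>M. L s f = vzero \<longleftrightarrow> (\<forall>j\<le>dW. epW s j f = 0))
    \<and> (\<forall>u\<in>bm_carrier W0. \<exists>g. \<forall>f\<in>M. (\<forall>j\<le>dW. epW s j f = g j) \<longrightarrow> L s f = u)"
    by (intro choice allI)
  then obtain L where L: "\<forall>s. bm_hom (L s) (DM k1 k2 k3 M) W0 \<and> (\<forall>f\<in>M. L s f = vzero \<longleftrightarrow> (\<forall>j\<le>dW. epW s j f = 0))
    \<and> (\<forall>u\<in>bm_carrier W0. \<exists>g. \<forall>f\<in>M. (\<forall>j\<le>dW. epW s j f = g j) \<longrightarrow> L s f = u)" by (elim exE)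
  show ?thesis by (rule double_hom[OF _ _ _ epW_ker epW_surj subset_refl, where L = L]) (use L in blast)+
qed

section \<open>Irreducibility of the four modules\<close>

lemma irreducible_A: "bm_irreducible A"
proof -
  interpret reflected_chain V "BX k1 k2 k3" "BY k1 k2 k3" "epA False" "t1 - 1" "of_real (- K - real n - 1)" "of_real k3" "of_real k2"
    "\<lambda>j. - \<i> * sp False * sg (int j) * dki k1 (int j + 1)" "\<lambda>j. sg (int j) * of_real (real n - real j + k2 + k3 + 1/2)"
    "\<lambda>j. 0" "\<lambda>j. sg (int j) * of_real (real j + t3 + k1 + k3 + 1/2)"
    "\<lambda>j. if j = 0 then 0 else \<i> * sp False * sg (int j) * dki k2 (int n - int t3 - int j + 1)"
    by (rule chain_A)
  show ?thesis
  \<comment> \<open>The chain can serve as \<open>ga\<close>: with \<open>p d = 0\<close> and no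
    downward coupling of \<open>X\<close>, its last functional is a left eigenvector, and the
    couplings of \<open>Y\<close> lead down to the first.\<close>
  proof (rule Omod_irreducible[where ga = "epA False" and J = "t1 - 1", OF _ refl ep_Q])
    fix i assume i: "1 \<le> i" "i \<le> t1 - 1"
    then have r: "real i + 1 \<le> real t1" "real (t1 - 1) = real t1 - 1" "real t1 + real t2 + real t3 \<le> real n"
      using t_le by (linarith | simp add: of_nat_diff)+
    \<comment> \<open>The deciding factors are \<open>2 (t1 + t2 - n - 1 - i)\<close> for even
      \<open>i\<close> and \<open>2 (t1 - n - 1 - i)\<close> for odd \<open>i\<close>, both
      negative.\<close>
    have "O_phi (t1 - 1) (of_real (K + real n + 1)) (of_real (- k3)) (of_real k2) i \<noteq> 0"
      by (rule O_phi_nonzero[OF i]) (use r in \<open>simp_all add: k_eq\<close>)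
    then show "O_phi (t1 - 1) (- of_real (- K - real n - 1)) (- of_real k3) (of_real k2) i \<noteq> 0" by (simp add: algebra_simps)
  next
    fix j assume "1 \<le> j" "j \<le> t1 - 1"
    then show "(if j = 0 then 0 else \<i> * sp False * sg (int j) * dki k2 (int n - int t3 - int j + 1)) \<noteq> 0"
      using t_le dki_zero_iff(2)[of "int n - int t3 - int j + 1"] by (auto simp: sg_def)
  next
    fix f assume f: "f \<in> V"
    have "sg (int (t1 - 1)) * of_real (real n - real (t1 - 1) + k2 + k3 + 1/2) = O_theta (t1 - 1) (- of_real (- K - real n - 1)) 0"
      using t_pos odd_t by (simp add: O_theta_def of_nat_diff k_eq sg_def field_simps)
    then show "epA False (t1 - 1) (negX f) = O_theta (t1 - 1) (- of_real (- K - real n - 1)) 0 * epA False (t1 - 1) f"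
      using ep_P[OF f, of "t1 - 1"] p_d by simp
  qed (use ep_lin in auto)
qed

lemma irreducible_B: "bm_irreducible B"
proof -
  interpret reflected_chain V "BX k1 k2 k3" "BY k1 k2 k3" "epB False" "t2 - 1" "of_real k3" "of_real (- K - real n - 1)" "of_real k1"
   "\<lambda>j. if j = t2 - 1 then 0 else - \<i> * sp False * sg (int j) * dki k1 (int n + 2 - int t2 - int t3 + int j)"
   "\<lambda>j. sg (int j) * of_real (real t2 - 1 - real j + t3 + k2 + k3 + 1/2)"
   "\<lambda>j. 0" "\<lambda>j. sg (int j) * of_real (real n + 1 - real t2 + real j + k1 + k3 + 1/2)"
   "\<lambda>j. \<i> * sp False * sg (int j) * dki k2 (int t2 - int j)"
    by (rule chain_B)
  show ?thesis
  proof (rule Omod_irreducible[where ga = "epB False" and J = "t2 - 1", OF _ refl ep_Q])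
    fix i assume i: "1 \<le> i" "i \<le> t2 - 1"
    then have r: "real i + 1 \<le> real t2" "real (t2 - 1) = real t2 - 1" "real t1 + real t2 + real t3 \<le> real n"
      using t_le by (linarith | simp add: of_nat_diff)+
    have "O_phi (t2 - 1) (of_real (- k3)) (of_real (K + real n + 1)) (of_real k1) i \<noteq> 0"
      by (rule O_phi_nonzero[OF i]) (use r in \<open>simp_all add: k_eq\<close>)
    then show "O_phi (t2 - 1) (- of_real k3) (- of_real (- K - real n - 1)) (of_real k1) i \<noteq> 0" by (simp add: algebra_simps)
  next
    fix j assume "1 \<le> j" "j \<le> t2 - 1"
    then show "\<i> * sp False * sg (int j) * dki k2 (int t2 - int j) \<noteq> 0"
      using dki_zero_iff(2)[of "int t2 - int j"] by (auto simp: sg_def)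
  next
    fix f assume f: "f \<in> V"
    have "sg (int (t2 - 1)) * of_real (real t2 - 1 - real (t2 - 1) + t3 + k2 + k3 + 1/2) = O_theta (t2 - 1) (- of_real k3) 0"
      using t_pos odd_t by (simp add: O_theta_def of_nat_diff k_eq sg_def field_simps)
    then show "epB False (t2 - 1) (negX f) = O_theta (t2 - 1) (- of_real k3) 0 * epB False (t2 - 1) f"
      using ep_P[OF f, of "t2 - 1"] by simp
  qed (use ep_lin in auto)
qed

text \<open>The functional \<open>ga J\<close> does not factor through one of the two copies alone, so the kernel of the other
  copy is used as module.\<close>

lemma irreducible_C: "bm_irreducible C"
proof -
  define S where "S = {f \<in> V. \<forall>j\<le>t3 - 1. epC True j f = 0}"
  have epC_lin: "epC s j (vadd f g) = epC s j f + epC s j g" "epC s j (vsmul x f) = x * epC s j f" for s j f g x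
    by (simp_all add: epC_def cf_vadd cf_vsmul del: cf_int)
  have X0: "epC True j (BX k1 k2 k3 f) = 0" if f: "f \<in> S" and j: "j \<le> t3 - 1" for f j
  proof -
    \<comment> \<open>\<open>S\<close> does not control \<open>epC True\<close> at index
      \<open>t3\<close>, but the factor in front of it there is
      \<open>dki k3 (int t3) = 0\<close>.\<close>
    have "dki k3 (int j + 1) * epC True (Suc j) f = 0"
    proof (cases "j = t3 - 1")
      case True
      then have "int j + 1 = int t3" using t_pos by simp
      then have "dki k3 (int j + 1) = 0" by (simp only: dki_zero_iff) simp
      then show ?thesis by (simp only: mult_zero_left)
    next
      case False
      then show ?thesis using f j by (simp add: S_def)
    qed
    then show ?thesis using epC_X[of True j f] f j by (auto simp: S_def epC_lin simp del: dki_int_Suc)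
  qed
  have Y0: "epC True j (BY k1 k2 k3 f) = 0" if f: "f \<in> S" and j: "j \<le> t3 - 1" for f j
    using epC_Y[of f j True] f j t_pos by (auto simp: S_def epC_lin)
  interpret reflected_chain S "BX k1 k2 k3" "BY k1 k2 k3" "epC False" "t3 - 1" "of_real k2" "of_real k1" "of_real (- K - real n - 1)"
   "\<lambda>j. \<i> * dki k3 (int j + 1)"
   "\<lambda>j. - of_real (1/2) - of_real (k2 + k3) * sg (int j)"
   "\<lambda>j. if j = 0 then 0 else - \<i> * dki k2 (int n - int t1 - int j + 1)"
   "\<lambda>j. sg (int j) * of_real (real t1 + real j + k1 + k3 + 1/2)"
   "\<lambda>j. if j = 0 then 0 else - \<i> * sg (int j) * dki k2 (int n - int t1 - int j + 1)"
  proof (rule chain_C)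
    fix g :: "nat \<Rightarrow> complex"
    obtain f where f: "f \<in> V1 \<inter> V2" "\<forall>s. \<forall>j\<le>t3 - 1. epC s j f = (if s then 0 else g j)"
      using epC_surj[of "\<lambda>s j. if s then 0 else g j"] by auto
    then have "f \<in> S" using V_sub by (auto simp: S_def)
    then show "\<exists>f\<in>S. \<forall>j\<le>t3 - 1. epC False j f = g j" using f(2) by (intro bexI[of _ f]) auto
  qed (use X0 Y0 in \<open>auto simp: S_def BX_Mn BY_Mn Mn_vadd Mn_vsmul epC_lin\<close>)
  \<comment> \<open>As \<open>X\<close> is tridiagonal on \<open>epC\<close>, the last
    \<open>epC\<close> need not be an eigenvector. The row \<open>c = 0\<close> is followed instead:
    there \<open>Y\<close> couples an entry to its predecessor only. At its end
    \<open>b = t2\<close> the remaining term of \<open>X\<close> falls into the region of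
    \<open>V_vanish23\<close>, which makes \<open>ga J\<close> a left eigenvector.\<close>
  define ga where "ga j f = cf f False (int t1 + int j) (int n - int t1 - int j) 0" for j :: nat and f
  define J where "J = n - t1 - t2"
  have J: "int J = int n - int t1 - int t2" using t_le by (simp add: J_def)
  show ?thesis
  proof (rule Omod_irreducible[where ga = ga and J = J
      and y' = "\<lambda>j. sg (int j) * (of_int (int t1 + int j) + k1 + k3 + 1/2)"
      and c' = "\<lambda>j. sg (int j) * (\<i> * sp False * dki k2 (int n - int t1 - int j + 1))"])
    fix i assume i: "1 \<le> i" "i \<le> t3 - 1"
    then have r: "real i + 1 \<le> real t3" "real (t3 - 1) = real t3 - 1" "real t1 + real t2 + real t3 \<le> real n"
      using t_le by (linarith | simp add: of_nat_diff)+
    have "O_phi (t3 - 1) (of_real (- k2)) (of_real (- k1)) (of_real (- K - real n - 1)) i \<noteq> 0"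
      by (rule O_phi_nonzero[OF i]) (use r in \<open>simp_all add: k_eq\<close>)
    then show "O_phi (t3 - 1) (- of_real k2) (- of_real k1) (of_real (- K - real n - 1)) i \<noteq> 0" by simp
  next
    fix f assume "f \<in> S"
    show "ga 0 f = epC False 0 f" by (simp add: ga_def epC_def)
  next
    fix j f assume f: "f \<in> S" and j: "1 \<le> j" "j \<le> J"
    have fV: "f \<in> V" using f by (simp add: S_def)
    have e: "ga (j - 1) f = cf f False (int t1 + int j - 1) (int n - int t1 - int j + 1) 0"
      using j by (simp add: ga_def of_nat_diff algebra_simps)
    show "ga j (negY f) = sg (int j) * (of_int (int t1 + int j) + k1 + k3 + 1/2) * ga j f
       + sg (int j) * (\<i> * sp False * dki k2 (int n - int t1 - int j + 1)) * ga (j - 1) f"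
      unfolding e ga_def[of j] cf_vsmul Mn_Y_triangular[OF fV]
      by (simp add: sg_add algebra_simps)
  next
    fix j assume j: "1 \<le> j" "j \<le> J"
    have "int j \<le> int n - int t1 - int t2" using j J by simp
    then show "sg (int j) * (\<i> * sp False * dki k2 (int n - int t1 - int j + 1)) \<noteq> 0"
      using dki_zero_iff(2)[of "int n - int t1 - int j + 1"] t_pos by (auto simp: sg_def)
  next
    fix f assume f: "f \<in> S"
    have fV: "f \<in> V" using f by (simp add: S_def)
    have "cf f False (int t1 + int J + 1) (int t2 - 1) 0 = 0"
      using V_vanish23[OF fV] t_pos by simp
    then have "cf (BX k1 k2 k3 f) False (int t1 + int J) (int t2) 0
      = - (of_real (t2 + k2 + k3 + 1/2) * cf f False (int t1 + int J) (int t2) 0)"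
      unfolding Mn_X_triangular[OF fV] by (simp add: algebra_simps)
    moreover have "int n - int t1 - int J = int t2" using J by simp
    ultimately show "ga J (negX f) = O_theta (t3 - 1) (- of_real k2) 0 * ga J f"
      using t_pos by (simp add: ga_def cf_vsmul O_theta_def of_nat_diff k_eq field_simps)
  next
    fix f assume f: "f \<in> S" "\<And>j. j \<le> t3 - 1 \<Longrightarrow> epC False j f = 0"
    have fV: "f \<in> V" using f by (simp add: S_def)
    have "\<forall>s. \<forall>j\<le>t3 - 1. epC s j f = 0"
    proof (intro allI impI)
      fix s j assume "j \<le> t3 - 1"
      then show "epC s j f = 0" using f by (cases s) (auto simp: S_def)
    qed
    then have "f \<in> V3" using epC_ker[OF fV] by blast
    then show "ga J f = 0" using t_pos unfolding V3_iff ga_def by simp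
  next
    show "lin_fun (ga J)" unfolding ga_def[abs_def] by (rule lin_fun_cf)
  qed
qed

lemma irreducible_W: "bm_irreducible W0"
proof -
  interpret direct_chain M "BX k1 k2 k3" "BY k1 k2 k3" "epW False" dW
    "of_real (k1 + (real n + 1) / 2)" "of_real (k2 + (real n + 1) / 2)" "of_real (k3 + (real n + 1) / 2)"
    "\<lambda>j. if j = dW then 0 else \<i> * sp False * sg (int j) * dki k2 (int t2 + int j + 1)"
    "\<lambda>j. sg (int j) * of_real (real t1 + real dW - real j + t3 + k1 + k3 + 1/2)"
    "\<lambda>j. 0"
    "\<lambda>j. sg (int j) * of_real (real t2 + real j + t3 + k2 + k3 + 1/2)"
    "\<lambda>j. if j = 0 then 0 else - \<i> * sp False * sg (int j) * dki k1 (int t1 + int dW - int j + 1)"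
    by (rule chain_W)
  show ?thesis
  proof (rule Omod_irreducible[where ga = "epW False" and J = dW, OF refl ep_Q])
    fix j assume "1 \<le> j" "j \<le> dW"
    then show "(if j = 0 then 0 else - \<i> * sp False * sg (int j) * dki k1 (int t1 + int dW - int j + 1)) \<noteq> 0"
      using dki_zero_iff(1)[of "int t1 + int dW - int j + 1"] by (auto simp: sg_def)
  next
    fix f assume "f \<in> M"
    then have "epW False dW (BY k1 k2 k3 f) = of_real (real t1 + t3 + k1 + k3 + 1/2) * epW False dW f"
      using ep_P[of f dW] sg_dW by simp
    moreover have "complex_of_real (real t1 + t3 + k1 + k3 + 1/2) = O_theta dW (of_real (k2 + (real n + 1) / 2)) 0"
    proof -
      have n: "n = t1 + t2 + t3 + dW" using t_le unfolding dW_def by simp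
      show ?thesis by (subst n) (simp add: O_theta_def k_eq field_simps)
    qed
    ultimately show "epW False dW (BY k1 k2 k3 f) = O_theta dW (of_real (k2 + (real n + 1) / 2)) 0 * epW False dW f"
      by simp
  qed (use ep_lin in auto)
qed

section \<open>Assembling the quotients\<close>

lemma vzero_M: "vzero \<in> M"
proof -
  have "vzero \<in> V" by (simp add: Mn_iff cf_vzero D_cf_def)
  then show ?thesis by (simp add: V1_iff V2_iff V3_iff cf_vzero)
qed

text \<open>\<open>H2\<close> vanishes on \<open>TA\<close> and \<open>H1\<close> on
  \<open>TB\<close>, so the sum of two separate lifts has any prescribed pair of images.\<close>

lemma quotient_pair:
  assumes H1: "bm_hom H1 (DM k1 k2 k3 V) W1" "\<forall>f\<in>V. H1 f = vzero \<longleftrightarrow> f \<in> S1" "\<forall>u\<in>bm_carrier W1. \<exists>f\<in>TA. H1 f = u"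
    and H2: "bm_hom H2 (DM k1 k2 k3 V) W2" "\<forall>f\<in>V. H2 f = vzero \<longleftrightarrow> f \<in> S2" "\<forall>u\<in>bm_carrier W2. \<exists>f\<in>TB. H2 f = u"
    and S: "S \<subseteq> V" "\<And>f g. f \<in> S \<Longrightarrow> g \<in> S \<Longrightarrow> vadd f g \<in> S"
    and T: "TA \<subseteq> S \<inter> S2" "TB \<subseteq> S \<inter> S1"
  shows "bm_quot_isomorphic (DM k1 k2 k3 S) (S \<inter> S1 \<inter> S2) (dsum W1 W2)"
proof (rule bm_quot_isomorphic_pairI)
  show "bm_hom H1 (DM k1 k2 k3 S) W1" "bm_hom H2 (DM k1 k2 k3 S) W2"
    using bm_hom_subset[OF H1(1), of "DM k1 k2 k3 S"] bm_hom_subset[OF H2(1), of "DM k1 k2 k3 S"] S(1)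
    by (simp_all add: DM_def)
  show "{v \<in> bm_carrier (DM k1 k2 k3 S). H1 v = vzero \<and> H2 v = vzero} = S \<inter> S1 \<inter> S2"
    using H1(2) H2(2) S(1) by (auto simp: DM_def)
  fix u w assume "u \<in> bm_carrier W1" "w \<in> bm_carrier W2"
  then obtain f g where f: "f \<in> TA" "H1 f = u" and g: "g \<in> TB" "H2 g = w" using H1(3) H2(3) by meson
  have V: "f \<in> V" "g \<in> V" using f g T S by auto
  then have "H2 f = vzero" "H1 g = vzero" using H1(2) H2(2) f g T by auto
  then have "H1 (vadd f g) = u" "H2 (vadd f g) = w"
    using H1(1) H2(1) V f g by (auto simp: bm_hom_def lin_on_def DM_def vadd_def vzero_def)
  moreover have "vadd f g \<in> S" using f g T by (intro S(2)) auto
  ultimately show "\<exists>v\<in>bm_carrier (DM k1 k2 k3 S). H1 v = u \<and> H2 v = w" by (auto simp: DM_def)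
qed

lemma quotient_single:
  assumes H: "bm_hom H (DM k1 k2 k3 S) W" "\<forall>f\<in>S. H f = vzero \<longleftrightarrow> f \<in> S'" "\<forall>u\<in>bm_carrier W. \<exists>f\<in>T. H f = u"
    and "T \<subseteq> S" "S' \<subseteq> S"
  shows "bm_quot_isomorphic (DM k1 k2 k3 S) S' W"
  unfolding bm_quot_isomorphic_def
proof (intro exI conjI)
  show "bm_hom H (DM k1 k2 k3 S) W" by (rule H)
  then have "H ` S \<subseteq> bm_carrier W" by (auto simp: bm_hom_def DM_def)
  moreover have "u \<in> H ` S" if "u \<in> bm_carrier W" for u
  proof -
    obtain f where "f \<in> T" "H f = u" using H(3) \<open>u \<in> bm_carrier W\<close> by auto
    then show ?thesis using assms(4) by auto
  qed
  ultimately show "H ` bm_carrier (DM k1 k2 k3 S) = bm_carrier W" by (auto simp: DM_def)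
  show "{v \<in> bm_carrier (DM k1 k2 k3 S). H v = vzero} = S'" using H(2) assms(5) by (auto simp: DM_def)
qed

end

theorem theorem9p8:
  fixes k1 k2 k3 :: real and n :: nat
  assumes "odd n"
    and "tpar k1 + tpar k2 + tpar k3 \<le> enat n"
  defines "t1 \<equiv> the_enat (tpar k1)" and "t2 \<equiv> the_enat (tpar k2)" and "t3 \<equiv> the_enat (tpar k3)"
    and "K \<equiv> k1 + k2 + k3" and "N \<equiv> (real n + 1) / 2"
    and "M \<equiv> Mnx1 k1 k2 k3 n \<inter> Mnx2 k1 k2 k3 n \<inter> Mnx3 k1 k2 k3 n"
  defines "W0 \<equiv> Omod (n - t1 - t2 - t3) (of_real (k1 + N)) (of_real (k2 + N)) (of_real (k3 + N))"
    and "A \<equiv> Omod (t1 - 1) (of_real (- K - real n - 1)) (of_real k3) (of_real k2)"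
    and "B \<equiv> Omod (t2 - 1) (of_real k3) (of_real (- K - real n - 1)) (of_real k1)"
    and "C \<equiv> Omod (t3 - 1) (of_real k2) (of_real k1) (of_real (- K - real n - 1))"
  shows "bm_isomorphic (DM k1 k2 k3 M) (dsum W0 W0)
    \<and> bm_quot_isomorphic (DM k1 k2 k3 (Mn k1 k2 k3 n)) (Mnx1 k1 k2 k3 n) (dsum A A)
    \<and> bm_quot_isomorphic (DM k1 k2 k3 (Mn k1 k2 k3 n)) (Mnx2 k1 k2 k3 n) (dsum B B)
    \<and> bm_quot_isomorphic (DM k1 k2 k3 (Mn k1 k2 k3 n)) (Mnx3 k1 k2 k3 n) (dsum C C)
    \<and> bm_quot_isomorphic (DM k1 k2 k3 (Mnx1 k1 k2 k3 n)) M (dsum (dsum B B) (dsum C C))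
    \<and> bm_quot_isomorphic (DM k1 k2 k3 (Mnx2 k1 k2 k3 n)) M (dsum (dsum A A) (dsum C C))
    \<and> bm_quot_isomorphic (DM k1 k2 k3 (Mnx3 k1 k2 k3 n)) M (dsum (dsum A A) (dsum B B))
    \<and> bm_irreducible W0 \<and> bm_irreducible A \<and> bm_irreducible B \<and> bm_irreducible C"
proof -
  \<comment> \<open>An infinite \<open>tpar\<close> would make the sum infinite, contrary to the
    bound by \<open>enat n\<close>.\<close>
  have fin: "tpar k1 \<noteq> \<infinity>" "tpar k2 \<noteq> \<infinity>" "tpar k3 \<noteq> \<infinity>"
    using assms(2) by (cases "tpar k1"; cases "tpar k2"; cases "tpar k3"; simp)+
  have half: "odd (the_enat (tpar k)) \<and> k = - real (the_enat (tpar k)) / 2" if "tpar k \<noteq> \<infinity>" for k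
  proof -
    obtain m :: nat where m: "odd m" "2 * k = - real m" using \<open>tpar k \<noteq> \<infinity>\<close> by (auto simp: tpar_def split: if_splits)
    have "- (2 * k) = real m" using m(2) by simp
    then have "- 2 * k = real m" by simp
    then have "nat \<lfloor>- 2 * k\<rfloor> = m" by simp
    then show ?thesis using m by (auto simp: tpar_def)
  qed
  have "tpar k1 = enat t1" "tpar k2 = enat t2" "tpar k3 = enat t3"
    using fin by (auto simp: t1_def t2_def t3_def)
  then have "t1 + t2 + t3 \<le> n" using assms(2) by simp
  then interpret odd_params k1 k2 k3 n t1 t2 t3
    using half fin assms(1) by unfold_locales (auto simp: t1_def t2_def t3_def)
  have W0: "W0 = odd_params.W0 k1 k2 k3 n t1 t2 t3" by (simp add: W0_def N_def dW_def)
  obtain HA where HA: "bm_hom HA (DM k1 k2 k3 V) (dsum A A)" "\<forall>f\<in>V. HA f = vzero \<longleftrightarrow> f \<in> V1"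
    "\<forall>u\<in>bm_carrier (dsum A A). \<exists>f\<in>V2 \<inter> V3. HA f = u"
    using hom_A unfolding A_def K_def by blast
  obtain HB where HB: "bm_hom HB (DM k1 k2 k3 V) (dsum B B)" "\<forall>f\<in>V. HB f = vzero \<longleftrightarrow> f \<in> V2"
    "\<forall>u\<in>bm_carrier (dsum B B). \<exists>f\<in>V1 \<inter> V3. HB f = u"
    using hom_B unfolding B_def K_def by blast
  obtain HC where HC: "bm_hom HC (DM k1 k2 k3 V) (dsum C C)" "\<forall>f\<in>V. HC f = vzero \<longleftrightarrow> f \<in> V3"
    "\<forall>u\<in>bm_carrier (dsum C C). \<exists>f\<in>V1 \<inter> V2. HC f = u"
    using hom_C unfolding C_def K_def by blast
  obtain HW where HW: "bm_hom HW (DM k1 k2 k3 M) (dsum W0 W0)" "\<forall>f\<in>M. HW f = vzero \<longleftrightarrow> f \<in> {vzero}"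
    "\<forall>u\<in>bm_carrier (dsum W0 W0). \<exists>f\<in>M. HW f = u"
    using hom_W unfolding W0 M_def by blast
  have M_sub: "vsubspace M"
    unfolding vsubspace_def M_def using vzero_M by (auto intro: V1_add V2_add V3_add V1_smul V2_smul V3_smul)
  have "bm_isomorphic (DM k1 k2 k3 M) (dsum W0 W0)"
    using M_sub by (intro bm_isomorphicI quotient_single[OF HW]) (auto simp: DM_def vsubspace_def)
  moreover have "bm_quot_isomorphic (DM k1 k2 k3 V) V1 (dsum A A)" "bm_quot_isomorphic (DM k1 k2 k3 V) V2 (dsum B B)"
    "bm_quot_isomorphic (DM k1 k2 k3 V) V3 (dsum C C)"
    using V_sub by (auto intro!: quotient_single[OF HA] quotient_single[OF HB] quotient_single[OF HC])
  moreover have "bm_quot_isomorphic (DM k1 k2 k3 V1) (V1 \<inter> V2 \<inter> V3) (dsum (dsum B B) (dsum C C))"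
    by (rule quotient_pair[OF HB HC]) (use V_sub V1_add in auto)
  moreover have "bm_quot_isomorphic (DM k1 k2 k3 V2) (V2 \<inter> V1 \<inter> V3) (dsum (dsum A A) (dsum C C))"
    by (rule quotient_pair[OF HA HC]) (use V_sub V2_add in auto)
  moreover have "bm_quot_isomorphic (DM k1 k2 k3 V3) (V3 \<inter> V1 \<inter> V2) (dsum (dsum A A) (dsum B B))"
    by (rule quotient_pair[OF HA HB]) (use V_sub V3_add in auto)
  moreover have "V2 \<inter> V1 \<inter> V3 = M" "V3 \<inter> V1 \<inter> V2 = M" by (auto simp: M_def)
  ultimately show ?thesis
    using irreducible_A irreducible_B irreducible_C irreducible_W
    unfolding W0 A_def B_def C_def K_def M_def by simp
qed

end
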